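(* Consider the iterates $\{x_k\}_{k\ge 0}$ generated by the TR-SSQP method (described in the context) applied to $\min_{x\in\mathbb{R}^d} f(x)=\mathbb{E}_{\xi\sim\mathcal P}[F(x;\xi)]$ subject to $c(x)=0$, from any initial point $x_0\in\mathbb{R}^d$ and any initial momentum $m_{-1}\in\mathbb{R}^d$. Suppose the regularity assumption (R) and the stochastic gradient assumption (S) of the context hold, the latter with moment order $p\in(1,2]$. Suppose that for all $k\ge 0$ $$\Delta_k=\frac{\Delta_0}{(k+1)^{a_1}},\qquad \nu_k=\frac{\nu_0}{(k+1)^{a_2}},\qquad N_k=\lceil N_0(k+1)^{a_3}\rceil,$$ where $\Delta_0>0$, $0<\nu_0\le 1$, $N_0\ge 1$, and the exponents satisfy $$0.5<a_1\le 1,\qquad 0<a_2<2a_1-1,\qquad a_3\ge 0,\qquad a_1+\frac{(a_2+a_3)(p-1)}{p}>1 .$$ Then, with $\lambda_k=-[G_kG_k^\top]^{-1}G_k\nabla f_k$, $$\lim_{k\to\infty}\left(\|\nabla f_k+G_k^\top\lambda_k\|+\|c_k\|\right)=0\qquad\text{almost surely}.$$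
   Context: Notation. $\|\cdot\|$ is the $\ell_2$ norm for vectors and the operator norm for matrices. $f:\mathbb{R}^d\to\mathbb{R}$, $f(x)=\mathbb{E}_{\xi\sim\mathcal P}[F(x;\xi)]$; $c:\mathbb{R}^d\to\mathbb{R}^m$ is deterministic with Jacobian $G(x)=\nabla c(x)\in\mathbb{R}^{m\times d}$. Write $f_k=f(x_k)$, $\nabla f_k=\nabla f(x_k)$, $c_k=c(x_k)$, $G_k=G(x_k)$. $P_k=I-G_k^\top[G_kG_k^\top]^{-1}G_k$ is the orthogonal projection onto $\ker(G_k)$, and $Z_k\in\mathbb{R}^{d\times(d-m)}$ has orthonormal columns spanning $\ker(G_k)$, so $Z_k^\top Z_k=I$, $Z_kZ_k^\top=P_k$. TR-SSQP method. Inputs: $x_0$, $m_{-1}\in\mathbb{R}^d$, deterministic sequences of radii $\Delta_k>0$, momentum weights $\nu_k\in(0,1]$, batch sizes $N_k\in\mathbb{N}$, and fixed $\theta\in(0,1)$, $\eta\in(0,1]$. At iteration $k=0,1,2,\dots$: 1. Draw samples $\xi_k^1,\dots,\xi_k^{N_k}\sim\mathcal P$ and set $g_k=\frac1{N_k}\sum_{i=1}^{N_k}\nabla F(x_k;\xi_k^i)$ and $m_k=(1-\nu_k)m_{k-1}+\nu_kg_k$. 2. Normal step: $v_k=-G_k^\top[G_kG_k^\top]^{-1}c_k$, $\gamma_k=\min\{\theta\Delta_k/\|v_k\|,1\}$ (with $\gamma_k=1$ if $v_k=0$), $w_k=\gamma_kv_k$. 3. Tangential step: let $B_k$ be a symmetric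 $d\times d$ matrix (not necessarily positive definite), $\Delta_k^t=\sqrt{\Delta_k^2-\|w_k\|^2}$, and $\bar q_k(u)=\frac12u^\top Z_k^\top B_kZ_ku+(m_k+B_kw_k)^\top Z_ku$ for $u\in\mathbb{R}^{d-m}$. Let $u_k^{CP}$ be the Cauchy point, i.e. the minimizer of $\bar q_k$ over points $-\alpha Z_k^\top(m_k+B_kw_k)$, $\alpha\ge 0$, with norm at most $\Delta_k^t$. Take any $\bar u_k$ with $\|\bar u_k\|\le\Delta_k^t$ and $\bar q_k(\bar u_k)-\bar q_k(0)\le\eta(\bar q_k(u_k^{CP})-\bar q_k(0))$, and set $\bar t_k=Z_k\bar u_k$. 4. Set $\bar\Delta x_k=w_k+\bar t_k$ and $x_{k+1}=x_k+\bar\Delta x_k$. Filtration. $\mathcal F_k=\sigma(\{\{\xi_j^i\}_{i=1}^{N_j}\}_{j=0}^k)$ contains all randomness up to and including iteration $k$ ($\mathcal F_{-1}$ trivial), so $x_k,c_k,G_k$ are $\mathcal F_{k-1}$-measurable. Assumption (R). There is an open convex set $\Omega\subseteq\mathbb{R}^d$ containing all iterates $\{x_k\}$ such that on $\Omega$: $f$ is continuously differentiable and bounded below by $f_{\inf}$; $\nabla f$ is Lipschitz with constant $L_{\nabla f}>0$; $c$ is continuously differentiable and $G=\nabla c$ is $L_G$-Lipschitz. Moreover there are positive constants $\kappa_B,\kappa_c,\kappa_{\nabla f},\kappa_{1,G},\kappa_{2,G}$ such that for all $k\ge0$: $\|B_k\|\le\kappa_B$, $\|c_k\|\le\kappa_c$,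 $\|\nabla f_k\|\le\kappa_{\nabla f}$, and $\kappa_{1,G}I\preceq G_kG_k^\top\preceq\kappa_{2,G}I$. Assumption (S). For every $k\ge0$, the samples $\{\xi_k^i\}_{i=1}^{N_k}\sim\mathcal P$ are i.i.d. conditional on $\mathcal F_{k-1}$ and $\mathbb{E}[\nabla F(x_k;\xi_k^i)\mid\mathcal F_{k-1}]=\nabla f_k$ for $1\le i\le N_k$. Moreover there exist $p\in(1,2]$ and $\sigma_0\ge0$ with $\mathbb{E}[\|\nabla F(x_k;\xi_k^i)-\nabla f_k\|^p\mid\mathcal F_{k-1}]\le\sigma_0^p$ for $1\le i\le N_k$. *)

theory Defs
  imports "HOL-Analysis.Analysis" "HOL-Probability.Probability"
begin

section \<open>Linear algebra and calculus\<close>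

text \<open>The library norm on \<^typ>\<open>real^'n^'m\<close> is the Frobenius norm, hence a separate operator norm.\<close>

definition opnorm :: "real^'n^'m \<Rightarrow> real" where
  "opnorm A = onorm (\<lambda>v. A *v v)"

definition psd :: "real^'n^'n \<Rightarrow> bool" where
  "psd A \<longleftrightarrow> transpose A = A \<and> (\<forall>v. 0 \<le> v \<bullet> (A *v v))"

definition loewner_le :: "real^'n^'n \<Rightarrow> real^'n^'n \<Rightarrow> bool" (infix "\<preceq>\<^sub>L" 50) where
  "A \<preceq>\<^sub>L B \<longleftrightarrow> psd (B - A)"

definition gradient :: "('a::real_inner \<Rightarrow> real) \<Rightarrow> 'a \<Rightarrow> 'a" where
  "gradient f x = (THE D. GDERIV f x :> D)"

abbreviation jacobian_at :: "(real^'d \<Rightarrow> real^'m) \<Rightarrow> real^'d \<Rightarrow> real^'d^'m" where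
  "jacobian_at c x \<equiv> jacobian c (at x)"

definition lagrange_multiplier :: "real^'d^'m \<Rightarrow> real^'d \<Rightarrow> real^'m" where
  "lagrange_multiplier G g = - (matrix_inv (G ** transpose G) *v (G *v g))"


section \<open>One step of the trust-region method\<close>

definition normal_step :: "real \<Rightarrow> real \<Rightarrow> real^'d^'m \<Rightarrow> real^'m \<Rightarrow> real^'d" where
  "normal_step \<theta> \<Delta> G c =
     (let v = - (transpose G *v (matrix_inv (G ** transpose G) *v c));
          \<gamma> = (if v = 0 then 1 else min (\<theta> * \<Delta> / norm v) 1)
      in \<gamma> *\<^sub>R v)"

text \<open>
  The matrix \<open>Z\<close> has \<open>r = d - m\<close> columns. The number \<open>r\<close> depends on \<open>d\<close> and \<open>m\<close>, and it may be
  zero, so it cannot be the cardinality of an index type. The matrix is represented by the family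
  \<open>Z j\<close> (\<open>j < r\<close>) of its columns, and a vector \<open>u\<close> of dimension \<open>r\<close> by the family \<open>u j\<close> (\<open>j < r\<close>)
  of its entries. Values at indices \<open>j \<ge> r\<close> never matter. The Euclidean norm of \<open>u\<close> is
  \<^term>\<open>L2_set u {..<r}\<close>.
\<close>

definition zmult :: "nat \<Rightarrow> (nat \<Rightarrow> real^'d) \<Rightarrow> (nat \<Rightarrow> real) \<Rightarrow> real^'d" where
  "zmult r Z u = (\<Sum>j<r. u j *\<^sub>R Z j)"

definition ztrans_mult :: "(nat \<Rightarrow> real^'d) \<Rightarrow> real^'d \<Rightarrow> (nat \<Rightarrow> real)" where
  "ztrans_mult Z y = (\<lambda>j. Z j \<bullet> y)"

definition kernel_basis :: "nat \<Rightarrow> real^'d^'m \<Rightarrow> (nat \<Rightarrow> real^'d) \<Rightarrow> bool" where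
  "kernel_basis r G Z \<longleftrightarrow>
     (\<forall>i<r. \<forall>j<r. Z i \<bullet> Z j = (if i = j then 1 else 0)) \<and>
     span (Z ` {..<r}) = {y. G *v y = 0}"

text \<open>In the following three definitions, \<open>h\<close> stands for the vector \<open>m\<^sub>k + B\<^sub>k w\<^sub>k\<close>.\<close>

definition reduced_model ::
  "nat \<Rightarrow> (nat \<Rightarrow> real^'d) \<Rightarrow> real^'d^'d \<Rightarrow> real^'d \<Rightarrow> (nat \<Rightarrow> real) \<Rightarrow> real" where
  "reduced_model r Z B h u =
     1/2 * (zmult r Z u \<bullet> (B *v zmult r Z u)) + h \<bullet> zmult r Z u"

definition cauchy_point ::
  "nat \<Rightarrow> (nat \<Rightarrow> real^'d) \<Rightarrow> real^'d^'d \<Rightarrow> real^'d \<Rightarrow> real \<Rightarrow> (nat \<Rightarrow> real) \<Rightarrow> bool" where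
  "cauchy_point r Z B h \<rho> u \<longleftrightarrow>
     is_arg_min (reduced_model r Z B h)
       (\<lambda>u. (\<exists>\<alpha>\<ge>0. u = (\<lambda>j. - \<alpha> * ztrans_mult Z h j)) \<and> L2_set u {..<r} \<le> \<rho>) u"

definition tangential_solution ::
  "nat \<Rightarrow> real \<Rightarrow> (nat \<Rightarrow> real^'d) \<Rightarrow> real^'d^'d \<Rightarrow> real^'d \<Rightarrow> real \<Rightarrow> (nat \<Rightarrow> real) \<Rightarrow> bool" where
  "tangential_solution r \<eta> Z B h \<rho> u \<longleftrightarrow>
     L2_set u {..<r} \<le> \<rho> \<and>
     (\<exists>u\<^sub>C. cauchy_point r Z B h \<rho> u\<^sub>C \<and>
        reduced_model r Z B h u - reduced_model r Z B h (\<lambda>_. 0)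
          \<le> \<eta> * (reduced_model r Z B h u\<^sub>C - reduced_model r Z B h (\<lambda>_. 0)))"


section \<open>The TR-SSQP method\<close>

text \<open>
  A run of the method for one realisation \<open>\<xi> k i\<close> (\<open>1 \<le> i \<le> N k\<close>) of the samples. The symmetric
  matrices \<open>B k\<close>, the bases \<open>Z k\<close> and the inexact tangential solutions \<open>u k\<close> are free choices of
  the user.
\<close>

definition tr_ssqp_run ::
  "(real^'d \<Rightarrow> 's \<Rightarrow> real) \<Rightarrow> (real^'d \<Rightarrow> real^'m) \<Rightarrow> real \<Rightarrow> real
    \<Rightarrow> (nat \<Rightarrow> real) \<Rightarrow> (nat \<Rightarrow> real) \<Rightarrow> (nat \<Rightarrow> nat) \<Rightarrow> real^'d \<Rightarrow> real^'d
    \<Rightarrow> (nat \<Rightarrow> nat \<Rightarrow> 's) \<Rightarrow> (nat \<Rightarrow> real^'d^'d) \<Rightarrow> (nat \<Rightarrow> nat \<Rightarrow> real^'d) \<Rightarrow> (nat \<Rightarrow> nat \<Rightarrow> real)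
    \<Rightarrow> (nat \<Rightarrow> real^'d) \<Rightarrow> (nat \<Rightarrow> real^'d) \<Rightarrow> bool" where
  "tr_ssqp_run F c \<theta> \<eta> \<Delta> \<nu> N x0 m_init \<xi> B Z u x m \<longleftrightarrow>
     x 0 = x0 \<and>
     (\<forall>k. let r = CARD('d) - CARD('m);
              G = jacobian_at c (x k);
              g = (1 / real (N k)) *\<^sub>R (\<Sum>i\<in>{1..N k}. gradient (\<lambda>y. F y (\<xi> k i)) (x k));
              m_prev = (if k = 0 then m_init else m (k - 1));
              w = normal_step \<theta> (\<Delta> k) G (c (x k));
              h = m k + B k *v w
          in m k = (1 - \<nu> k) *\<^sub>R m_prev + \<nu> k *\<^sub>R g \<and>
             transpose (B k) = B k \<and>
             kernel_basis r G (Z k) \<and>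
             tangential_solution r \<eta> (Z k) (B k) h (sqrt ((\<Delta> k)\<^sup>2 - (norm w)\<^sup>2)) (u k) \<and>
             x (Suc k) = x k + (w + zmult r (Z k) (u k)))"


section \<open>Filtration and conditional sampling\<close>

text \<open>
  The index is shifted by one: \<open>sample_filtration M P N \<xi> k\<close> is the sigma-algebra
  \<open>\<F>\<^bsub>k-1\<^esub>\<close> generated by the samples drawn in the iterations before \<open>k\<close>; it is trivial for \<open>k = 0\<close>.
\<close>

definition sample_filtration ::
  "'w measure \<Rightarrow> 's measure \<Rightarrow> (nat \<Rightarrow> nat) \<Rightarrow> (nat \<Rightarrow> nat \<Rightarrow> 'w \<Rightarrow> 's) \<Rightarrow> nat \<Rightarrow> 'w measure" where
  "sample_filtration M P N \<xi> k =
     sigma (space M)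
       {\<xi> j i -` A \<inter> space M | j i A. j < k \<and> i \<in> {1..N j} \<and> A \<in> sets P}"

definition cond_prob_sub :: "'w measure \<Rightarrow> 'w measure \<Rightarrow> 'w set \<Rightarrow> 'w \<Rightarrow> real" where
  "cond_prob_sub M \<F> E = real_cond_exp M \<F> (indicator E)"

text \<open>
  Conditionally on \<open>\<F>\<close>, the variables \<open>X i\<close> (\<open>i \<in> I\<close>, \<open>I\<close> finite) are independent, each with
  distribution \<open>P\<close>. Since \<open>A i = space P\<close> is allowed, the product rule over \<open>I\<close> covers all
  subfamilies.
\<close>

definition cond_iid ::
  "'w measure \<Rightarrow> 'w measure \<Rightarrow> 's measure \<Rightarrow> 'i set \<Rightarrow> ('i \<Rightarrow> 'w \<Rightarrow> 's) \<Rightarrow> bool" where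
  "cond_iid M \<F> P I X \<longleftrightarrow>
     (\<forall>i\<in>I. X i \<in> measurable M P) \<and>
     (\<forall>i\<in>I. \<forall>A\<in>sets P. AE \<omega> in M. cond_prob_sub M \<F> (X i -` A \<inter> space M) \<omega> = measure P A) \<and>
     (\<forall>A. (\<forall>i\<in>I. A i \<in> sets P) \<longrightarrow>
        (AE \<omega> in M. cond_prob_sub M \<F> {\<omega>\<in>space M. \<forall>i\<in>I. X i \<omega> \<in> A i} \<omega>
                      = (\<Prod>i\<in>I. cond_prob_sub M \<F> (X i -` A i \<inter> space M) \<omega>)))"

end

theory Submission
  imports Defs "HOL-Real_Asymp.Real_Asymp"
begin

text \<open>Let \<open>e k = m k - \<nabla>f (x k)\<close> be the error of the momentum estimate. The theorem splits into a probabilistic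
statement, \<open>\<Sum>k. \<Delta> k * \<parallel>e k\<parallel> < \<infinity>\<close> almost surely, and a deterministic statement about each path for which
this sum converges.

Deterministic part. The step has norm at most \<open>\<Delta> k\<close>. Its normal component scales the linearised
constraint by a factor \<open>1 - \<gamma>\<close>, and its tangential component achieves a fixed fraction of the decrease of the model
at the Cauchy point. Therefore the merit function \<open>f + \<mu> * \<parallel>c\<parallel>\<close>, with \<open>\<mu>\<close> large enough, decreases by at
least a multiple of \<open>\<Delta> k\<close> times the residual, up to \<open>O(\<Delta> k * \<parallel>e k\<parallel> + (\<Delta> k)\<^sup>2)\<close>
(\<open>merit_decrease\<close>). The merit function is bounded below, so \<open>\<Delta> k\<close> times the residual is summable.
Since \<open>\<Sum>k. \<Delta> k\<close> diverges, since \<open>\<Sum>k. (\<Delta> k)\<^sup>2\<close> converges, and since the residual changes by \<open>O(\<Delta> k)\<close> per iteration,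
the residual tends to zero (\<open>weighted_summable_imp_tendsto_zero\<close>).

Probabilistic part. The error is the sum of a drift, caused by the change of \<open>\<nabla>f\<close> along the iterates,
and the moving average of the mean-zero batch errors. Both obey recursions
\<open>y (k+1) \<le> (1 - \<nu> (k+1)) * y k + O(\<nu> (k+1) * (k+2) powr - \<beta>)\<close>, for which \<open>y k = O((k+1) powr - \<beta>)\<close>
(\<open>momentum_recursion_decay\<close>). For the norm of the drift, \<open>\<beta> = a1 - a2\<close>; it is summable against
\<open>\<Delta> k\<close> as \<open>2 * a1 - a2 > 1\<close>. For the \<open>p\<close>-th moment of the noise, \<open>\<beta> = (a2 + a3) * (p - 1)\<close>, so the noise is
of size \<open>(k+1) powr - (\<beta> / p)\<close>, which is summable against \<open>\<Delta> k\<close> by the last condition on the exponents. That recursion uses an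
inequality of von Bahr and Esseen type: for \<open>1 < p \<le> 2\<close>, the addition of a martingale difference \<open>b\<close> increases the
\<open>p\<close>-th moment by at most \<open>6 * E \<parallel>b\<parallel> powr p\<close> (\<open>norm_powr_martingale_step\<close>). It is applied to the samples of a
batch one after the other; a sample stays unbiased conditionally on the earlier samples of the batch
(\<open>cond_exp_batch_algebra\<close>), because it is independent of them and of the past.\<close>

section \<open>Real sequences and powers of norms\<close>

text \<open>The exponential averaging with weights \<open>\<nu>0 / (k + 2) powr a\<close>, \<open>a < 1\<close>, forgets the past faster than the power
\<open>(k + 1) powr - \<beta>\<close> decays, so the decay rate of the input is inherited by \<open>y\<close>.\<close>

lemma momentum_recursion_decay:
  fixes y :: "nat \<Rightarrow> real" and \<nu>0 a \<beta> C :: real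
  assumes \<nu>0: "0 < \<nu>0" "\<nu>0 \<le> 1" and a: "0 < a" "a < 1" and "0 \<le> \<beta>" "0 \<le> C"
    and nonneg: "\<And>k. 0 \<le> y k"
    and rec: "\<And>k. y (Suc k) \<le> (1 - \<nu>0 / real (k + 2) powr a) * y k
                     + C * (\<nu>0 / real (k + 2) powr a) * real (k + 2) powr (- \<beta>)"
  obtains D where "0 \<le> D" "\<And>k. y k \<le> D * real (k + 1) powr (- \<beta>)"
proof -
  define \<nu> where "\<nu> k = \<nu>0 / real (k + 2) powr a" for k :: nat
  have \<nu>: "0 < \<nu> k" "\<nu> k \<le> 1" for k
  proof -
    have "1 \<le> real (k + 2) powr a" using a by (intro ge_one_powr_ge_zero) auto
    then show "0 < \<nu> k" "\<nu> k \<le> 1" using \<nu>0 unfolding \<nu>_def by (auto simp: divide_simps)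
  qed
  \<comment> \<open>From some \<open>K\<close> on, \<open>\<beta> / (k + 1) \<le> \<nu> k / 2\<close>, which makes the induction step below work.\<close>
  have "((\<lambda>k. \<beta> / real (k + 1) * (2 * real (k + 2) powr a)) \<longlonglongrightarrow> 0)"
    using a by real_asymp
  then have "\<forall>\<^sub>F k in sequentially. \<beta> / real (k + 1) * (2 * real (k + 2) powr a) < \<nu>0"
    using \<nu>0 by (intro order_tendstoD(2)) auto
  then obtain K where K: "\<And>k. k \<ge> K \<Longrightarrow> \<beta> / real (k + 1) * (2 * real (k + 2) powr a) < \<nu>0"
    unfolding eventually_sequentially by auto
  \<comment> \<open>The summand \<open>4 * C\<close> serves the induction step, the sum the indices up to \<open>K\<close>.\<close>
  define D where "D = 4 * C + (\<Sum>j\<le>K. y j * real (j + 1) powr \<beta>)"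
  have D4: "4 * C \<le> D" unfolding D_def using nonneg by (auto intro!: sum_nonneg)
  have small: "y k \<le> D * real (k + 1) powr (- \<beta>)" if "k \<le> K" for k
  proof -
    have "y k * real (k + 1) powr \<beta> \<le> (\<Sum>j\<le>K. y j * real (j + 1) powr \<beta>)"
      using that nonneg by (intro member_le_sum) auto
    also have "\<dots> \<le> D" using \<open>0 \<le> C\<close> by (simp add: D_def)
    finally have "y k * real (k + 1) powr \<beta> * real (k + 1) powr (- \<beta>) \<le> D * real (k + 1) powr (- \<beta>)"
      by (intro mult_right_mono) auto
    then show ?thesis by (simp add: mult.assoc flip: powr_add)
  qed
  have "y k \<le> D * real (k + 1) powr (- \<beta>)" for k
  proof (induction k)
    case 0
    then show ?case using small[of 0] by simp
  next
    case (Suc k)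
    show ?case
    proof (cases "Suc k \<le> K")
      case False
      then have "K \<le> k" by simp
      have "\<beta> / real (k + 1) \<le> \<nu> k / 2"
        using K[OF \<open>K \<le> k\<close>] by (simp add: \<nu>_def field_simps)
      then have "\<beta> * (1 / real (k + 1)) \<le> \<nu> k / 2" by simp
      have "(real (k + 2) / real (k + 1)) powr \<beta> = (1 + 1 / real (k + 1)) powr \<beta>"
        by (simp add: field_simps)
      also have "\<dots> \<le> exp (1 / real (k + 1)) powr \<beta>"
        using \<open>0 \<le> \<beta>\<close> by (intro powr_mono2) (auto simp: add_nonneg_nonneg exp_ge_add_one_self)
      also have "\<dots> \<le> exp (\<nu> k / 2)"
        using \<open>\<beta> * (1 / real (k + 1)) \<le> \<nu> k / 2\<close> by (simp add: powr_def mult.commute)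
      finally have ratio: "(real (k + 2) / real (k + 1)) powr \<beta> \<le> exp (\<nu> k / 2)" .
      have "(1 - \<nu> k) * (real (k + 2) / real (k + 1)) powr \<beta> \<le> exp (- \<nu> k) * exp (\<nu> k / 2)"
        using \<nu>[of k] exp_ge_add_one_self[of "- \<nu> k"] by (intro mult_mono ratio) auto
      also have "\<dots> = exp (- (\<nu> k / 2))" by (simp flip: exp_add)
      also have "\<dots> = inverse (exp (\<nu> k / 2))" by (simp add: exp_minus)
      also have "\<dots> \<le> inverse (1 + \<nu> k / 2)"
        using \<nu>(1)[of k] by (intro le_imp_inverse_le exp_ge_add_one_self) auto
      also have "\<dots> \<le> 1 - \<nu> k / 4"
      proof -
        have "1 \<le> (1 - \<nu> k / 4) * (1 + \<nu> k / 2)"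
          using mult_nonneg_nonneg[of "\<nu> k" "1 - \<nu> k"] \<nu>[of k]
          by (simp add: algebra_simps)
        then show ?thesis using \<nu>[of k] by (simp add: field_simps)
      qed
      finally have fac: "(1 - \<nu> k) * (real (k + 2) / real (k + 1)) powr \<beta> \<le> 1 - \<nu> k / 4" .
      define s where "s = real (k + 2) powr (- \<beta>)"
      have s: "0 \<le> s" by (simp add: s_def)
      have shift: "real (k + 1) powr (- \<beta>) = (real (k + 2) / real (k + 1)) powr \<beta> * s"
        unfolding s_def by (simp add: powr_divide powr_minus field_simps)
      have "y (Suc k) \<le> (1 - \<nu> k) * y k + C * \<nu> k * s"
        using rec[of k] by (simp add: \<nu>_def s_def)
      also have "\<dots> \<le> (1 - \<nu> k) * (D * real (k + 1) powr (- \<beta>)) + C * \<nu> k * s"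
        using Suc.IH \<nu>[of k] by (intro add_right_mono mult_left_mono) auto
      also have "\<dots> = ((1 - \<nu> k) * (real (k + 2) / real (k + 1)) powr \<beta>) * (D * s) + C * \<nu> k * s"
        unfolding shift by (simp add: mult_ac)
      also have "\<dots> \<le> (1 - \<nu> k / 4) * (D * s) + C * \<nu> k * s"
        using s D4 \<open>0 \<le> C\<close> by (intro add_right_mono mult_right_mono fac) auto
      also have "\<dots> \<le> D * s"
        using mult_right_mono[OF D4, of "\<nu> k * s"] s \<nu>[of k] by (simp add: algebra_simps)
      finally show ?thesis by (simp add: s_def)
    qed (use small[of "Suc k"] in simp)
  qed
  moreover have "0 \<le> D" using D4 \<open>0 \<le> C\<close> by simp
  ultimately show ?thesis using that by blast
qed

text \<open>The squares \<open>(a k)\<^sup>2\<close> converge because their increments are \<open>O(\<Delta> k * a k + (\<Delta> k)\<^sup>2)\<close>, hence summable; a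
nonzero limit would contradict the divergence of \<open>\<Sum>k. \<Delta> k\<close>.\<close>

lemma weighted_summable_imp_tendsto_zero:
  fixes a \<Delta> :: "nat \<Rightarrow> real"
  assumes nonneg: "\<And>k. 0 \<le> a k" and \<Delta>: "\<And>k. 0 \<le> \<Delta> k"
    and diverges: "\<not> summable \<Delta>" and sq: "summable (\<lambda>k. (\<Delta> k)\<^sup>2)"
    and sa: "summable (\<lambda>k. \<Delta> k * a k)"
    and slow: "\<And>k. \<bar>a (Suc k) - a k\<bar> \<le> C * \<Delta> k"
  shows "a \<longlonglongrightarrow> 0"
proof -
  have "summable (\<lambda>k. (a (Suc k))\<^sup>2 - (a k)\<^sup>2)"
  proof (rule summable_comparison_test'[where N = 0])
    show "summable (\<lambda>k. 2 * C * (\<Delta> k * a k) + C\<^sup>2 * (\<Delta> k)\<^sup>2)"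
      by (intro summable_add summable_mult sq sa)
    fix k
    have C: "0 \<le> C * \<Delta> k" using slow[of k] by linarith
    have "(a (Suc k))\<^sup>2 - (a k)\<^sup>2 = (a (Suc k) - a k) * (a (Suc k) + a k)"
      by (simp add: power2_eq_square algebra_simps)
    then have "norm ((a (Suc k))\<^sup>2 - (a k)\<^sup>2) = \<bar>a (Suc k) - a k\<bar> * (a (Suc k) + a k)"
      using nonneg by (simp add: abs_mult)
    also have "\<dots> \<le> (C * \<Delta> k) * (2 * a k + C * \<Delta> k)"
      using slow[of k] nonneg[of k] nonneg[of "Suc k"] C by (intro mult_mono) auto
    finally show "norm ((a (Suc k))\<^sup>2 - (a k)\<^sup>2) \<le> 2 * C * (\<Delta> k * a k) + C\<^sup>2 * (\<Delta> k)\<^sup>2"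
      by (simp add: power2_eq_square algebra_simps)
  qed
  then have "convergent (\<lambda>n. \<Sum>k<n. (a (Suc k))\<^sup>2 - (a k)\<^sup>2)"
    by (simp add: summable_iff_convergent)
  then obtain l0 where "(\<lambda>n. \<Sum>k<n. (a (Suc k))\<^sup>2 - (a k)\<^sup>2) \<longlonglongrightarrow> l0"
    by (auto simp: convergent_def)
  then have "(\<lambda>n. (a n)\<^sup>2 - (a 0)\<^sup>2) \<longlonglongrightarrow> l0"
    using sum_lessThan_telescope[of "\<lambda>k. (a k)\<^sup>2"] by simp
  then have "(\<lambda>n. ((a n)\<^sup>2 - (a 0)\<^sup>2) + (a 0)\<^sup>2) \<longlonglongrightarrow> l0 + (a 0)\<^sup>2"
    by (intro tendsto_intros)
  then have "(\<lambda>n. sqrt ((a n)\<^sup>2)) \<longlonglongrightarrow> sqrt (l0 + (a 0)\<^sup>2)"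
    by (intro tendsto_intros) simp
  then obtain l where l: "a \<longlonglongrightarrow> l" using nonneg by auto
  have "0 \<le> l" using l nonneg by (intro LIMSEQ_le_const) auto
  moreover have "\<not> 0 < l"
  proof
    assume "0 < l"
    then have "\<forall>\<^sub>F k in sequentially. l / 2 < a k"
      using l by (intro order_tendstoD(1)) auto
    then have "\<forall>\<^sub>F k in sequentially. norm (\<Delta> k) \<le> 2 / l * (\<Delta> k * a k)"
    proof eventually_elim
      case (elim k)
      then have "\<Delta> k * (l / 2) \<le> \<Delta> k * a k" using \<Delta> by (intro mult_left_mono) auto
      then show ?case using \<Delta>[of k] \<open>0 < l\<close> by (simp add: field_simps)
    qed
    then have "summable \<Delta>"
      by (rule summable_comparison_test_ev) (intro summable_mult sa)
    with diverges show False by simp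
  qed
  ultimately show ?thesis using l by simp
qed

text \<open>The graph of the concave function \<open>x powr q\<close> lies below its tangents.\<close>

lemma powr_concave_tangent:
  fixes x y q :: real
  assumes "0 < x" "0 \<le> y" "0 < q" "q \<le> 1"
  shows "y powr q \<le> x powr q + q * x powr (q - 1) * (y - x)"
proof -
  have "(y / x) powr q \<le> 1 + q * (y / x - 1)"
  proof (cases "y = 0")
    case False
    have "(y / x) powr q * 1 powr (1 - q) \<le> q * (y / x) + (1 - q) * 1"
      using assms False by (intro Youngs_inequality_0) auto
    then show ?thesis by (simp add: algebra_simps)
  qed (use assms in auto)
  then have "x powr q * (y / x) powr q \<le> x powr q * (1 + q * (y / x - 1))"
    by (intro mult_left_mono) auto
  also have "\<dots> = x powr q + q * x powr (q - 1) * (y - x)"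
    using assms by (simp add: powr_diff field_simps)
  finally show ?thesis using assms by (simp add: powr_divide)
qed

text \<open>A first-order expansion of \<open>\<parallel>\<cdot>\<parallel> powr p\<close> with remainder of order \<open>p\<close>. If \<open>\<parallel>b\<parallel> \<le> \<parallel>a\<parallel>\<close> it follows from the concavity
of \<open>x powr (p / 2)\<close> at \<open>\<parallel>a\<parallel>\<^sup>2\<close>; otherwise every term is at most a multiple of \<open>\<parallel>b\<parallel> powr p\<close>. For \<open>a = 0\<close> the
middle term vanishes, whatever the value of \<open>0 powr (p - 2)\<close>.\<close>

lemma norm_add_powr_le:
  fixes a b :: "'a::real_inner"
  assumes "1 < p" "p \<le> 2"
  shows "norm (a + b) powr p \<le> norm a powr p + p * norm a powr (p - 2) * (a \<bullet> b) + 6 * norm b powr p"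
proof (cases "norm b \<le> norm a \<and> a \<noteq> 0")
  case True
  have sq: "((norm v)\<^sup>2) powr (p / 2) = norm v powr p" for v :: 'a
  proof -
    have "((norm v)\<^sup>2) powr (p / 2) = (norm v powr 2) powr (p / 2)" by simp
    then show ?thesis by (simp only: powr_powr) simp
  qed
  have sq2: "((norm a)\<^sup>2) powr (p / 2 - 1) = norm a powr (p - 2)"
  proof -
    have "((norm a)\<^sup>2) powr (p / 2 - 1) = (norm a powr 2) powr (p / 2 - 1)" by simp
    then show ?thesis by (simp only: powr_powr) (simp add: algebra_simps)
  qed
  have "norm (a + b) powr p \<le> norm a powr p + p / 2 * norm a powr (p - 2) * ((norm (a + b))\<^sup>2 - (norm a)\<^sup>2)"
    using powr_concave_tangent[of "(norm a)\<^sup>2" "(norm (a + b))\<^sup>2" "p / 2"] True assms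
    by (simp add: sq sq2)
  also have "(norm (a + b))\<^sup>2 - (norm a)\<^sup>2 = 2 * (a \<bullet> b) + (norm b)\<^sup>2"
    by (simp add: power2_norm_eq_inner inner_add_left inner_add_right inner_commute)
  also have "p / 2 * norm a powr (p - 2) * (2 * (a \<bullet> b) + (norm b)\<^sup>2)
      = p * norm a powr (p - 2) * (a \<bullet> b) + p / 2 * (norm a powr (p - 2) * (norm b)\<^sup>2)"
    by (simp add: algebra_simps)
  also have "p / 2 * (norm a powr (p - 2) * (norm b)\<^sup>2) \<le> 6 * norm b powr p"
  proof (cases "b = 0")
    case False
    have "norm a powr (p - 2) \<le> norm b powr (p - 2)"
      using True False assms by (intro powr_mono2') auto
    then have "norm a powr (p - 2) * (norm b)\<^sup>2 \<le> norm b powr (p - 2) * (norm b)\<^sup>2"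
      by (intro mult_right_mono) auto
    also have "\<dots> = norm b powr p"
    proof -
      have "norm b powr (p - 2) * (norm b)\<^sup>2 = norm b powr (p - 2) * norm b powr 2" by simp
      then show ?thesis by (simp only: flip: powr_add) simp
    qed
    finally have "p / 2 * (norm a powr (p - 2) * (norm b)\<^sup>2) \<le> p / 2 * norm b powr p"
      using assms by (intro mult_left_mono) auto
    also have "\<dots> \<le> 6 * norm b powr p" using assms by (intro mult_right_mono) auto
    finally show ?thesis .
  qed simp
  finally show ?thesis by simp
next
  case False
  then have ab: "norm a \<le> norm b" by auto
  have "norm (a + b) powr p \<le> (2 * norm b) powr p"
    using ab norm_triangle_ineq[of a b] assms by (intro powr_mono2) auto
  also have "\<dots> = 2 powr p * norm b powr p" by (simp add: powr_mult)
  also have "\<dots> \<le> 4 * norm b powr p"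
    using powr_mono[of p 2 "2::real"] assms by (intro mult_right_mono) auto
  finally have 1: "norm (a + b) powr p \<le> 4 * norm b powr p" .
  have "\<bar>norm a powr (p - 2) * (a \<bullet> b)\<bar> \<le> norm b powr p"
  proof (cases "a = 0")
    case False
    have "\<bar>norm a powr (p - 2) * (a \<bullet> b)\<bar> \<le> norm a powr (p - 2) * (norm a * norm b)"
      by (simp add: abs_mult Cauchy_Schwarz_ineq2 mult_left_mono)
    also have "\<dots> = norm a powr (p - 1) * norm b"
      using False powr_mult_base[of "norm a" "p - 2"] by (simp add: mult_ac)
    also have "\<dots> \<le> norm b powr (p - 1) * norm b"
      using ab assms by (intro mult_right_mono powr_mono2) auto
    also have "\<dots> = norm b powr p"
      using False ab powr_mult_base[of "norm b" "p - 1"] by (simp add: mult_ac)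
    finally show ?thesis .
  qed simp
  then have "- (norm b powr p) \<le> norm a powr (p - 2) * (a \<bullet> b)" by linarith
  then have "p * (- (norm b powr p)) \<le> p * (norm a powr (p - 2) * (a \<bullet> b))"
    using assms by (intro mult_left_mono) auto
  then have "- (p * norm b powr p) \<le> p * norm a powr (p - 2) * (a \<bullet> b)"
    by (simp add: mult.assoc)
  moreover have "p * norm b powr p \<le> 2 * norm b powr p"
    using assms by (intro mult_right_mono) auto
  ultimately show ?thesis using 1 powr_ge_zero[of "norm a" p] by linarith
qed

section \<open>Linear algebra of one step\<close>

lemma norm_matrix_vector_le_opnorm:
  fixes A :: "real^'n^'m"
  shows "norm (A *v v) \<le> opnorm A * norm v"
  unfolding opnorm_def by (rule onorm) simp

text \<open>Transposed matrices act by \<open>*v\<close> throughout, so the rewriting of \<open>transpose A *v v\<close> to \<open>v v* A\<close> is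
switched off.\<close>

declare transpose_matrix_vector [simp del]

lemma le_if_square_le_mult:
  fixes x c :: real
  assumes "x * x \<le> c * x" "0 \<le> c"
  shows "x \<le> c"
  using assms mult_le_cancel_right[of x x c] by (cases "0 < x") auto

lemma inner_le_norm_mult:
  fixes a b :: "'a::real_inner"
  assumes "norm b \<le> c"
  shows "a \<bullet> b \<le> norm a * c"
  using norm_cauchy_schwarz[of a b] mult_left_mono[OF assms norm_ge_zero[of a]] by linarith

lemma inner_transpose:
  fixes A :: "real^'d^'m"
  shows "(transpose A *v z) \<bullet> y = z \<bullet> (A *v y)"
  by (simp add: transpose_matrix_vector dot_lmul_matrix)

lemma mat_vector_mult: "mat a *v (v :: real^'n) = a *\<^sub>R v"
  by (simp add: matrix_vector_mult_def mat_def vec_eq_iff if_distrib[of "\<lambda>x. x * _"] cong: if_cong)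

lemma matrix_vector_mult_uminus: "A *v (- v) = - (A *v (v :: real^'n))" for A :: "real^'n^'m"
  by (rule linear_neg) simp

lemma inner_gram:
  fixes G :: "real^'d^'m" and z :: "real^'m"
  shows "z \<bullet> ((G ** transpose G) *v z) = (norm (transpose G *v z))\<^sup>2"
  by (simp add: power2_norm_eq_inner inner_transpose flip: matrix_vector_mul_assoc)

lemma norm_transpose_ge:
  fixes G :: "real^'d^'m"
  assumes "mat \<kappa> \<preceq>\<^sub>L G ** transpose G" "0 < \<kappa>"
  shows "sqrt \<kappa> * norm z \<le> norm (transpose G *v z)"
proof -
  have "0 \<le> z \<bullet> ((G ** transpose G - mat \<kappa>) *v z)"
    using assms by (simp add: loewner_le_def psd_def)
  then have "\<kappa> * (norm z)\<^sup>2 \<le> (norm (transpose G *v z))\<^sup>2"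
    by (simp add: matrix_vector_mult_diff_rdistrib inner_diff_right inner_gram
        mat_vector_mult power2_norm_eq_inner)
  then show ?thesis
    using assms by - (rule power2_le_imp_le, auto simp: power_mult_distrib)
qed

lemma norm_transpose_le:
  fixes G :: "real^'d^'m"
  assumes "G ** transpose G \<preceq>\<^sub>L mat \<kappa>" "0 < \<kappa>"
  shows "norm (transpose G *v z) \<le> sqrt \<kappa> * norm z"
proof -
  have "0 \<le> z \<bullet> ((mat \<kappa> - G ** transpose G) *v z)"
    using assms by (simp add: loewner_le_def psd_def)
  then have "(norm (transpose G *v z))\<^sup>2 \<le> \<kappa> * (norm z)\<^sup>2"
    by (simp add: matrix_vector_mult_diff_rdistrib inner_diff_right inner_gram
        mat_vector_mult power2_norm_eq_inner)
  then show ?thesis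
    using assms by - (rule power2_le_imp_le, auto simp: power_mult_distrib)
qed

lemma norm_transpose_le_opnorm:
  fixes A :: "real^'d^'m"
  shows "norm (transpose A *v z) \<le> opnorm A * norm z"
proof -
  have "(norm (transpose A *v z))\<^sup>2 = z \<bullet> (A *v (transpose A *v z))"
    by (simp add: matrix_vector_mul_assoc inner_gram)
  also have "\<dots> \<le> norm z * (opnorm A * norm (transpose A *v z))"
    by (intro inner_le_norm_mult norm_matrix_vector_le_opnorm)
  finally have "norm (transpose A *v z) * norm (transpose A *v z) \<le> (opnorm A * norm z) * norm (transpose A *v z)"
    by (simp add: power2_eq_square mult_ac)
  moreover have "0 \<le> opnorm A" unfolding opnorm_def by (rule onorm_pos_le) simp
  ultimately show ?thesis
    using le_if_square_le_mult[of "norm (transpose A *v z)" "opnorm A * norm z"] by simp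
qed

lemma norm_jacobian_le:
  fixes G :: "real^'d^'m"
  assumes "G ** transpose G \<preceq>\<^sub>L mat \<kappa>" "0 < \<kappa>"
  shows "norm (G *v y) \<le> sqrt \<kappa> * norm y"
proof -
  have "(norm (G *v y))\<^sup>2 = y \<bullet> (transpose G *v (G *v y))"
    using inner_transpose[of G "G *v y" y] by (simp add: power2_norm_eq_inner inner_commute)
  also have "\<dots> \<le> norm y * (sqrt \<kappa> * norm (G *v y))"
    by (intro inner_le_norm_mult norm_transpose_le[OF assms])
  finally have "norm (G *v y) * norm (G *v y) \<le> (sqrt \<kappa> * norm y) * norm (G *v y)"
    by (simp add: power2_eq_square mult_ac)
  then show ?thesis
    by (rule le_if_square_le_mult) (use assms in simp)
qed

lemma matrix_inv_right_inverse:
  fixes A :: "real^'n^'n"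
  assumes "invertible A"
  shows "A ** matrix_inv A = mat 1"
  using someI_ex[OF assms[unfolded invertible_def]] by (simp add: matrix_inv_def)

lemma gram_right_inverse:
  fixes G :: "real^'d^'m"
  assumes "mat \<kappa> \<preceq>\<^sub>L G ** transpose G" "0 < \<kappa>"
  shows "G *v (transpose G *v (matrix_inv (G ** transpose G) *v y)) = y"
proof -
  have "inj ((*v) (G ** transpose G))"
  proof (rule injI)
    fix a b assume "(G ** transpose G) *v a = (G ** transpose G) *v b"
    then have "(a - b) \<bullet> ((G ** transpose G) *v (a - b)) = 0"
      by (simp add: matrix_vector_mult_diff_distrib)
    then have "sqrt \<kappa> * norm (a - b) \<le> 0"
      using norm_transpose_ge[OF assms, of "a - b"] by (simp add: inner_gram)
    then show "a = b" using assms by (simp add: mult_le_0_iff)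
  qed
  then have "invertible (G ** transpose G)"
    using matrix_left_invertible_injective invertible_left_inverse by blast
  then have "(G ** transpose G) *v (matrix_inv (G ** transpose G) *v y) = y"
    by (simp add: matrix_vector_mul_assoc matrix_inv_right_inverse)
  then show ?thesis by (simp add: matrix_vector_mul_assoc matrix_mul_assoc)
qed

lemma norm_min_norm_solution_le:
  fixes G :: "real^'d^'m"
  assumes "mat \<kappa> \<preceq>\<^sub>L G ** transpose G" "0 < \<kappa>"
  shows "norm (transpose G *v (matrix_inv (G ** transpose G) *v y)) \<le> norm y / sqrt \<kappa>"
proof -
  define s where "s = matrix_inv (G ** transpose G) *v y"
  define v where "v = transpose G *v s"
  have "(norm v)\<^sup>2 = s \<bullet> (G *v v)"
    by (simp add: v_def matrix_vector_mul_assoc inner_gram)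
  also have "G *v v = y" using gram_right_inverse[OF assms] by (simp add: v_def s_def)
  also have "s \<bullet> y \<le> norm s * norm y" by (rule norm_cauchy_schwarz)
  also have "\<dots> \<le> (norm v / sqrt \<kappa>) * norm y"
    using norm_transpose_ge[OF assms, of s] assms
    by (intro mult_right_mono) (auto simp: v_def field_simps)
  finally have "norm v * norm v \<le> (norm y / sqrt \<kappa>) * norm v"
    by (simp add: power2_eq_square mult_ac)
  then have "norm v \<le> norm y / sqrt \<kappa>"
    by (rule le_if_square_le_mult) (use assms in simp)
  then show ?thesis by (simp add: v_def s_def)
qed

text \<open>The residual \<open>g + G\<^sup>T \<lambda>\<close> of the least-squares multiplier \<open>\<lambda>\<close>. If \<open>G\<close> has full row rank, it is the
orthogonal projection of \<open>g\<close> onto \<open>ker G\<close>.\<close>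

definition projected_gradient :: "real^'d^'m \<Rightarrow> real^'d \<Rightarrow> real^'d" where
  "projected_gradient G g = g + transpose G *v lagrange_multiplier G g"

lemma jacobian_projected_gradient:
  fixes G :: "real^'d^'m"
  assumes "mat \<kappa> \<preceq>\<^sub>L G ** transpose G" "0 < \<kappa>"
  shows "G *v projected_gradient G g = 0"
  using gram_right_inverse[OF assms, of "G *v g"]
  by (simp add: matrix_vector_mult_diff_distrib projected_gradient_def lagrange_multiplier_def matrix_vector_mult_uminus
      matrix_vector_right_distrib)

lemma projected_gradient_diff:
  "projected_gradient G (g - h) = projected_gradient G g - projected_gradient G h"
  by (simp add: projected_gradient_def lagrange_multiplier_def matrix_vector_mult_diff_distrib
      matrix_vector_mult_uminus)

lemma inner_transpose_kernel:
  fixes G :: "real^'d^'m"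
  assumes "G *v y = 0"
  shows "y \<bullet> (transpose G *v z) = 0"
  using inner_transpose[of G z y] assms by (simp add: inner_commute)

lemma norm_projected_gradient_le:
  fixes G :: "real^'d^'m"
  assumes "mat \<kappa> \<preceq>\<^sub>L G ** transpose G" "0 < \<kappa>"
  shows "norm (projected_gradient G g) \<le> norm (g + transpose G *v z)"
proof -
  let ?P = "projected_gradient G g" and ?l = "lagrange_multiplier G g"
  have "g + transpose G *v z = ?P + transpose G *v (z - ?l)"
    by (simp add: projected_gradient_def matrix_vector_mult_diff_distrib)
  then have "(norm (g + transpose G *v z))\<^sup>2 = (norm ?P)\<^sup>2 + (norm (transpose G *v (z - ?l)))\<^sup>2"
    using inner_transpose_kernel[OF jacobian_projected_gradient[OF assms]]
    by (simp add: norm_add_Pythagorean orthogonal_def)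
  then show ?thesis by - (rule power2_le_imp_le, auto)
qed

lemma norm_projected_gradient_le_norm:
  fixes G :: "real^'d^'m"
  assumes "mat \<kappa> \<preceq>\<^sub>L G ** transpose G" "0 < \<kappa>"
  shows "norm (projected_gradient G g) \<le> norm g"
  using norm_projected_gradient_le[OF assms, of g 0] by simp

lemma norm_lagrange_multiplier_le:
  fixes G :: "real^'d^'m"
  assumes "mat \<kappa> \<preceq>\<^sub>L G ** transpose G" "0 < \<kappa>"
  shows "norm (lagrange_multiplier G g) \<le> norm g / sqrt \<kappa>"
proof -
  let ?P = "projected_gradient G g" and ?l = "lagrange_multiplier G g"
  have "?P + transpose G *v (- ?l) = g"
    by (simp add: projected_gradient_def matrix_vector_mult_uminus)
  then have "(norm g)\<^sup>2 = (norm ?P)\<^sup>2 + (norm (transpose G *v (- ?l)))\<^sup>2"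
    using inner_transpose_kernel[OF jacobian_projected_gradient[OF assms], of g "- ?l"]
      norm_add_Pythagorean[of ?P "transpose G *v (- ?l)"] by (simp add: orthogonal_def)
  then have "norm (transpose G *v (- ?l)) \<le> norm g" by - (rule power2_le_imp_le, auto)
  then have "sqrt \<kappa> * norm ?l \<le> norm g"
    using norm_transpose_ge[OF assms, of "- ?l"] by simp
  then show ?thesis using assms by (simp add: field_simps)
qed

text \<open>Comparing with the multiplier of \<open>G\<close> and \<open>g\<close> in the minimality property \<open>norm_projected_gradient_le\<close> gives
the Lipschitz dependence on \<open>G\<close> and \<open>g\<close> without differentiating a matrix inverse.\<close>

lemma projected_gradient_lipschitz:
  fixes G G' :: "real^'d^'m"
  assumes "mat \<kappa> \<preceq>\<^sub>L G ** transpose G" "mat \<kappa> \<preceq>\<^sub>L G' ** transpose G'" "0 < \<kappa>"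
  shows "norm (projected_gradient G' g') \<le> norm (projected_gradient G g)
           + norm (g' - g) + opnorm (G' - G) * norm g / sqrt \<kappa>"
proof -
  let ?l = "lagrange_multiplier G g"
  have "norm (projected_gradient G' g') \<le> norm (g' + transpose G' *v ?l)"
    by (rule norm_projected_gradient_le[OF assms(2,3)])
  also have "g' + transpose G' *v ?l = projected_gradient G g + (g' - g) + transpose (G' - G) *v ?l"
    by (simp add: projected_gradient_def transpose_def matrix_vector_mult_def vec_eq_iff
        left_diff_distrib sum_subtractf)
  also have "norm \<dots> \<le> norm (projected_gradient G g) + norm (g' - g) + norm (transpose (G' - G) *v ?l)"
    using norm_triangle_ineq[of "projected_gradient G g" "g' - g"]
      norm_triangle_ineq[of "projected_gradient G g + (g' - g)" "transpose (G' - G) *v ?l"] by linarith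
  also have "norm (transpose (G' - G) *v ?l) \<le> opnorm (G' - G) * norm ?l"
    by (rule norm_transpose_le_opnorm)
  also have "\<dots> \<le> opnorm (G' - G) * (norm g / sqrt \<kappa>)"
    using norm_lagrange_multiplier_le[OF assms(1,3)]
    by (intro mult_left_mono) (auto simp: opnorm_def intro: onorm_pos_le)
  finally show ?thesis by simp
qed

text \<open>The last inequality bounds below the achieved reduction \<open>\<gamma> * \<parallel>c\<parallel>\<close> of the linearised constraint.\<close>

lemma normal_step_properties:
  fixes G :: "real^'d^'m"
  assumes G: "mat \<kappa> \<preceq>\<^sub>L G ** transpose G" "0 < \<kappa>" and "0 < \<theta>" "0 < \<Delta>"
  obtains \<gamma> z where "0 \<le> \<gamma>" "\<gamma> \<le> 1"
    "normal_step \<theta> \<Delta> G c = transpose G *v z"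
    "G *v normal_step \<theta> \<Delta> G c = - \<gamma> *\<^sub>R c"
    "norm (normal_step \<theta> \<Delta> G c) \<le> \<theta> * \<Delta>"
    "norm (normal_step \<theta> \<Delta> G c) \<le> \<gamma> * norm c / sqrt \<kappa>"
    "min (\<theta> * sqrt \<kappa> * \<Delta>) (norm c) \<le> \<gamma> * norm c"
proof -
  define s where "s = matrix_inv (G ** transpose G) *v c"
  define v where "v = - (transpose G *v s)"
  define \<gamma> where "\<gamma> = (if v = 0 then 1 else min (\<theta> * \<Delta> / norm v) 1)"
  have w: "normal_step \<theta> \<Delta> G c = \<gamma> *\<^sub>R v"
    by (simp add: normal_step_def v_def \<gamma>_def Let_def s_def)
  have \<gamma>: "0 \<le> \<gamma>" "\<gamma> \<le> 1" using assms by (auto simp: \<gamma>_def)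
  have v: "norm v \<le> norm c / sqrt \<kappa>"
    using norm_min_norm_solution_le[OF G] by (simp add: v_def s_def)
  have Gv: "G *v v = - c"
    using gram_right_inverse[OF G] by (simp add: v_def s_def matrix_vector_mult_uminus)
  show ?thesis
  proof
    show "normal_step \<theta> \<Delta> G c = transpose G *v (- \<gamma> *\<^sub>R s)"
      by (simp add: w v_def matrix_vector_mult_scaleR matrix_vector_mult_uminus)
    show "G *v normal_step \<theta> \<Delta> G c = - \<gamma> *\<^sub>R c"
      by (simp add: w matrix_vector_mult_scaleR Gv)
    show "norm (normal_step \<theta> \<Delta> G c) \<le> \<theta> * \<Delta>"
      using assms by (auto simp: w \<gamma>_def min_def field_simps)
    show "norm (normal_step \<theta> \<Delta> G c) \<le> \<gamma> * norm c / sqrt \<kappa>"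
      using mult_left_mono[OF v \<gamma>(1)] \<gamma> by (simp add: w)
    show "min (\<theta> * sqrt \<kappa> * \<Delta>) (norm c) \<le> \<gamma> * norm c"
    proof (cases "v = 0 \<or> norm v \<le> \<theta> * \<Delta>")
      case True
      then have "\<gamma> = 1" by (auto simp: \<gamma>_def field_simps)
      then show ?thesis by simp
    next
      case False
      then have \<gamma>_eq: "\<gamma> = \<theta> * \<Delta> / norm v" by (auto simp: \<gamma>_def field_simps)
      have "\<theta> * \<Delta> * (norm v * sqrt \<kappa>) \<le> \<theta> * \<Delta> * norm c"
        using v assms by (intro mult_left_mono) (auto simp: field_simps)
      then have "\<theta> * sqrt \<kappa> * \<Delta> \<le> \<gamma> * norm c"
        using False by (simp add: \<gamma>_eq field_simps)
      then show ?thesis by simp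
    qed
  qed (use \<gamma> in auto)
qed

lemma norm_zmult:
  assumes "kernel_basis r G Z"
  shows "norm (zmult r Z u) = L2_set u {..<r}"
proof -
  have "zmult r Z u \<bullet> zmult r Z u = (\<Sum>i<r. \<Sum>j<r. u i * u j * (Z j \<bullet> Z i))"
    by (simp add: zmult_def inner_sum_left inner_sum_right mult.assoc sum_distrib_left)
  also have "\<dots> = (\<Sum>i<r. \<Sum>j<r. if i = j then u i * u j else 0)"
    using assms by (intro sum.cong) (auto simp: kernel_basis_def)
  also have "\<dots> = (\<Sum>i<r. (u i)\<^sup>2)" by (simp add: power2_eq_square)
  finally show ?thesis by (simp add: norm_eq_sqrt_inner L2_set_def)
qed

lemma jacobian_zmult:
  assumes "kernel_basis r G Z"
  shows "G *v zmult r Z u = 0"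
proof -
  have "zmult r Z u \<in> span (Z ` {..<r})"
    unfolding zmult_def by (intro span_sum span_scale span_base) auto
  then show ?thesis using assms by (auto simp: kernel_basis_def)
qed

text \<open>In matrix notation, \<open>Z Z\<^sup>T\<close> is the orthogonal projection onto \<open>ker G\<close>.\<close>

lemma zmult_ztrans_mult:
  fixes G :: "real^'d^'m"
  assumes Z: "kernel_basis r G Z" and G: "mat \<kappa> \<preceq>\<^sub>L G ** transpose G" "0 < \<kappa>"
  shows "zmult r Z (ztrans_mult Z h) = projected_gradient G h"
proof -
  let ?P = "projected_gradient G h"
  have "Z j \<bullet> h = Z j \<bullet> ?P" if "j < r" for j
  proof -
    have "Z j \<in> span (Z ` {..<r})" using that by (intro span_base) auto
    then have "G *v Z j = 0" using Z by (auto simp: kernel_basis_def)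
    then show ?thesis by (simp add: projected_gradient_def inner_add_right inner_transpose_kernel)
  qed
  then have 1: "zmult r Z (ztrans_mult Z h) = zmult r Z (ztrans_mult Z ?P)"
    unfolding zmult_def ztrans_mult_def by (intro sum.cong) auto
  define e where "e = ?P - zmult r Z (ztrans_mult Z ?P)"
  have "Z i \<bullet> e = 0" if "i < r" for i
  proof -
    have "Z i \<bullet> zmult r Z (ztrans_mult Z ?P) = (\<Sum>j<r. (Z j \<bullet> ?P) * (if i = j then 1 else 0))"
      using Z that by (auto simp: zmult_def ztrans_mult_def inner_sum_right kernel_basis_def intro!: sum.cong)
    also have "\<dots> = (\<Sum>j<r. if i = j then Z j \<bullet> ?P else 0)" by (intro sum.cong) auto
    also have "\<dots> = Z i \<bullet> ?P" using that by simp
    finally show ?thesis by (simp add: e_def inner_diff_right)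
  qed
  then have "orthogonal e y" if "y \<in> Z ` {..<r}" for y
    using that by (auto simp: orthogonal_def inner_commute)
  moreover have "e \<in> span (Z ` {..<r})"
    using Z jacobian_projected_gradient[OF G, of h] jacobian_zmult[OF Z, of "ztrans_mult Z ?P"]
    by (auto simp: kernel_basis_def e_def matrix_vector_mult_diff_distrib)
  ultimately have "orthogonal e e" using orthogonal_to_span by blast
  then have "e = 0" by (simp add: orthogonal_def)
  then show ?thesis using 1 by (simp add: e_def)
qed

lemma quadratic_form_bound:
  fixes B :: "real^'d^'d"
  assumes "opnorm B \<le> \<kappa>" "norm a \<le> \<alpha>" "norm b \<le> \<beta>"
  shows "\<bar>a \<bullet> (B *v b)\<bar> \<le> \<kappa> * \<alpha> * \<beta>"
proof -
  have \<alpha>: "0 \<le> \<alpha>" using assms(2) norm_ge_zero order_trans by blast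
  have B0: "0 \<le> opnorm B" unfolding opnorm_def by (rule onorm_pos_le) simp
  have "\<bar>a \<bullet> (B *v b)\<bar> \<le> norm a * norm (B *v b)" by (rule Cauchy_Schwarz_ineq2)
  also have "\<dots> \<le> \<alpha> * (\<kappa> * \<beta>)"
  proof (rule mult_mono)
    have "norm (B *v b) \<le> opnorm B * norm b" by (rule norm_matrix_vector_le_opnorm)
    also have "\<dots> \<le> \<kappa> * \<beta>" using assms B0 by (intro mult_mono) auto
    finally show "norm (B *v b) \<le> \<kappa> * \<beta>" .
  qed (use assms \<alpha> in auto)
  finally show ?thesis by (simp add: mult_ac)
qed

text \<open>The Cauchy point is at least as good as the point at distance \<open>\<rho>\<close> along the same ray. Its
value suffices, because errors of order \<open>\<rho>\<^sup>2\<close> are summable along the iterations.\<close>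

lemma tangential_decrease:
  fixes G :: "real^'d^'m"
  assumes Z: "kernel_basis r G Z" and G: "mat \<kappa> \<preceq>\<^sub>L G ** transpose G" "0 < \<kappa>"
    and sol: "tangential_solution r \<eta> Z B h \<rho> u" and "0 \<le> \<rho>" "0 \<le> \<eta>" and B: "opnorm B \<le> \<kappa>_B"
  shows "reduced_model r Z B h u \<le> \<eta> * (\<kappa>_B / 2 * \<rho>\<^sup>2 - \<rho> * norm (projected_gradient G h))"
proof -
  let ?P = "projected_gradient G h" and ?q = "reduced_model r Z B h"
  \<comment> \<open>If the projection of \<open>h\<close> vanishes, the ray of the Cauchy point consists of the origin only.\<close>
  define \<alpha> where "\<alpha> = (if ?P = 0 then 0 else \<rho> / norm ?P)"
  define uA where "uA = (\<lambda>j. - \<alpha> * ztrans_mult Z h j)"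
  have zA: "zmult r Z uA = - \<alpha> *\<^sub>R ?P"
    by (simp add: uA_def zmult_def sum_negf scaleR_sum_right
        flip: zmult_ztrans_mult[OF Z G])
  have nA: "norm (zmult r Z uA) \<le> \<rho>" using \<open>0 \<le> \<rho>\<close> by (simp add: zA \<alpha>_def)
  have \<alpha>0: "0 \<le> \<alpha>" using \<open>0 \<le> \<rho>\<close> by (simp add: \<alpha>_def)
  have hP: "h \<bullet> ?P = (norm ?P)\<^sup>2"
  proof -
    have "?P \<bullet> h = ?P \<bullet> (?P - transpose G *v lagrange_multiplier G h)"
      by (simp add: projected_gradient_def)
    then show ?thesis
      using inner_transpose_kernel[OF jacobian_projected_gradient[OF G]]
      by (simp add: power2_norm_eq_inner inner_diff_right inner_commute)
  qed
  have "h \<bullet> zmult r Z uA = - (\<rho> * norm ?P)"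
    by (simp add: zA hP \<alpha>_def power2_eq_square)
  moreover have "\<bar>zmult r Z uA \<bullet> (B *v zmult r Z uA)\<bar> \<le> \<kappa>_B * \<rho> * \<rho>"
    by (rule quadratic_form_bound[OF B nA nA])
  ultimately have qA: "?q uA \<le> \<kappa>_B / 2 * \<rho>\<^sup>2 - \<rho> * norm ?P"
    unfolding reduced_model_def by (simp add: power2_eq_square)
  obtain uC where uC: "cauchy_point r Z B h \<rho> uC"
    and dec: "?q u - ?q (\<lambda>_. 0) \<le> \<eta> * (?q uC - ?q (\<lambda>_. 0))"
    using sol by (auto simp: tangential_solution_def)
  have "?q uC \<le> ?q uA"
  proof -
    have "(\<exists>\<alpha>\<ge>0. uA = (\<lambda>j. - \<alpha> * ztrans_mult Z h j)) \<and> L2_set uA {..<r} \<le> \<rho>"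
      using nA \<alpha>0 by (auto simp: norm_zmult[OF Z] uA_def)
    then show ?thesis
      using uC unfolding cauchy_point_def is_arg_min_def using not_less by blast
  qed
  then have "\<eta> * ?q uC \<le> \<eta> * (\<kappa>_B / 2 * \<rho>\<^sup>2 - \<rho> * norm ?P)"
    using qA \<open>0 \<le> \<eta>\<close> by (intro mult_left_mono) auto
  moreover have "?q (\<lambda>_. 0) = 0" by (simp add: reduced_model_def zmult_def)
  ultimately show ?thesis using dec by simp
qed

section \<open>First-order estimates\<close>

lemma gradient_eqI:
  assumes "GDERIV f x :> D"
  shows "gradient f x = D"
proof -
  have "D' = D" if "GDERIV f x :> D'" for D'
  proof -
    have "(\<lambda>h. h \<bullet> D') = (\<lambda>h. h \<bullet> D)"
      using that assms unfolding gderiv_def by (rule has_derivative_unique)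
    then have "(D' - D) \<bullet> (D' - D) = 0"
      unfolding inner_diff_right by (metis diff_self)
    then show ?thesis by simp
  qed
  then show ?thesis unfolding gradient_def using assms by (rule the_equality[rotated])
qed

lemma has_derivative_gradient:
  fixes f :: "'a::euclidean_space \<Rightarrow> real"
  assumes "f differentiable (at x)"
  shows "(f has_derivative (\<lambda>h. gradient f x \<bullet> h)) (at x)"
proof -
  obtain f' where f': "(f has_derivative f') (at x)" using assms by (auto simp: differentiable_def)
  then interpret linear f' by (rule has_derivative_linear)
  define D where "D = (\<Sum>b\<in>Basis. f' b *\<^sub>R b)"
  have "f' h = h \<bullet> D" for h
  proof -
    have "f' h = f' (\<Sum>b\<in>Basis. (h \<bullet> b) *\<^sub>R b)" by (simp add: euclidean_representation)
    also have "\<dots> = h \<bullet> D" by (simp add: sum scale D_def inner_sum_right mult.commute)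
    finally show ?thesis .
  qed
  then have "GDERIV f x :> D" using f' unfolding gderiv_def by (metis (no_types, lifting) ext)
  then show ?thesis using gradient_eqI[of f x D] by (simp add: gderiv_def inner_commute)
qed

text \<open>The mean value theorem yields the constant \<open>L\<close> in place of the optimal \<open>L / 2\<close>.\<close>

lemma descent_lemma:
  fixes f :: "'a::euclidean_space \<Rightarrow> real"
  assumes "convex \<Omega>" and diff: "\<And>y. y \<in> \<Omega> \<Longrightarrow> f differentiable (at y)"
    and lip: "L-lipschitz_on \<Omega> (gradient f)" and xy: "x \<in> \<Omega>" "y \<in> \<Omega>"
  shows "f y \<le> f x + gradient f x \<bullet> (y - x) + L * (norm (y - x))\<^sup>2"
proof -
  have seg: "x + t *\<^sub>R (y - x) \<in> \<Omega>" if "0 \<le> t" "t \<le> 1" for t :: real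
    using convexD_alt[OF \<open>convex \<Omega>\<close> xy that] by (simp add: algebra_simps)
  have der: "((\<lambda>t. f (x + t *\<^sub>R (y - x))) has_derivative
      (\<lambda>s. gradient f (x + t *\<^sub>R (y - x)) \<bullet> (s *\<^sub>R (y - x)))) (at t within {0..1})"
    if "0 \<le> t" "t \<le> 1" for t :: real
  proof (rule has_derivative_compose[where f = "\<lambda>t. x + t *\<^sub>R (y - x)" and g = f
        and f' = "\<lambda>s. s *\<^sub>R (y - x)" and g' = "\<lambda>h. gradient f (x + t *\<^sub>R (y - x)) \<bullet> h"])
    show "((\<lambda>t. x + t *\<^sub>R (y - x)) has_derivative (\<lambda>s. s *\<^sub>R (y - x))) (at t within {0..1})"
      by (auto intro!: derivative_eq_intros)
    show "(f has_derivative (\<lambda>h. gradient f (x + t *\<^sub>R (y - x)) \<bullet> h)) (at (x + t *\<^sub>R (y - x)))"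
      by (rule has_derivative_gradient[OF diff[OF seg[OF that]]])
  qed
  obtain t :: real where t: "0 \<le> t" "t \<le> 1"
    and eq: "f (x + 1 *\<^sub>R (y - x)) - f (x + 0 *\<^sub>R (y - x))
       = gradient f (x + t *\<^sub>R (y - x)) \<bullet> ((1 - 0) *\<^sub>R (y - x))"
    using mvt_very_simple[of 0 1 "\<lambda>t. f (x + t *\<^sub>R (y - x))", OF _ der] by auto
  let ?z = "x + t *\<^sub>R (y - x)"
  have "f y - f x - gradient f x \<bullet> (y - x) = (gradient f ?z - gradient f x) \<bullet> (y - x)"
    using eq by (simp add: inner_diff_left)
  also have "\<dots> \<le> norm (gradient f ?z - gradient f x) * norm (y - x)" by (rule norm_cauchy_schwarz)
  also have "\<dots> \<le> (L * norm (y - x)) * norm (y - x)"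
  proof (rule mult_right_mono)
    have "norm (gradient f ?z - gradient f x) \<le> L * norm (?z - x)"
      using lipschitz_onD[OF lip seg[OF t] xy(1)] by (simp add: dist_norm)
    also have "\<dots> \<le> L * norm (y - x)"
      using t lipschitz_on_nonneg[OF lip] by (intro mult_left_mono) (auto simp: mult_left_le_one_le)
    finally show "norm (gradient f ?z - gradient f x) \<le> L * norm (y - x)" .
  qed simp
  finally show ?thesis by (simp add: power2_eq_square)
qed

lemma jacobian_linearization_error:
  fixes c :: "real^'d \<Rightarrow> real^'m"
  assumes "convex \<Omega>" and diff: "\<And>y. y \<in> \<Omega> \<Longrightarrow> c differentiable (at y)"
    and lip: "\<And>y z. y \<in> \<Omega> \<Longrightarrow> z \<in> \<Omega> \<Longrightarrow> opnorm (jacobian_at c y - jacobian_at c z) \<le> L * norm (y - z)"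
    and "0 \<le> L" and xy: "x \<in> \<Omega>" "y \<in> \<Omega>"
  shows "norm (c y - c x - jacobian_at c x *v (y - x)) \<le> L * (norm (y - x))\<^sup>2"
proof -
  let ?S = "closed_segment x y"
  have S: "z \<in> \<Omega>" if "z \<in> ?S" for z
    using that closed_segment_subset[OF xy \<open>convex \<Omega>\<close>] by auto
  have "norm (c y - c x - jacobian_at c x *v (y - x)) \<le> norm (y - x) * (L * norm (y - x))"
  proof (rule differentiable_bound_linearization[where S = ?S and f' = "\<lambda>z. (*v) (jacobian_at c z)"])
    show "x + t *\<^sub>R (y - x) \<in> ?S" if "t \<in> {0..1}" for t
      using that unfolding in_segment by (intro exI[of _ t]) (simp add: algebra_simps)
    fix z assume z: "z \<in> ?S"
    show "(c has_derivative (*v) (jacobian_at c z)) (at z within ?S)"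
      using diff[OF S[OF z]] unfolding jacobian_works by (rule has_derivative_at_withinI)
    have "onorm ((*v) (jacobian_at c z) - (*v) (jacobian_at c x)) = opnorm (jacobian_at c z - jacobian_at c x)"
      by (simp add: opnorm_def fun_diff_def matrix_vector_mult_diff_rdistrib)
    also have "\<dots> \<le> L * norm (z - x)" by (intro lip S z) auto
    also have "\<dots> \<le> L * norm (y - x)"
      using segment_bound(1)[OF z] \<open>0 \<le> L\<close> by (intro mult_left_mono) (auto simp: norm_minus_commute)
    finally show "onorm ((*v) (jacobian_at c z) - (*v) (jacobian_at c x)) \<le> L * norm (y - x)" .
  qed auto
  then show ?thesis by (simp add: power2_eq_square mult_ac)
qed

text \<open>If \<open>\<phi>\<close> is bounded below and decreases by \<open>a k\<close> up to a summable error, then \<open>a\<close> is summable.\<close>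

lemma summable_decrease:
  fixes \<phi> a b :: "nat \<Rightarrow> real"
  assumes "\<And>k. 0 \<le> a k" "\<And>k. 0 \<le> b k" "summable b" and low: "\<And>k. l \<le> \<phi> k"
    and dec: "\<And>k. \<phi> (Suc k) \<le> \<phi> k - a k + b k"
  shows "summable a"
proof (rule summableI_nonneg_bounded)
  fix n
  have "(\<Sum>k<n. a k) \<le> \<phi> 0 - \<phi> n + (\<Sum>k<n. b k)"
  proof (induction n)
    case (Suc n)
    then show ?case using dec[of n] by simp
  qed simp
  also have "\<dots> \<le> \<phi> 0 - l + suminf b"
  proof -
    have "(\<Sum>k<n. b k) \<le> suminf b" using assms by (intro sum_le_suminf) auto
    then show ?thesis using low[of n] by linarith
  qed
  finally show "(\<Sum>k<n. a k) \<le> \<phi> 0 - l + suminf b" .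
qed (use assms in auto)

section \<open>Decrease of the merit function along a path\<close>

text \<open>A single path of the method under the regularity assumptions. The estimates \<open>m k\<close> of the gradients are arbitrary vectors here;
\<open>\<Delta>_max\<close> is an upper bound of the trust-region radii, and \<open>r\<close> is the dimension of the null spaces.\<close>

locale tr_ssqp_path =
  fixes f :: "real^'d \<Rightarrow> real" and c :: "real^'d \<Rightarrow> real^'m" and \<Omega> :: "(real^'d) set"
    and B :: "nat \<Rightarrow> real^'d^'d" and Z :: "nat \<Rightarrow> nat \<Rightarrow> real^'d" and u :: "nat \<Rightarrow> nat \<Rightarrow> real"
    and x m :: "nat \<Rightarrow> real^'d" and \<Delta> :: "nat \<Rightarrow> real" and r :: nat
    and \<theta> \<eta> f_inf L_f L_G \<kappa>_B \<kappa>_c \<kappa>_f \<kappa>_1G \<kappa>_2G \<Delta>_max :: real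
  assumes \<theta>: "0 < \<theta>" "\<theta> < 1" and \<eta>: "0 < \<eta>" "\<eta> \<le> 1"
    and convex: "convex \<Omega>" and iterates: "\<And>k. x k \<in> \<Omega>"
    and f_diff: "\<And>y. y \<in> \<Omega> \<Longrightarrow> f differentiable (at y)"
    and f_bound: "\<And>y. y \<in> \<Omega> \<Longrightarrow> f_inf \<le> f y"
    and f_lip: "L_f-lipschitz_on \<Omega> (gradient f)"
    and c_diff: "\<And>y. y \<in> \<Omega> \<Longrightarrow> c differentiable (at y)"
    and G_lip: "\<And>y z. y \<in> \<Omega> \<Longrightarrow> z \<in> \<Omega> \<Longrightarrow>
      opnorm (jacobian_at c y - jacobian_at c z) \<le> L_G * norm (y - z)"
    and L_G: "0 \<le> L_G"
    and \<kappa>: "0 < \<kappa>_B" "0 < \<kappa>_c" "0 < \<kappa>_f" "0 < \<kappa>_1G" "0 < \<kappa>_2G"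
    and B_bound: "\<And>k. opnorm (B k) \<le> \<kappa>_B"
    and c_bound: "\<And>k. norm (c (x k)) \<le> \<kappa>_c"
    and g_bound: "\<And>k. norm (gradient f (x k)) \<le> \<kappa>_f"
    and gram_lower: "\<And>k. mat \<kappa>_1G \<preceq>\<^sub>L jacobian_at c (x k) ** transpose (jacobian_at c (x k))"
    and gram_upper: "\<And>k. jacobian_at c (x k) ** transpose (jacobian_at c (x k)) \<preceq>\<^sub>L mat \<kappa>_2G"
    and \<Delta>_pos: "\<And>k. 0 < \<Delta> k" and \<Delta>_max: "\<And>k. \<Delta> k \<le> \<Delta>_max"
    and basis: "\<And>k. kernel_basis r (jacobian_at c (x k)) (Z k)"
    and tangential: "\<And>k. let w = normal_step \<theta> (\<Delta> k) (jacobian_at c (x k)) (c (x k)) in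
      tangential_solution r \<eta> (Z k) (B k) (m k + B k *v w) (sqrt ((\<Delta> k)\<^sup>2 - (norm w)\<^sup>2)) (u k) \<and>
      x (Suc k) = x k + (w + zmult r (Z k) (u k))"
begin

text \<open>The quantity \<open>err k\<close> is the error of the gradient estimate, and \<open>residual k\<close> the optimality residual that has to
vanish in the limit.\<close>

abbreviation "G k \<equiv> jacobian_at c (x k)"
abbreviation "g k \<equiv> gradient f (x k)"
abbreviation "w k \<equiv> normal_step \<theta> (\<Delta> k) (G k) (c (x k))"
abbreviation "t k \<equiv> zmult r (Z k) (u k)"
abbreviation "\<rho> k \<equiv> sqrt ((\<Delta> k)\<^sup>2 - (norm (w k))\<^sup>2)"
abbreviation "err k \<equiv> norm (m k - g k)"
abbreviation "residual k \<equiv> norm (projected_gradient (G k) (g k)) + norm (c (x k))"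

lemma next_iterate: "x (Suc k) - x k = w k + t k"
  using tangential[of k] by (simp add: Let_def)

lemma norm_w_le: "norm (w k) \<le> \<theta> * \<Delta> k"
  using normal_step_properties[OF gram_lower \<kappa>(4) \<theta>(1) \<Delta>_pos] by metis

lemma norm_w_le_radius: "norm (w k) \<le> \<Delta> k"
proof -
  have "\<theta> * \<Delta> k \<le> 1 * \<Delta> k" using \<theta> less_imp_le[OF \<Delta>_pos] by (intro mult_right_mono) auto
  then show ?thesis using norm_w_le[of k] by simp
qed

lemma tangential_radius: "sqrt (1 - \<theta>\<^sup>2) * \<Delta> k \<le> \<rho> k" "0 \<le> \<rho> k" "\<rho> k \<le> \<Delta> k"
proof -
  have sq: "(norm (w k))\<^sup>2 \<le> (\<theta> * \<Delta> k)\<^sup>2" "(norm (w k))\<^sup>2 \<le> (\<Delta> k)\<^sup>2"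
    using norm_w_le norm_w_le_radius by (auto intro!: power_mono)
  have "sqrt (1 - \<theta>\<^sup>2) * \<Delta> k = sqrt ((1 - \<theta>\<^sup>2) * (\<Delta> k)\<^sup>2)"
    using \<Delta>_pos[of k] by (simp add: real_sqrt_mult)
  also have "\<dots> \<le> \<rho> k" using sq by (auto simp: algebra_simps power_mult_distrib)
  finally show "sqrt (1 - \<theta>\<^sup>2) * \<Delta> k \<le> \<rho> k" .
  show "0 \<le> \<rho> k" using sq by simp
  have "\<rho> k \<le> sqrt ((\<Delta> k)\<^sup>2)" by (intro real_sqrt_le_mono) simp
  then show "\<rho> k \<le> \<Delta> k" using \<Delta>_pos[of k] by simp
qed

lemma norm_t_le: "norm (t k) \<le> \<rho> k"
  using tangential[of k] by (simp add: norm_zmult[OF basis] Let_def tangential_solution_def)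

lemma norm_step_le: "norm (x (Suc k) - x k) \<le> \<Delta> k"
proof -
  obtain z where "w k = transpose (G k) *v z"
    using normal_step_properties[OF gram_lower \<kappa>(4) \<theta>(1) \<Delta>_pos] by metis
  then have "orthogonal (w k) (t k)"
    using inner_transpose_kernel[OF jacobian_zmult[OF basis]] by (simp add: orthogonal_def inner_commute)
  then have "(norm (x (Suc k) - x k))\<^sup>2 = (norm (w k))\<^sup>2 + (norm (t k))\<^sup>2"
    by (simp add: next_iterate norm_add_Pythagorean)
  also have "\<dots> \<le> (norm (w k))\<^sup>2 + (\<rho> k)\<^sup>2"
    using norm_t_le by (intro add_left_mono power_mono) auto
  also have "\<dots> = (\<Delta> k)\<^sup>2"
    using norm_w_le_radius by (simp add: power_mono)
  finally show ?thesis using \<Delta>_pos[of k] by - (rule power2_le_imp_le, auto)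
qed

lemma step_sq_le: "(norm (x (Suc k) - x k))\<^sup>2 \<le> (\<Delta> k)\<^sup>2"
  using norm_step_le by (intro power_mono) auto

lemma linearization_error: "norm (c (x (Suc k)) - c (x k) - G k *v (w k + t k)) \<le> L_G * (\<Delta> k)\<^sup>2"
proof -
  have "norm (c (x (Suc k)) - c (x k) - G k *v (x (Suc k) - x k)) \<le> L_G * (norm (x (Suc k) - x k))\<^sup>2"
    by (rule jacobian_linearization_error[OF convex c_diff G_lip L_G iterates iterates])
  also have "\<dots> \<le> L_G * (\<Delta> k)\<^sup>2" by (intro mult_left_mono step_sq_le L_G)
  finally show ?thesis by (simp add: next_iterate)
qed

text \<open>The first-order change along the tangential step is the model value minus the second-order terms,
and the projected estimate differs from the projected gradient by at most \<open>err k + \<kappa>_B * \<Delta> k\<close>.\<close>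

lemma tangential_model_decrease:
  "m k \<bullet> t k \<le> - \<eta> * sqrt (1 - \<theta>\<^sup>2) * \<Delta> k * norm (projected_gradient (G k) (g k))
     + \<Delta> k * err k + 3 * \<kappa>_B * (\<Delta> k)\<^sup>2"
proof -
  let ?h = "m k + B k *v w k" and ?P = "projected_gradient (G k)"
  define D where "D = \<Delta> k"
  have D: "0 < D" using \<Delta>_pos by (simp add: D_def)
  have t: "norm (t k) \<le> D" using norm_t_le tangential_radius(3) order_trans unfolding D_def by blast
  have tBt: "\<bar>t k \<bullet> (B k *v t k)\<bar> \<le> \<kappa>_B * D * D"
    by (rule quadratic_form_bound[OF B_bound t t])
  have tBw: "\<bar>t k \<bullet> (B k *v w k)\<bar> \<le> \<kappa>_B * D * D"
    by (rule quadratic_form_bound[OF B_bound t]) (simp add: norm_w_le_radius D_def)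
  have Bw: "norm (B k *v w k) \<le> \<kappa>_B * D"
  proof -
    have "norm (B k *v w k) \<le> opnorm (B k) * norm (w k)" by (rule norm_matrix_vector_le_opnorm)
    also have "\<dots> \<le> \<kappa>_B * D"
      using B_bound norm_w_le_radius \<kappa> by (intro mult_mono) (auto simp: D_def)
    finally show ?thesis .
  qed
  have "?P (g k) = ?P ?h - ?P ((m k - g k) + B k *v w k)"
    by (simp flip: projected_gradient_diff)
  then have "norm (?P (g k)) \<le> norm (?P ?h) + norm (?P ((m k - g k) + B k *v w k))"
    by (simp add: norm_triangle_ineq4)
  also have "norm (?P ((m k - g k) + B k *v w k)) \<le> norm ((m k - g k) + B k *v w k)"
    by (rule norm_projected_gradient_le_norm[OF gram_lower \<kappa>(4)])
  also have "\<dots> \<le> err k + \<kappa>_B * D"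
    using norm_triangle_ineq[of "m k - g k" "B k *v w k"] Bw by linarith
  finally have Pg: "norm (?P (g k)) \<le> norm (?P ?h) + (err k + \<kappa>_B * D)" by simp
  have model: "reduced_model r (Z k) (B k) ?h (u k) \<le> \<eta> * (\<kappa>_B / 2 * (\<rho> k)\<^sup>2 - \<rho> k * norm (?P ?h))"
    using tangential[of k] tangential_radius(2)[of k] \<eta>
    by (intro tangential_decrease[OF basis gram_lower \<kappa>(4)]) (auto simp: Let_def B_bound)
  have "\<eta> * (\<kappa>_B / 2 * (\<rho> k)\<^sup>2) \<le> 1 * (\<kappa>_B / 2 * D\<^sup>2)"
    using \<eta> \<kappa> tangential_radius(2,3)[of k]
    by (intro mult_mono power_mono) (auto simp: D_def)
  moreover have "\<eta> * (\<rho> k * (err k + \<kappa>_B * D)) \<le> 1 * (D * (err k + \<kappa>_B * D))"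
    using \<eta> \<kappa> tangential_radius(2,3)[of k] D
    by (intro mult_mono) (auto simp: D_def)
  moreover have "\<eta> * (sqrt (1 - \<theta>\<^sup>2) * D * norm (?P (g k))) \<le> \<eta> * (\<rho> k * (norm (?P ?h) + (err k + \<kappa>_B * D)))"
    using \<eta> tangential_radius(1,2)[of k] Pg by (intro mult_left_mono mult_mono) (auto simp: D_def)
  ultimately have "reduced_model r (Z k) (B k) ?h (u k)
      \<le> \<kappa>_B / 2 * D\<^sup>2 + D * (err k + \<kappa>_B * D) - \<eta> * (sqrt (1 - \<theta>\<^sup>2) * D * norm (?P (g k)))"
    using model by (simp add: algebra_simps)
  moreover have "m k \<bullet> t k = reduced_model r (Z k) (B k) ?h (u k) - 1/2 * (t k \<bullet> (B k *v t k)) - t k \<bullet> (B k *v w k)"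
    by (simp add: reduced_model_def inner_add_left inner_add_right inner_commute)
  ultimately show ?thesis
    using tBt tBw unfolding D_def[symmetric] by (simp add: algebra_simps power2_eq_square)
qed

text \<open>The penalty parameter of the merit function. The normal step may increase \<open>f\<close> to first order by
\<open>\<kappa>_f / sqrt \<kappa>_1G\<close> times the reduction of \<open>\<parallel>c\<parallel>\<close>; the summand \<open>1\<close> leaves a net decrease.\<close>

definition "\<mu> = \<kappa>_f / sqrt \<kappa>_1G + 1"

text \<open>The \<open>l\<^sub>2\<close> merit function along the iterates.\<close>

definition "merit k = f (x k) + \<mu> * norm (c (x k))"

text \<open>The constant in the decrease of the merit function. The last two terms ensure that the
reduction \<open>min (\<theta> * sqrt \<kappa>_1G * \<Delta> k) \<parallel>c\<parallel>\<close> is at least \<open>\<beta> * \<Delta> k * \<parallel>c\<parallel>\<close>.\<close>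

definition "\<beta> = min (\<eta> * sqrt (1 - \<theta>\<^sup>2)) (min (\<theta> * sqrt \<kappa>_1G / \<kappa>_c) (1 / \<Delta>_max))"

lemma \<Delta>_max_pos: "0 < \<Delta>_max"
  using \<Delta>_pos[of 0] \<Delta>_max[of 0] by simp

lemma \<beta>_pos: "0 < \<beta>"
  using \<theta> \<eta> \<kappa> \<Delta>_max_pos by (simp add: \<beta>_def power_less_one_iff)

lemma merit_decrease:
  "merit (Suc k) \<le> merit k - \<beta> * (\<Delta> k * residual k)
     + (2 * (\<Delta> k * err k) + (L_f + 3 * \<kappa>_B + \<mu> * L_G) * (\<Delta> k)\<^sup>2)"
proof -
  let ?P = "norm (projected_gradient (G k) (g k))" and ?c = "norm (c (x k))"
  obtain \<gamma> where \<gamma>: "0 \<le> \<gamma>" "\<gamma> \<le> 1" and Gw: "G k *v w k = - \<gamma> *\<^sub>R c (x k)"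
    and nw: "norm (w k) \<le> \<gamma> * ?c / sqrt \<kappa>_1G"
    and \<gamma>c: "min (\<theta> * sqrt \<kappa>_1G * \<Delta> k) ?c \<le> \<gamma> * ?c"
    using normal_step_properties[OF gram_lower \<kappa>(4) \<theta>(1) \<Delta>_pos] by metis
  have D: "0 \<le> \<Delta> k" using \<Delta>_pos[of k] by simp
  have Lf: "0 \<le> L_f" using lipschitz_on_nonneg[OF f_lip] .
  have "f (x (Suc k)) \<le> f (x k) + g k \<bullet> (x (Suc k) - x k) + L_f * (norm (x (Suc k) - x k))\<^sup>2"
    by (rule descent_lemma[OF convex f_diff f_lip iterates iterates])
  also have "\<dots> \<le> f (x k) + g k \<bullet> (w k + t k) + L_f * (\<Delta> k)\<^sup>2"
    using mult_left_mono[OF step_sq_le Lf, of k] by (simp add: next_iterate)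
  also have "g k \<bullet> (w k + t k) = g k \<bullet> w k + m k \<bullet> t k - (m k - g k) \<bullet> t k"
    by (simp add: inner_add_right inner_diff_left)
  finally have f1: "f (x (Suc k)) \<le> f (x k) + g k \<bullet> w k + m k \<bullet> t k - (m k - g k) \<bullet> t k + L_f * (\<Delta> k)\<^sup>2"
    by simp
  have "g k \<bullet> w k \<le> norm (g k) * norm (w k)" by (rule norm_cauchy_schwarz)
  also have "\<dots> \<le> \<kappa>_f * (\<gamma> * ?c / sqrt \<kappa>_1G)"
    using g_bound nw \<kappa> by (intro mult_mono) auto
  finally have gw: "g k \<bullet> w k \<le> \<kappa>_f / sqrt \<kappa>_1G * (\<gamma> * ?c)" by simp
  have "\<bar>(m k - g k) \<bullet> t k\<bar> \<le> err k * norm (t k)" by (rule Cauchy_Schwarz_ineq2)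
  also have "\<dots> \<le> err k * \<Delta> k"
    using norm_t_le[of k] tangential_radius(3)[of k] by (intro mult_left_mono) auto
  finally have et: "- ((m k - g k) \<bullet> t k) \<le> \<Delta> k * err k" by (simp add: mult.commute)
  define E where "E = c (x (Suc k)) - c (x k) - G k *v (w k + t k)"
  have eq: "(1 - \<gamma>) *\<^sub>R c (x k) + E = c (x (Suc k))"
    by (simp add: E_def matrix_vector_right_distrib Gw jacobian_zmult[OF basis] scaleR_diff_left)
  have "norm (c (x (Suc k))) \<le> norm ((1 - \<gamma>) *\<^sub>R c (x k)) + norm E"
    unfolding eq[symmetric] by (rule norm_triangle_ineq)
  also have "norm E \<le> L_G * (\<Delta> k)\<^sup>2" using linearization_error by (simp add: E_def)
  also have "norm ((1 - \<gamma>) *\<^sub>R c (x k)) = ?c - \<gamma> * ?c" using \<gamma> by (simp add: left_diff_distrib)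
  finally have "\<mu> * norm (c (x (Suc k))) \<le> \<mu> * (?c - \<gamma> * ?c + L_G * (\<Delta> k)\<^sup>2)"
    using \<kappa> by (intro mult_left_mono) (auto simp: \<mu>_def)
  then have c1: "\<mu> * norm (c (x (Suc k))) \<le> \<mu> * ?c - \<kappa>_f / sqrt \<kappa>_1G * (\<gamma> * ?c) - \<gamma> * ?c + \<mu> * L_G * (\<Delta> k)\<^sup>2"
    by (simp add: \<mu>_def algebra_simps)
  have "\<beta> * (\<Delta> k * ?P) \<le> \<eta> * sqrt (1 - \<theta>\<^sup>2) * (\<Delta> k * ?P)"
    using D by (intro mult_right_mono) (auto simp: \<beta>_def)
  moreover have "\<beta> * (\<Delta> k * ?c) \<le> \<gamma> * ?c"
  proof -
    have "\<beta> * (\<Delta> k * ?c) \<le> (\<theta> * sqrt \<kappa>_1G / \<kappa>_c) * (\<Delta> k * \<kappa>_c)"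
      using D \<beta>_pos c_bound \<theta> \<kappa> by (intro mult_mono) (auto simp: \<beta>_def)
    then have 1: "\<beta> * (\<Delta> k * ?c) \<le> \<theta> * sqrt \<kappa>_1G * \<Delta> k" using \<kappa> by (simp add: field_simps)
    have "\<beta> * (\<Delta> k * ?c) \<le> (1 / \<Delta>_max) * (\<Delta>_max * ?c)"
      using D \<beta>_pos \<Delta>_max[of k] \<Delta>_max_pos by (intro mult_mono) (auto simp: \<beta>_def)
    then have "\<beta> * (\<Delta> k * ?c) \<le> ?c" using \<Delta>_max_pos by simp
    with 1 \<gamma>c show ?thesis by linarith
  qed
  ultimately show ?thesis
    using f1 gw et c1 tangential_model_decrease[of k]
    unfolding merit_def by (simp add: algebra_simps)
qed

lemma residual_diff_le: "\<exists>C. \<forall>k. \<bar>residual (Suc k) - residual k\<bar> \<le> C * \<Delta> k"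
proof -
  let ?P = "\<lambda>k. norm (projected_gradient (G k) (g k))"
  define CP where "CP = L_f + L_G * \<kappa>_f / sqrt \<kappa>_1G"
  have P: "?P j \<le> ?P i + CP * d" if d: "norm (x j - x i) \<le> d" for i j d
  proof -
    have Lf: "0 \<le> L_f" using lipschitz_on_nonneg[OF f_lip] .
    have "norm (g j - g i) \<le> L_f * norm (x j - x i)"
      using lipschitz_onD[OF f_lip iterates iterates] by (simp add: dist_norm)
    also have "\<dots> \<le> L_f * d" by (intro mult_left_mono d Lf)
    finally have 1: "norm (g j - g i) \<le> L_f * d" .
    have "opnorm (G j - G i) \<le> L_G * norm (x j - x i)" by (intro G_lip iterates)
    also have "\<dots> \<le> L_G * d" by (intro mult_left_mono d L_G)
    finally have "opnorm (G j - G i) * norm (g i) / sqrt \<kappa>_1G \<le> (L_G * d) * \<kappa>_f / sqrt \<kappa>_1G"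
      using g_bound \<kappa> L_G order_trans[OF norm_ge_zero d]
      by (intro divide_right_mono mult_mono) (auto intro!: mult_nonneg_nonneg)
    with 1 projected_gradient_lipschitz[OF gram_lower[of i] gram_lower[of j] \<kappa>(4), of "g j" "g i"]
    show ?thesis by (simp add: CP_def algebra_simps)
  qed
  have c: "norm (c (x (Suc k)) - c (x k)) \<le> (L_G * \<Delta>_max + sqrt \<kappa>_2G) * \<Delta> k" for k
  proof -
    have "norm (G k *v (w k + t k)) \<le> sqrt \<kappa>_2G * norm (w k + t k)"
      by (rule norm_jacobian_le[OF gram_upper \<kappa>(5)])
    also have "\<dots> \<le> sqrt \<kappa>_2G * \<Delta> k"
      using norm_step_le[of k] \<kappa> by (intro mult_left_mono) (auto simp: next_iterate)
    finally have "norm (G k *v (w k + t k)) \<le> sqrt \<kappa>_2G * \<Delta> k" .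
    moreover have "L_G * (\<Delta> k)\<^sup>2 \<le> L_G * (\<Delta>_max * \<Delta> k)"
      using \<Delta>_max[of k] \<Delta>_pos[of k] L_G by (auto simp: power2_eq_square intro!: mult_left_mono mult_right_mono)
    ultimately show ?thesis
      using linearization_error[of k]
        norm_triangle_sub[of "c (x (Suc k)) - c (x k)" "G k *v (w k + t k)"]
      by (simp add: algebra_simps)
  qed
  have "\<bar>residual (Suc k) - residual k\<bar> \<le> (CP + (L_G * \<Delta>_max + sqrt \<kappa>_2G)) * \<Delta> k" for k
  proof -
    have "\<bar>norm (c (x (Suc k))) - norm (c (x k))\<bar> \<le> (L_G * \<Delta>_max + sqrt \<kappa>_2G) * \<Delta> k"
      using c[of k] norm_triangle_ineq3 order_trans by blast
    moreover have "\<bar>?P (Suc k) - ?P k\<bar> \<le> CP * \<Delta> k"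
      using P[of "Suc k" k "\<Delta> k"] P[of k "Suc k" "\<Delta> k"] norm_step_le[of k]
      by (simp add: norm_minus_commute)
    ultimately show ?thesis by (simp add: algebra_simps)
  qed
  then show ?thesis by blast
qed

theorem residual_tendsto_zero:
  assumes sq: "summable (\<lambda>k. (\<Delta> k)\<^sup>2)" and div: "\<not> summable \<Delta>" and err: "summable (\<lambda>k. \<Delta> k * err k)"
  shows "residual \<longlonglongrightarrow> 0"
proof -
  have Lf: "0 \<le> L_f" using lipschitz_on_nonneg[OF f_lip] .
  have "summable (\<lambda>k. \<beta> * (\<Delta> k * residual k))"
  proof (rule summable_decrease[where \<phi> = merit and l = f_inf])
    show "summable (\<lambda>k. 2 * (\<Delta> k * err k) + (L_f + 3 * \<kappa>_B + \<mu> * L_G) * (\<Delta> k)\<^sup>2)"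
      by (intro summable_add summable_mult sq err)
    fix k
    have D: "0 \<le> \<Delta> k" using \<Delta>_pos[of k] by simp
    show "0 \<le> \<beta> * (\<Delta> k * residual k)" using D \<beta>_pos by simp
    show "0 \<le> 2 * (\<Delta> k * err k) + (L_f + 3 * \<kappa>_B + \<mu> * L_G) * (\<Delta> k)\<^sup>2"
      using D Lf L_G \<kappa> by (simp add: \<mu>_def)
    show "f_inf \<le> merit k" using f_bound[OF iterates] \<kappa> by (simp add: merit_def \<mu>_def add_increasing2)
  qed (rule merit_decrease)
  then have "summable (\<lambda>k. \<Delta> k * residual k)"
    using \<beta>_pos by (simp add: summable_cmult_iff)
  moreover obtain C where "\<And>k. \<bar>residual (Suc k) - residual k\<bar> \<le> C * \<Delta> k"
    using residual_diff_le by blast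
  ultimately show ?thesis
    using sq div \<Delta>_pos
    by (intro weighted_summable_imp_tendsto_zero[where a = residual and \<Delta> = \<Delta> and C = C]) (auto simp: less_imp_le)
qed

end

section \<open>Measurability and freezing\<close>

text \<open>A Caratheodory function is jointly measurable: \<open>X\<close> is approximated by simple functions, whose values
need not lie in \<open>\<Omega>\<close>. For this reason \<open>F\<close> is continued by zero, which does not affect the limits since \<open>\<Omega>\<close> is open.\<close>

lemma caratheodory_compose_measurable:
  fixes F :: "'a::{metric_space, second_countable_topology} \<Rightarrow> 's \<Rightarrow> real"
  assumes "open \<Omega>" and meas: "\<And>y. y \<in> \<Omega> \<Longrightarrow> F y \<in> borel_measurable P"
    and cont: "\<And>s. s \<in> space P \<Longrightarrow> continuous_on \<Omega> (\<lambda>y. F y s)"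
    and X [measurable]: "X \<in> borel_measurable N"
  shows "(\<lambda>(\<omega>, s). if X \<omega> \<in> \<Omega> then F (X \<omega>) s else 0) \<in> borel_measurable (N \<Otimes>\<^sub>M P)"
proof -
  define F0 where "F0 y s = (if y \<in> \<Omega> then F y s else 0)" for y s
  have F0 [measurable]: "F0 y \<in> borel_measurable P" for y
    using meas by (cases "y \<in> \<Omega>") (auto simp: F0_def[abs_def])
  have [measurable]: "\<Omega> \<in> sets borel" using \<open>open \<Omega>\<close> by simp
  obtain S where S: "\<And>i. simple_function N (S i)" "\<And>\<omega>. \<omega> \<in> space N \<Longrightarrow> (\<lambda>i. S i \<omega>) \<longlonglongrightarrow> X \<omega>"
    using borel_measurable_implies_sequence_metric[OF X, of undefined] by auto
  define H where "H i z = (if X (fst z) \<in> \<Omega> then F0 (S i (fst z)) (snd z) else 0)" for i z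
  have "H i \<in> borel_measurable (N \<Otimes>\<^sub>M P)" for i
  proof -
    have "(\<lambda>z. F0 (S i (fst z)) (snd z)) \<in> borel_measurable (N \<Otimes>\<^sub>M P)"
    proof (rule measurable_compose_countable'[where f = "\<lambda>y z. F0 y (snd z)" and I = "S i ` space N"])
      have "S i \<in> measurable N (count_space (S i ` space N))"
        using S(1)[of i] by (simp add: measurable_count_space_eq2 simple_function_def)
      then show "(\<lambda>z. S i (fst z)) \<in> measurable (N \<Otimes>\<^sub>M P) (count_space (S i ` space N))" by simp
      show "countable (S i ` space N)"
        using S(1)[of i] by (simp add: simple_function_def countable_finite)
    qed simp
    then show ?thesis unfolding H_def[abs_def] by measurable
  qed
  then have "(\<lambda>z. if X (fst z) \<in> \<Omega> then F (X (fst z)) (snd z) else 0) \<in> borel_measurable (N \<Otimes>\<^sub>M P)"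
  proof (rule borel_measurable_LIMSEQ_real[rotated])
    fix z assume "z \<in> space (N \<Otimes>\<^sub>M P)"
    then have z: "fst z \<in> space N" "snd z \<in> space P" by (auto simp: space_pair_measure)
    show "(\<lambda>i. H i z) \<longlonglongrightarrow> (if X (fst z) \<in> \<Omega> then F (X (fst z)) (snd z) else 0)"
    proof (cases "X (fst z) \<in> \<Omega>")
      case True
      have "isCont (\<lambda>y. F y (snd z)) (X (fst z))"
        using cont[OF z(2)] \<open>open \<Omega>\<close> True by (simp add: continuous_on_eq_continuous_at)
      then have "(\<lambda>i. F (S i (fst z)) (snd z)) \<longlonglongrightarrow> F (X (fst z)) (snd z)"
        using S(2)[OF z(1)] by (rule isCont_tendsto_compose)
      moreover have "\<forall>\<^sub>F i in sequentially. S i (fst z) \<in> \<Omega>"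
        using S(2)[OF z(1)] \<open>open \<Omega>\<close> True by (rule topological_tendstoD)
      then have "\<forall>\<^sub>F i in sequentially. F (S i (fst z)) (snd z) = H i z"
        by eventually_elim (simp add: H_def F0_def True)
      ultimately show ?thesis using True by (simp add: filterlim_cong[OF refl refl] tendsto_cong)
    qed (simp add: H_def)
  qed
  then show ?thesis by (simp add: case_prod_beta')
qed

lemma gradient_limit:
  fixes f :: "'a::euclidean_space \<Rightarrow> real"
  assumes "f differentiable (at x)"
  shows "(\<lambda>n. real (Suc n) * (f (x + (1 / real (Suc n)) *\<^sub>R b) - f x)) \<longlonglongrightarrow> gradient f x \<bullet> b"
proof -
  have "((\<lambda>t. f (x + t *\<^sub>R b)) has_derivative (\<lambda>t. gradient f x \<bullet> (t *\<^sub>R b))) (at 0)"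
  proof (rule has_derivative_compose[where f = "\<lambda>t. x + t *\<^sub>R b" and g = f
        and f' = "\<lambda>t. t *\<^sub>R b" and g' = "\<lambda>h. gradient f x \<bullet> h"])
    show "((\<lambda>t. x + t *\<^sub>R b) has_derivative (\<lambda>t. t *\<^sub>R b)) (at 0)"
      by (auto intro!: derivative_eq_intros)
    show "(f has_derivative (\<lambda>h. gradient f x \<bullet> h)) (at (x + 0 *\<^sub>R b))"
      using has_derivative_gradient[OF assms] by simp
  qed
  then have "DERIV (\<lambda>t. f (x + t *\<^sub>R b)) 0 :> gradient f x \<bullet> b"
    by (simp add: has_field_derivative_def mult_commute_abs)
  then have "((\<lambda>h. (f (x + h *\<^sub>R b) - f x) / h) \<longlongrightarrow> gradient f x \<bullet> b) (at 0)"
    by (simp add: DERIV_def)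
  moreover have "filterlim (\<lambda>n. 1 / real (Suc n)) (at 0) sequentially"
    unfolding filterlim_at using LIMSEQ_inverse_real_of_nat by (auto simp: inverse_eq_divide)
  ultimately have "(\<lambda>n. (f (x + (1 / real (Suc n)) *\<^sub>R b) - f x) / (1 / real (Suc n)))
      \<longlonglongrightarrow> gradient f x \<bullet> b"
    by (rule filterlim_compose)
  then show ?thesis by (simp add: mult.commute)
qed

lemma gradient_compose_measurable:
  fixes F :: "'a::euclidean_space \<Rightarrow> 's \<Rightarrow> real"
  assumes "open \<Omega>" and meas: "\<And>y. y \<in> \<Omega> \<Longrightarrow> F y \<in> borel_measurable P"
    and diff: "\<And>y s. y \<in> \<Omega> \<Longrightarrow> s \<in> space P \<Longrightarrow> (\<lambda>z. F z s) differentiable (at y)"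
    and X [measurable]: "X \<in> borel_measurable N" and X\<Omega>: "\<And>\<omega>. \<omega> \<in> space N \<Longrightarrow> X \<omega> \<in> \<Omega>"
  shows "(\<lambda>(\<omega>, s). gradient (\<lambda>z. F z s) (X \<omega>)) \<in> borel_measurable (N \<Otimes>\<^sub>M P)"
proof -
  have "(\<lambda>z. gradient (\<lambda>y. F y (snd z)) (X (fst z)) \<bullet> b) \<in> borel_measurable (N \<Otimes>\<^sub>M P)" for b
  proof (rule borel_measurable_LIMSEQ_real)
    define F0 where "F0 y s = (if y \<in> \<Omega> then F y s else 0)" for y s
    have "continuous_on \<Omega> (\<lambda>y. F y s)" if "s \<in> space P" for s
      using diff[OF _ that] by (intro continuous_at_imp_continuous_on ballI differentiable_imp_continuous_within)
    then have F0: "(\<lambda>z. F0 (Y (fst z)) (snd z)) \<in> borel_measurable (N \<Otimes>\<^sub>M P)"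
      if "Y \<in> borel_measurable N" for Y
      using caratheodory_compose_measurable[OF \<open>open \<Omega>\<close> meas _ that]
      by (simp add: F0_def case_prod_beta')
    define Q where "Q n z = real (Suc n) * (F0 (X (fst z) + (1 / real (Suc n)) *\<^sub>R b) (snd z) - F0 (X (fst z)) (snd z))"
      for n z
    show "Q n \<in> borel_measurable (N \<Otimes>\<^sub>M P)" for n
      unfolding Q_def[abs_def]
      by (intro borel_measurable_times borel_measurable_diff borel_measurable_const F0[of X]
          F0[of "\<lambda>\<omega>. X \<omega> + (1 / real (Suc n)) *\<^sub>R b"]) auto
    fix z assume "z \<in> space (N \<Otimes>\<^sub>M P)"
    then have z: "X (fst z) \<in> \<Omega>" "snd z \<in> space P" using X\<Omega> by (auto simp: space_pair_measure)
    have "(\<lambda>n. X (fst z) + (1 / real (Suc n)) *\<^sub>R b) \<longlonglongrightarrow> X (fst z) + 0 *\<^sub>R b"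
      using LIMSEQ_inverse_real_of_nat by (intro tendsto_intros) (simp add: inverse_eq_divide)
    then have "\<forall>\<^sub>F n in sequentially. X (fst z) + (1 / real (Suc n)) *\<^sub>R b \<in> \<Omega>"
      using \<open>open \<Omega>\<close> z by (intro topological_tendstoD) auto
    then have "\<forall>\<^sub>F n in sequentially. real (Suc n) * (F (X (fst z) + (1 / real (Suc n)) *\<^sub>R b) (snd z)
        - F (X (fst z)) (snd z)) = Q n z"
      by eventually_elim (simp add: Q_def F0_def z)
    then show "(\<lambda>n. Q n z) \<longlonglongrightarrow> gradient (\<lambda>y. F y (snd z)) (X (fst z)) \<bullet> b"
      using gradient_limit[OF diff[OF z], of b] by (rule Lim_transform_eventually[rotated])
  qed
  then show ?thesis
    by (subst borel_measurable_euclidean_space) (simp add: case_prod_beta')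
qed

text \<open>If \<open>X\<close> has law \<open>P\<close> and is independent of \<open>H\<close>, then the pair \<open>(\<omega>, X \<omega>)\<close> has the product law when \<open>\<omega>\<close> is
observed through \<open>H\<close> only.\<close>

lemma distr_pair_independent:
  assumes "prob_space M" "prob_space P" and H: "subalgebra M H" and X [measurable]: "X \<in> measurable M P"
    and indep: "\<And>A B. A \<in> sets H \<Longrightarrow> B \<in> sets P \<Longrightarrow>
      measure M (A \<inter> (X -` B \<inter> space M)) = measure M A * measure P B"
  shows "distr M (restr_to_subalg M H \<Otimes>\<^sub>M P) (\<lambda>\<omega>. (\<omega>, X \<omega>)) = restr_to_subalg M H \<Otimes>\<^sub>M P"
proof (rule pair_measure_eqI[symmetric])
  interpret M: prob_space M by fact
  interpret P: prob_space P by fact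
  interpret R: prob_space "restr_to_subalg M H" by (rule prob_space_restr_to_subalg) fact+
  show "sigma_finite_measure (restr_to_subalg M H)" "sigma_finite_measure P" by unfold_locales
  fix A B assume "A \<in> sets (restr_to_subalg M H)" and B: "B \<in> sets P"
  then have A: "A \<in> sets H" by (simp add: sets_restr_to_subalg[OF H])
  then have "A \<in> sets M" using H by (auto simp: subalgebra_def)
  have "(\<lambda>\<omega>. \<omega>) \<in> measurable M (restr_to_subalg M H)"
    by (rule measurableI) (use H in \<open>auto simp: space_restr_to_subalg sets_restr_to_subalg subalgebra_def dest: sets.sets_into_space\<close>)
  then have [measurable]: "(\<lambda>\<omega>. (\<omega>, X \<omega>)) \<in> measurable M (restr_to_subalg M H \<Otimes>\<^sub>M P)"
    by simp
  have "emeasure (distr M (restr_to_subalg M H \<Otimes>\<^sub>M P) (\<lambda>\<omega>. (\<omega>, X \<omega>))) (A \<times> B)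
      = emeasure M ((\<lambda>\<omega>. (\<omega>, X \<omega>)) -` (A \<times> B) \<inter> space M)"
    using A B by (intro emeasure_distr) (auto simp: sets_restr_to_subalg[OF H])
  also have "(\<lambda>\<omega>. (\<omega>, X \<omega>)) -` (A \<times> B) \<inter> space M = A \<inter> (X -` B \<inter> space M)"
    using sets.sets_into_space[OF \<open>A \<in> sets M\<close>] by auto
  also have "emeasure M \<dots> = ennreal (measure M A * measure P B)"
    using indep[OF A B] by (simp add: M.emeasure_eq_measure)
  also have "\<dots> = emeasure (restr_to_subalg M H) A * emeasure P B"
    by (simp add: emeasure_restr_to_subalg[OF H A] M.emeasure_eq_measure P.emeasure_eq_measure ennreal_mult)
  finally show "emeasure (restr_to_subalg M H) A * emeasure P B
      = emeasure (distr M (restr_to_subalg M H \<Otimes>\<^sub>M P) (\<lambda>\<omega>. (\<omega>, X \<omega>))) (A \<times> B)" by simp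
qed simp

text \<open>The freezing lemma: conditioning on \<open>H\<close> integrates out the independent variable \<open>X\<close>. The right-hand side does not
depend on \<open>H\<close>, so two \<open>\<sigma>\<close>-algebras that satisfy the hypotheses give the same conditional
expectation.\<close>

lemma cond_exp_frozen:
  fixes v :: "'w \<Rightarrow> 's \<Rightarrow> real"
  assumes "prob_space M" "prob_space P" and H: "subalgebra M H" and X [measurable]: "X \<in> measurable M P"
    and indep: "\<And>A B. A \<in> sets H \<Longrightarrow> B \<in> sets P \<Longrightarrow>
      measure M (A \<inter> (X -` B \<inter> space M)) = measure M A * measure P B"
    and v: "(\<lambda>(\<omega>, s). v \<omega> s) \<in> borel_measurable (H \<Otimes>\<^sub>M P)"
    and int: "integrable M (\<lambda>\<omega>. v \<omega> (X \<omega>))"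
  shows "AE \<omega> in M. real_cond_exp M H (\<lambda>\<omega>. v \<omega> (X \<omega>)) \<omega> = (\<integral>s. v \<omega> s \<partial>P)"
proof -
  let ?R = "restr_to_subalg M H"
  interpret M: prob_space M by fact
  interpret P: prob_space P by fact
  interpret R: prob_space ?R by (rule prob_space_restr_to_subalg) fact+
  interpret RP: pair_sigma_finite ?R P by unfold_locales
  interpret finite_measure_subalgebra M H by unfold_locales (rule H)
  have setsRP: "sets (?R \<Otimes>\<^sub>M P) = sets (H \<Otimes>\<^sub>M P)"
    by (intro sets_pair_measure_cong sets_restr_to_subalg H refl)
  have v' [measurable]: "(\<lambda>(\<omega>, s). v \<omega> s) \<in> borel_measurable (?R \<Otimes>\<^sub>M P)"
    using v measurable_cong_sets[OF setsRP refl] by blast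
  have "(\<lambda>\<omega>. \<omega>) \<in> measurable M ?R"
    by (rule measurableI) (use H in \<open>auto simp: space_restr_to_subalg sets_restr_to_subalg subalgebra_def dest: sets.sets_into_space\<close>)
  then have pair [measurable]: "(\<lambda>\<omega>. (\<omega>, X \<omega>)) \<in> measurable M (?R \<Otimes>\<^sub>M P)"
    by simp
  note distr = distr_pair_independent[OF assms(1,2) H X indep]
  have int_eq: "integrable (?R \<Otimes>\<^sub>M P) (\<lambda>(\<omega>, s). w \<omega> s) \<longleftrightarrow> integrable M (\<lambda>\<omega>. w \<omega> (X \<omega>))"
    and lint_eq: "(\<integral>z. (case z of (\<omega>, s) \<Rightarrow> w \<omega> s) \<partial>(?R \<Otimes>\<^sub>M P)) = (\<integral>\<omega>. w \<omega> (X \<omega>) \<partial>M)"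
    if "(\<lambda>(\<omega>, s). w \<omega> s) \<in> borel_measurable (?R \<Otimes>\<^sub>M P)" for w :: "'w \<Rightarrow> 's \<Rightarrow> real"
    using integrable_distr_eq[OF pair that] integral_distr[OF pair that] by (simp_all add: distr)
  have vint: "integrable (?R \<Otimes>\<^sub>M P) (\<lambda>(\<omega>, s). v \<omega> s)" using int int_eq[OF v'] by simp
  have gR: "integrable ?R (\<lambda>\<omega>. \<integral>s. v \<omega> s \<partial>P)" using RP.integrable_fst'[OF vint] by simp
  show ?thesis
  proof (rule real_cond_exp_charact)
    show "integrable M (\<lambda>\<omega>. v \<omega> (X \<omega>))" by fact
    show "integrable M (\<lambda>\<omega>. \<integral>s. v \<omega> s \<partial>P)" by (rule integrable_from_subalg[OF H gR])
    show gH: "(\<lambda>\<omega>. \<integral>s. v \<omega> s \<partial>P) \<in> borel_measurable H"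
      by (rule measurable_in_subalg'[OF H]) (use gR in auto)
    fix A assume A: "A \<in> sets H"
    then have [measurable]: "A \<in> sets ?R" by (simp add: sets_restr_to_subalg[OF H])
    let ?w = "\<lambda>\<omega> s. indicator A \<omega> * v \<omega> s"
    have w: "(\<lambda>(\<omega>, s). ?w \<omega> s) \<in> borel_measurable (?R \<Otimes>\<^sub>M P)" by measurable
    have Am: "A \<in> sets M" using A H by (auto simp: subalgebra_def)
    have "integrable M (\<lambda>\<omega>. ?w \<omega> (X \<omega>))"
      using integrable_mult_indicator[OF Am int] by simp
    then have wint: "integrable (?R \<Otimes>\<^sub>M P) (\<lambda>(\<omega>, s). ?w \<omega> s)" using int_eq[OF w] by simp
    have "(\<integral>\<omega>\<in>A. v \<omega> (X \<omega>) \<partial>M) = (\<integral>\<omega>. ?w \<omega> (X \<omega>) \<partial>M)"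
      by (simp add: set_lebesgue_integral_def)
    also have "\<dots> = (\<integral>\<omega>. (\<integral>s. ?w \<omega> s \<partial>P) \<partial>?R)"
      using lint_eq[OF w] RP.integral_fst'[OF wint] by simp
    also have "\<dots> = (\<integral>\<omega>. indicator A \<omega> * (\<integral>s. v \<omega> s \<partial>P) \<partial>?R)" by simp
    also have "\<dots> = (\<integral>\<omega>. indicator A \<omega> * (\<integral>s. v \<omega> s \<partial>P) \<partial>M)"
      by (rule integral_subalgebra2[OF H]) (intro borel_measurable_times borel_measurable_indicator gH A)
    finally show "(\<integral>\<omega>\<in>A. v \<omega> (X \<omega>) \<partial>M) = (\<integral>\<omega>\<in>A. (\<integral>s. v \<omega> s \<partial>P) \<partial>M)"
      by (simp add: set_lebesgue_integral_def)
  qed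
qed

text \<open>The conditional law \<open>P\<close> is not random, so the samples are in fact independent of \<open>\<F>\<close>.\<close>

lemma cond_iid_prob:
  assumes "prob_space M" "prob_space P" and F: "subalgebra M \<F>" and iid: "cond_iid M \<F> P I X" and "finite I"
    and D: "D \<in> sets \<F>" and A: "\<And>i. i \<in> I \<Longrightarrow> A i \<in> sets P"
  shows "measure M (D \<inter> {\<omega>\<in>space M. \<forall>i\<in>I. X i \<omega> \<in> A i}) = measure M D * (\<Prod>i\<in>I. measure P (A i))"
proof -
  interpret M: prob_space M by fact
  interpret finite_measure_subalgebra M \<F> by unfold_locales (rule F)
  let ?E = "{\<omega>\<in>space M. \<forall>i\<in>I. X i \<omega> \<in> A i}"
  have X [measurable]: "\<And>i. i \<in> I \<Longrightarrow> X i \<in> measurable M P" using iid by (simp add: cond_iid_def)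
  have E [measurable]: "?E \<in> sets M"
    using A \<open>finite I\<close> by measurable
  have DM: "D \<in> sets M" using D F by (auto simp: subalgebra_def)
  have "AE \<omega> in M. \<forall>i\<in>I. cond_prob_sub M \<F> (X i -` A i \<inter> space M) \<omega> = measure P (A i)"
    using iid A \<open>finite I\<close> by (intro AE_finite_allI) (auto simp: cond_iid_def)
  moreover have "AE \<omega> in M. cond_prob_sub M \<F> ?E \<omega> = (\<Prod>i\<in>I. cond_prob_sub M \<F> (X i -` A i \<inter> space M) \<omega>)"
    using iid A by (auto simp: cond_iid_def)
  ultimately have ae: "AE \<omega> in M. real_cond_exp M \<F> (indicator ?E) \<omega> = (\<Prod>i\<in>I. measure P (A i))"
    by eventually_elim (simp add: cond_prob_sub_def)
  have "measure M (D \<inter> ?E) = (\<integral>\<omega>\<in>D. indicator ?E \<omega> \<partial>M)"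
    using DM by (simp add: set_lebesgue_integral_def indicator_inter_arith[symmetric])
  also have "\<dots> = (\<integral>\<omega>\<in>D. real_cond_exp M \<F> (indicator ?E) \<omega> \<partial>M)"
    using D by (intro real_cond_exp_intA) (auto simp: M.emeasure_eq_measure)
  also have "\<dots> = (\<integral>\<omega>. (\<Prod>i\<in>I. measure P (A i)) * indicator D \<omega> \<partial>M)"
    unfolding set_lebesgue_integral_def
  proof (rule integral_cong_AE)
    show "AE \<omega> in M. indicator D \<omega> *\<^sub>R real_cond_exp M \<F> (indicator ?E) \<omega> = (\<Prod>i\<in>I. measure P (A i)) * indicator D \<omega>"
      using ae by eventually_elim simp
  qed (use DM in measurable)
  also have "\<dots> = measure M D * (\<Prod>i\<in>I. measure P (A i))" using DM by simp
  finally show ?thesis .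
qed

section \<open>Independence within a batch\<close>

lemma cond_iid_prob_subset:
  assumes M: "prob_space M" "prob_space P" and F: "subalgebra M \<F>" and iid: "cond_iid M \<F> P I X"
    and "finite I" and J: "J \<subseteq> I"
    and D: "D \<in> sets \<F>" and A: "\<And>i. i \<in> J \<Longrightarrow> A i \<in> sets P"
  shows "measure M (D \<inter> {\<omega>\<in>space M. \<forall>i\<in>J. X i \<omega> \<in> A i}) = measure M D * (\<Prod>i\<in>J. measure P (A i))"
proof -
  interpret P: prob_space P by fact
  define A' where "A' i = (if i \<in> J then A i else space P)" for i
  have X: "\<And>i. i \<in> I \<Longrightarrow> X i \<in> measurable M P" using iid by (simp add: cond_iid_def)
  have "{\<omega>\<in>space M. \<forall>i\<in>J. X i \<omega> \<in> A i} = {\<omega>\<in>space M. \<forall>i\<in>I. X i \<omega> \<in> A' i}"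
    using J measurable_space[OF X] by (auto simp: A'_def)
  moreover have "(\<Prod>i\<in>I. measure P (A' i)) = (\<Prod>i\<in>J. measure P (A i))"
    using \<open>finite I\<close> J P.prob_space by (intro prod.mono_neutral_cong_right) (auto simp: A'_def)
  moreover have "A' i \<in> sets P" for i using A by (simp add: A'_def)
  ultimately show ?thesis
    using cond_iid_prob[OF M F iid \<open>finite I\<close> D, of A'] by simp
qed

text \<open>The \<open>\<sigma>\<close>-algebra generated by \<open>\<F>\<close> and the samples \<open>X i\<close> (\<open>i \<in> J\<close>), given by a generator that is stable
under intersections.\<close>

definition batch_algebra ::
  "'w measure \<Rightarrow> 'w measure \<Rightarrow> 's measure \<Rightarrow> 'i set \<Rightarrow> ('i \<Rightarrow> 'w \<Rightarrow> 's) \<Rightarrow> 'w measure" where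
  "batch_algebra M \<F> P J X = sigma (space M)
     {D \<inter> {\<omega>\<in>space M. \<forall>i\<in>J. X i \<omega> \<in> A i} | D A. D \<in> sets \<F> \<and> (\<forall>i\<in>J. A i \<in> sets P)}"

lemma batch_algebra:
  assumes F: "subalgebra M \<F>"
  shows space_batch_algebra: "space (batch_algebra M \<F> P J X) = space M"
    and sets_batch_algebra: "sets (batch_algebra M \<F> P J X) = sigma_sets (space M)
      {D \<inter> {\<omega>\<in>space M. \<forall>i\<in>J. X i \<omega> \<in> A i} | D A. D \<in> sets \<F> \<and> (\<forall>i\<in>J. A i \<in> sets P)}"
proof -
  have *: "{D \<inter> {\<omega>\<in>space M. \<forall>i\<in>J. X i \<omega> \<in> A i} | D A. D \<in> sets \<F> \<and> (\<forall>i\<in>J. A i \<in> sets P)} \<subseteq> Pow (space M)"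
    by auto
  show "space (batch_algebra M \<F> P J X) = space M"
    unfolding batch_algebra_def by (rule space_measure_of[OF *])
  show "sets (batch_algebra M \<F> P J X) = sigma_sets (space M)
      {D \<inter> {\<omega>\<in>space M. \<forall>i\<in>J. X i \<omega> \<in> A i} | D A. D \<in> sets \<F> \<and> (\<forall>i\<in>J. A i \<in> sets P)}"
    unfolding batch_algebra_def by (rule sets_measure_of[OF *])
qed

lemma subalgebra_batch_algebra:
  assumes F: "subalgebra M \<F>" and "finite J" and X [measurable]: "\<And>i. i \<in> J \<Longrightarrow> X i \<in> measurable M P"
  shows "subalgebra M (batch_algebra M \<F> P J X)"
proof -
  have "D \<inter> {\<omega>\<in>space M. \<forall>i\<in>J. X i \<omega> \<in> A i} \<in> sets M"
    if "D \<in> sets \<F>" "\<forall>i\<in>J. A i \<in> sets P" for D A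
  proof -
    have "D \<in> sets M" using that F by (auto simp: subalgebra_def)
    moreover have "{\<omega>\<in>space M. \<forall>i\<in>J. X i \<omega> \<in> A i} \<in> sets M"
    proof (rule sets.sets_Collect_finite_All[OF _ \<open>finite J\<close>])
      fix i assume "i \<in> J"
      then have "X i -` A i \<inter> space M \<in> sets M" using that X by (auto intro: measurable_sets)
      then show "{\<omega>\<in>space M. X i \<omega> \<in> A i} \<in> sets M" by (simp add: vimage_def Int_def conj_commute)
    qed
    ultimately show ?thesis by (rule sets.Int)
  qed
  then have "sigma_sets (space M) {D \<inter> {\<omega>\<in>space M. \<forall>i\<in>J. X i \<omega> \<in> A i} | D A. D \<in> sets \<F> \<and> (\<forall>i\<in>J. A i \<in> sets P)}
      \<subseteq> sets M"
    by (intro sets.sigma_sets_subset) auto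
  then show ?thesis
    by (simp add: subalgebra_def space_batch_algebra[OF F] sets_batch_algebra[OF F])
qed

lemma sets_base_subset_batch_algebra:
  assumes F: "subalgebra M \<F>" and X: "\<And>i. i \<in> J \<Longrightarrow> X i \<in> measurable M P"
  shows "sets \<F> \<subseteq> sets (batch_algebra M \<F> P J X)"
proof
  fix D assume D: "D \<in> sets \<F>"
  then have "D \<subseteq> space M" using sets.sets_into_space[OF D] F by (simp add: subalgebra_def)
  then have "D = D \<inter> {\<omega>\<in>space M. \<forall>i\<in>J. X i \<omega> \<in> space P}"
    using measurable_space[OF X] by auto
  then show "D \<in> sets (batch_algebra M \<F> P J X)"
    unfolding sets_batch_algebra[OF F] using D
    by (intro sigma_sets.Basic) (auto intro!: exI[of _ D] exI[of _ "\<lambda>_. space P"])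
qed

lemma measurable_batch_algebra:
  assumes F: "subalgebra M \<F>" and X: "\<And>i. i \<in> J \<Longrightarrow> X i \<in> measurable M P" and "j \<in> J"
  shows "X j \<in> measurable (batch_algebra M \<F> P J X) P"
proof (rule measurableI)
  fix \<omega> assume "\<omega> \<in> space (batch_algebra M \<F> P J X)"
  then show "X j \<omega> \<in> space P" using measurable_space[OF X[OF \<open>j \<in> J\<close>]] by (simp add: space_batch_algebra[OF F])
next
  fix B assume B: "B \<in> sets P"
  let ?A = "\<lambda>i. if i = j then B else space P"
  have "X j -` B \<inter> space M = space M \<inter> {\<omega>\<in>space M. \<forall>i\<in>J. X i \<omega> \<in> ?A i}"
    using measurable_space[OF X] \<open>j \<in> J\<close> by auto
  moreover have "space M \<in> sets \<F>" using F sets.top[of \<F>] by (simp add: subalgebra_def)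
  ultimately show "X j -` B \<inter> space (batch_algebra M \<F> P J X) \<in> sets (batch_algebra M \<F> P J X)"
    unfolding sets_batch_algebra[OF F] space_batch_algebra[OF F] using B
    by (intro sigma_sets.Basic) (auto intro!: exI[of _ "space M"] exI[of _ ?A])
qed

lemma batch_algebra_independent:
  assumes M: "prob_space M" "prob_space P" and F: "subalgebra M \<F>" and iid: "cond_iid M \<F> P I X"
    and "finite I" and J: "J \<subseteq> I" and j: "j \<in> I" "j \<notin> J"
    and A: "A \<in> sets (batch_algebra M \<F> P J X)" and B: "B \<in> sets P"
  shows "measure M (A \<inter> (X j -` B \<inter> space M)) = measure M A * measure P B"
proof -
  interpret M: prob_space M by fact
  have X: "\<And>i. i \<in> I \<Longrightarrow> X i \<in> measurable M P" using iid by (simp add: cond_iid_def)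
  have "finite J" using J \<open>finite I\<close> finite_subset by blast
  let ?G = "{D \<inter> {\<omega>\<in>space M. \<forall>i\<in>J. X i \<omega> \<in> A i} | D A. D \<in> sets \<F> \<and> (\<forall>i\<in>J. A i \<in> sets P)}"
  have sub: "sigma_sets (space M) ?G \<subseteq> sets M"
    using subalgebra_batch_algebra[OF F \<open>finite J\<close>, of X P] X J
    unfolding subalgebra_def sets_batch_algebra[OF F] by auto
  let ?E = "X j -` B \<inter> space M"
  have E: "?E \<in> sets M" using X[OF j(1)] B by (rule measurable_sets)
  have "Int_stable ?G"
  proof (rule Int_stableI)
    fix a b assume "a \<in> ?G" "b \<in> ?G"
    then obtain D A D' A' where "D \<in> sets \<F>" "\<forall>i\<in>J. A i \<in> sets P" "D' \<in> sets \<F>" "\<forall>i\<in>J. A' i \<in> sets P"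
      and "a = D \<inter> {\<omega>\<in>space M. \<forall>i\<in>J. X i \<omega> \<in> A i}" "b = D' \<inter> {\<omega>\<in>space M. \<forall>i\<in>J. X i \<omega> \<in> A' i}"
      by auto
    then show "a \<inter> b \<in> ?G"
      by (intro CollectI exI[of _ "D \<inter> D'"] exI[of _ "\<lambda>i. A i \<inter> A' i"]) auto
  qed
  moreover have "?G \<subseteq> Pow (space M)" by auto
  moreover have "A \<in> sigma_sets (space M) ?G" using A by (simp add: sets_batch_algebra[OF F])
  ultimately show ?thesis
  proof (induction A rule: sigma_sets_induct_disjoint)
    case (basic A)
    then obtain D A' where D: "D \<in> sets \<F>" and A': "\<forall>i\<in>J. A' i \<in> sets P"
      and eq: "A = D \<inter> {\<omega>\<in>space M. \<forall>i\<in>J. X i \<omega> \<in> A' i}" by auto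
    let ?A = "A'(j := B)"
    have "A \<inter> ?E = D \<inter> {\<omega>\<in>space M. \<forall>i\<in>insert j J. X i \<omega> \<in> ?A i}"
      using j(2) by (auto simp: eq)
    also have "measure M \<dots> = measure M D * (\<Prod>i\<in>insert j J. measure P (?A i))"
      by (rule cond_iid_prob_subset[OF M F iid \<open>finite I\<close> _ D]) (use A' B j J in auto)
    also have "(\<Prod>i\<in>insert j J. measure P (?A i)) = measure P B * (\<Prod>i\<in>J. measure P (A' i))"
    proof -
      have "(\<Prod>i\<in>J. measure P (?A i)) = (\<Prod>i\<in>J. measure P (A' i))"
        using j(2) by (intro prod.cong) auto
      then show ?thesis using \<open>finite J\<close> j(2) by simp
    qed
    also have "measure M D * \<dots> = measure M A * measure P B"
      using cond_iid_prob_subset[OF M F iid \<open>finite I\<close> J D, of A'] A' by (simp add: eq)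
    finally show ?case .
  next
    case empty
    then show ?case by simp
  next
    case (compl A)
    then have AM: "A \<in> sets M" using sub by auto
    have "measure M ((space M - A) \<inter> ?E) = measure M (?E - A \<inter> ?E)"
      by (rule arg_cong[where f = "measure M"]) auto
    also have "\<dots> = measure M ?E - measure M (A \<inter> ?E)"
      using AM E by (intro M.finite_measure_Diff) auto
    also have "measure M ?E = measure P B"
    proof -
      have "space M \<in> sets \<F>" using F sets.top[of \<F>] by (simp add: subalgebra_def)
      moreover have "?E = space M \<inter> {\<omega>\<in>space M. \<forall>i\<in>{j}. X i \<omega> \<in> B}" by auto
      ultimately show ?thesis
        using cond_iid_prob_subset[OF M F iid \<open>finite I\<close>, of "{j}" "space M" "\<lambda>_. B"] j B M.prob_space by simp
    qed
    finally show ?case using compl AM by (simp add: M.prob_compl algebra_simps)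
  next
    case (union A)
    then have AM: "range A \<subseteq> sets M" using sub by auto
    have dis: "disjoint_family (\<lambda>i. A i \<inter> ?E)"
      using union(1) by (auto simp: disjoint_family_on_def)
    have "(\<lambda>i. measure M (A i \<inter> ?E)) sums measure M (\<Union>i. A i \<inter> ?E)"
      using AM E dis by (intro M.finite_measure_UNION) auto
    moreover have "(\<lambda>i. measure M (A i) * measure P B) sums (measure M (\<Union>i. A i) * measure P B)"
      using AM union(1) by (intro sums_mult2 M.finite_measure_UNION) auto
    ultimately show ?case
      using union(3) sums_unique2 by (simp add: Int_UN_distrib2) blast
  qed
qed

section \<open>Moments of sums of martingale differences\<close>

lemma borel_measurable_vec_component [measurable (raw)]:
  fixes f :: "'w \<Rightarrow> real^'d"
  assumes "f \<in> borel_measurable N"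
  shows "(\<lambda>\<omega>. f \<omega> $ j) \<in> borel_measurable N"
proof (rule measurable_compose[OF assms])
  show "(\<lambda>v::real^'d. v $ j) \<in> borel_measurable borel"
    by (intro borel_measurable_continuous_onI continuous_intros)
qed

lemma norm_powr_add_bound:
  fixes a b :: "'a::real_normed_vector"
  assumes "0 < p" "p \<le> 2"
  shows "norm (a + b) powr p \<le> 4 * (norm a powr p + norm b powr p)"
proof -
  have "norm (a + b) powr p \<le> (2 * max (norm a) (norm b)) powr p"
    using assms norm_triangle_ineq[of a b] by (intro powr_mono2) auto
  also have "\<dots> = 2 powr p * max (norm a) (norm b) powr p"
    by (simp add: powr_mult)
  also have "\<dots> \<le> 4 * max (norm a) (norm b) powr p"
    using powr_mono[of p 2 "2::real"] assms by (intro mult_right_mono) auto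
  also have "\<dots> \<le> 4 * (norm a powr p + norm b powr p)"
    by (auto simp: max_def)
  finally show ?thesis .
qed

lemma norm_powr_mult_norm_bound:
  fixes a b :: "'a::real_normed_vector"
  assumes "1 < p"
  shows "norm a powr (p - 1) * norm b \<le> norm a powr p + norm b powr p"
proof -
  let ?M = "max (norm a) (norm b)"
  have "norm a powr (p - 1) * norm b \<le> ?M powr (p - 1) * ?M"
    using assms by (intro mult_mono powr_mono2) auto
  also have "\<dots> = ?M powr p"
    using powr_mult_base[of ?M "p - 1"] by (simp add: mult.commute max.coboundedI1)
  also have "\<dots> \<le> norm a powr p + norm b powr p" by (auto simp: max_def)
  finally show ?thesis .
qed

lemma integrable_vec_component_of_moment:
  fixes b :: "'w \<Rightarrow> real^'d"
  assumes "prob_space M" and b [measurable]: "b \<in> borel_measurable M"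
    and int: "integrable M (\<lambda>\<omega>. norm (b \<omega>) powr p)" and "1 < p"
  shows "integrable M (\<lambda>\<omega>. b \<omega> $ j)"
proof (rule Bochner_Integration.integrable_bound)
  interpret M: prob_space M by fact
  show "integrable M (\<lambda>\<omega>. 1 + norm (b \<omega>) powr p)"
    by (intro Bochner_Integration.integrable_add int) simp
  have "\<bar>b \<omega> $ j\<bar> \<le> 1 + norm (b \<omega>) powr p" for \<omega>
  proof (cases "norm (b \<omega>) \<le> 1")
    case True
    then show ?thesis
      using component_le_norm_cart[of "b \<omega>" j] powr_ge_zero[of "norm (b \<omega>)" p] by linarith
  next
    case False
    then have "norm (b \<omega>) powr 1 \<le> norm (b \<omega>) powr p" using \<open>1 < p\<close> by (intro powr_mono) auto
    then show ?thesis using False component_le_norm_cart[of "b \<omega>" j] by simp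
  qed
  then show "AE \<omega> in M. norm (b \<omega> $ j) \<le> norm (1 + norm (b \<omega>) powr p)"
    by (intro AE_I2) (simp add: abs_of_nonneg add_nonneg_nonneg)
qed measurable

text \<open>The linear term of \<open>norm_add_powr_le\<close> has expectation zero, because its factor depending on \<open>A\<close> is
\<open>H\<close>-measurable.\<close>

lemma norm_powr_martingale_step:
  fixes A b :: "'w \<Rightarrow> real^'d"
  assumes "prob_space M" and H: "subalgebra M H" and p: "1 < p" "p \<le> 2"
    and A: "A \<in> borel_measurable H" and b [measurable]: "b \<in> borel_measurable M"
    and Ap: "integrable M (\<lambda>\<omega>. norm (A \<omega>) powr p)" and bp: "integrable M (\<lambda>\<omega>. norm (b \<omega>) powr p)"
    and zero: "\<And>j. AE \<omega> in M. real_cond_exp M H (\<lambda>\<omega>. b \<omega> $ j) \<omega> = 0"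
  shows "integrable M (\<lambda>\<omega>. norm (A \<omega> + b \<omega>) powr p)"
    and "(\<integral>\<omega>. norm (A \<omega> + b \<omega>) powr p \<partial>M)
      \<le> (\<integral>\<omega>. norm (A \<omega>) powr p \<partial>M) + 6 * (\<integral>\<omega>. norm (b \<omega>) powr p \<partial>M)"
proof -
  interpret M: prob_space M by fact
  interpret finite_measure_subalgebra M H by unfold_locales (rule H)
  have AM [measurable]: "A \<in> borel_measurable M" by (rule measurable_from_subalg[OF H A])
  have dom: "integrable M (\<lambda>\<omega>. 4 * (norm (A \<omega>) powr p + norm (b \<omega>) powr p))"
    by (intro integrable_mult_right Bochner_Integration.integrable_add Ap bp)
  show sum_int: "integrable M (\<lambda>\<omega>. norm (A \<omega> + b \<omega>) powr p)"
  proof (rule Bochner_Integration.integrable_bound[OF dom])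
    show "AE \<omega> in M. norm (norm (A \<omega> + b \<omega>) powr p) \<le> norm (4 * (norm (A \<omega>) powr p + norm (b \<omega>) powr p))"
      using norm_powr_add_bound[of p] p by (intro AE_I2) simp
  qed measurable
  define h where "h \<omega> = (p * norm (A \<omega>) powr (p - 2)) *\<^sub>R A \<omega>" for \<omega>
  have h: "h \<in> borel_measurable H" unfolding h_def[abs_def] using A by measurable
  have hb: "norm (h \<omega>) * norm (b \<omega>) \<le> 4 * (norm (A \<omega>) powr p + norm (b \<omega>) powr p)" for \<omega>
  proof -
    have "norm (h \<omega>) * norm (b \<omega>) = p * (norm (A \<omega>) powr (p - 1) * norm (b \<omega>))"
      using p powr_mult_base[of "norm (A \<omega>)" "p - 2"] by (simp add: h_def mult_ac)
    also have "\<dots> \<le> 4 * (norm (A \<omega>) powr p + norm (b \<omega>) powr p)"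
      using p norm_powr_mult_norm_bound[OF p(1)] by (intro mult_mono) auto
    finally show ?thesis .
  qed
  have hj: "integrable M (\<lambda>\<omega>. h \<omega> $ j * b \<omega> $ j)" "(\<integral>\<omega>. h \<omega> $ j * b \<omega> $ j \<partial>M) = 0" for j
  proof -
    have hjH: "(\<lambda>\<omega>. h \<omega> $ j) \<in> borel_measurable H" using h by measurable
    then have hjM [measurable]: "(\<lambda>\<omega>. h \<omega> $ j) \<in> borel_measurable M" by (rule measurable_from_subalg[OF H])
    have bj [measurable]: "(\<lambda>\<omega>. b \<omega> $ j) \<in> borel_measurable M" by measurable
    show int: "integrable M (\<lambda>\<omega>. h \<omega> $ j * b \<omega> $ j)"
    proof (rule Bochner_Integration.integrable_bound[OF dom])
      show "AE \<omega> in M. norm (h \<omega> $ j * b \<omega> $ j) \<le> norm (4 * (norm (A \<omega>) powr p + norm (b \<omega>) powr p))"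
      proof (rule AE_I2)
        fix \<omega>
        have "norm (h \<omega> $ j * b \<omega> $ j) \<le> norm (h \<omega>) * norm (b \<omega>)"
          using component_le_norm_cart[of "h \<omega>" j] component_le_norm_cart[of "b \<omega>" j]
          by (simp add: abs_mult mult_mono)
        then show "norm (h \<omega> $ j * b \<omega> $ j) \<le> norm (4 * (norm (A \<omega>) powr p + norm (b \<omega>) powr p))"
          using hb[of \<omega>] by simp
      qed
    qed measurable
    have "(\<integral>\<omega>. h \<omega> $ j * b \<omega> $ j \<partial>M) = (\<integral>\<omega>. h \<omega> $ j * real_cond_exp M H (\<lambda>\<omega>. b \<omega> $ j) \<omega> \<partial>M)"
      by (rule real_cond_exp_intg(2)[OF int hjH bj, symmetric])
    also have "\<dots> = (\<integral>\<omega>. 0 \<partial>M)"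
    proof (rule integral_cong_AE)
      show "AE \<omega> in M. h \<omega> $ j * real_cond_exp M H (\<lambda>\<omega>. b \<omega> $ j) \<omega> = 0"
        using zero[of j] by eventually_elim simp
    qed measurable
    finally show "(\<integral>\<omega>. h \<omega> $ j * b \<omega> $ j \<partial>M) = 0" by simp
  qed
  have inner: "h \<omega> \<bullet> b \<omega> = (\<Sum>j\<in>UNIV. h \<omega> $ j * b \<omega> $ j)" for \<omega> by (simp add: inner_vec_def)
  have hb_int: "integrable M (\<lambda>\<omega>. h \<omega> \<bullet> b \<omega>)" and hb_zero: "(\<integral>\<omega>. h \<omega> \<bullet> b \<omega> \<partial>M) = 0"
    unfolding inner using hj by (auto simp: Bochner_Integration.integral_sum)
  have "(\<integral>\<omega>. norm (A \<omega> + b \<omega>) powr p \<partial>M)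
      \<le> (\<integral>\<omega>. (norm (A \<omega>) powr p + h \<omega> \<bullet> b \<omega>) + 6 * norm (b \<omega>) powr p \<partial>M)"
  proof (rule integral_mono[OF sum_int])
    show "integrable M (\<lambda>\<omega>. (norm (A \<omega>) powr p + h \<omega> \<bullet> b \<omega>) + 6 * norm (b \<omega>) powr p)"
      by (intro Bochner_Integration.integrable_add integrable_mult_right Ap bp hb_int)
    show "norm (A \<omega> + b \<omega>) powr p \<le> (norm (A \<omega>) powr p + h \<omega> \<bullet> b \<omega>) + 6 * norm (b \<omega>) powr p" for \<omega>
      using norm_add_powr_le[OF p, of "A \<omega>" "b \<omega>"] by (simp add: h_def)
  qed
  also have "\<dots> = (\<integral>\<omega>. norm (A \<omega>) powr p \<partial>M) + 6 * (\<integral>\<omega>. norm (b \<omega>) powr p \<partial>M)"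
    using Ap bp hb_int by (simp add: hb_zero)
  finally show "(\<integral>\<omega>. norm (A \<omega> + b \<omega>) powr p \<partial>M)
      \<le> (\<integral>\<omega>. norm (A \<omega>) powr p \<partial>M) + 6 * (\<integral>\<omega>. norm (b \<omega>) powr p \<partial>M)" .
qed

text \<open>Conditioning on further samples of the batch does not change the conditional expectation of a
function of a sample and of the past: both sides equal the integral over \<open>P\<close> of the frozen function.\<close>

lemma cond_exp_batch_algebra:
  fixes v :: "'w \<Rightarrow> 's \<Rightarrow> real"
  assumes M: "prob_space M" "prob_space P" and F: "subalgebra M \<F>" and iid: "cond_iid M \<F> P I X"
    and I: "finite I" and J: "J \<subseteq> I" and j: "j \<in> I" "j \<notin> J"
    and v: "(\<lambda>(\<omega>, s). v \<omega> s) \<in> borel_measurable (\<F> \<Otimes>\<^sub>M P)"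
    and int: "integrable M (\<lambda>\<omega>. v \<omega> (X j \<omega>))"
  shows "AE \<omega> in M. real_cond_exp M (batch_algebra M \<F> P J X) (\<lambda>\<omega>. v \<omega> (X j \<omega>)) \<omega>
    = real_cond_exp M \<F> (\<lambda>\<omega>. v \<omega> (X j \<omega>)) \<omega>"
proof -
  let ?H = "batch_algebra M \<F> P J X"
  have X: "\<And>i. i \<in> I \<Longrightarrow> X i \<in> measurable M P" using iid by (simp add: cond_iid_def)
  have XJ: "\<And>i. i \<in> J \<Longrightarrow> X i \<in> measurable M P" using X J by blast
  have H: "subalgebra M ?H"
    using XJ finite_subset[OF J I] by (rule subalgebra_batch_algebra[OF F, rotated])
  have sub: "sets \<F> \<subseteq> sets ?H" using XJ by (rule sets_base_subset_batch_algebra[OF F])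
  have indep: "measure M (A \<inter> (X j -` B \<inter> space M)) = measure M A * measure P B"
    if "A \<in> sets ?H" "B \<in> sets P" for A B
    by (rule batch_algebra_independent[OF M F iid I J j that])
  have "subalgebra ?H \<F>" using sub F by (simp add: subalgebra_def space_batch_algebra[OF F])
  then have id: "(\<lambda>\<omega>. \<omega>) \<in> measurable ?H \<F>"
    by (intro measurableI) (auto simp: subalgebra_def dest: sets.sets_into_space)
  have "(\<lambda>z. (fst z, snd z)) \<in> measurable (?H \<Otimes>\<^sub>M P) (\<F> \<Otimes>\<^sub>M P)"
    using measurable_compose[OF measurable_fst id] by (intro measurable_Pair) auto
  from measurable_compose[OF this v]
  have vH: "(\<lambda>(\<omega>, s). v \<omega> s) \<in> borel_measurable (?H \<Otimes>\<^sub>M P)" by (simp add: case_prod_beta')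
  have "AE \<omega> in M. real_cond_exp M ?H (\<lambda>\<omega>. v \<omega> (X j \<omega>)) \<omega> = (\<integral>s. v \<omega> s \<partial>P)"
    by (rule cond_exp_frozen[OF M H X[OF j(1)] indep vH int])
  moreover have "AE \<omega> in M. real_cond_exp M \<F> (\<lambda>\<omega>. v \<omega> (X j \<omega>)) \<omega> = (\<integral>s. v \<omega> s \<partial>P)"
    by (rule cond_exp_frozen[OF M F X[OF j(1)] _ v int]) (use sub indep in auto)
  ultimately show ?thesis by eventually_elim simp
qed

text \<open>The samples are added one at a time. The \<open>p\<close>-th moment of the average of \<open>N\<close> samples (\<open>a = 1 / N\<close>) is therefore
of order \<open>N powr (1 - p)\<close>.\<close>

lemma batch_moment_bound:
  fixes V :: "'w \<Rightarrow> 's \<Rightarrow> real^'d"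
  assumes M: "prob_space M" "prob_space P" and F: "subalgebra M \<F>" and iid: "cond_iid M \<F> P {1..N} X"
    and p: "1 < p" "p \<le> 2"
    and V: "(\<lambda>(\<omega>, s). V \<omega> s) \<in> borel_measurable (\<F> \<Otimes>\<^sub>M P)"
    and mom: "\<And>i. i \<in> {1..N} \<Longrightarrow> integrable M (\<lambda>\<omega>. norm (V \<omega> (X i \<omega>)) powr p)"
      "\<And>i. i \<in> {1..N} \<Longrightarrow> (\<integral>\<omega>. norm (V \<omega> (X i \<omega>)) powr p \<partial>M) \<le> K"
    and zero: "\<And>i j. i \<in> {1..N} \<Longrightarrow> AE \<omega> in M. real_cond_exp M \<F> (\<lambda>\<omega>. V \<omega> (X i \<omega>) $ j) \<omega> = 0"
    and A: "A \<in> borel_measurable \<F>" "integrable M (\<lambda>\<omega>. norm (A \<omega>) powr p)" and "0 \<le> a"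
  shows "integrable M (\<lambda>\<omega>. norm (A \<omega> + a *\<^sub>R (\<Sum>i\<in>{1..N}. V \<omega> (X i \<omega>))) powr p) \<and>
    (\<integral>\<omega>. norm (A \<omega> + a *\<^sub>R (\<Sum>i\<in>{1..N}. V \<omega> (X i \<omega>))) powr p \<partial>M)
      \<le> (\<integral>\<omega>. norm (A \<omega>) powr p \<partial>M) + real N * (6 * a powr p * K)"
proof -
  interpret M: prob_space M by fact
  have X: "\<And>i. i \<in> {1..N} \<Longrightarrow> X i \<in> measurable M P" using iid by (simp add: cond_iid_def)
  define S where "S n \<omega> = A \<omega> + a *\<^sub>R (\<Sum>i\<in>{1..n}. V \<omega> (X i \<omega>))" for n \<omega>
  have "n \<le> N \<Longrightarrow> integrable M (\<lambda>\<omega>. norm (S n \<omega>) powr p) \<and>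
    (\<integral>\<omega>. norm (S n \<omega>) powr p \<partial>M) \<le> (\<integral>\<omega>. norm (A \<omega>) powr p \<partial>M) + real n * (6 * a powr p * K)" for n
  proof (induction n)
    case 0
    then show ?case using A by (simp add: S_def)
  next
    case (Suc n)
    then have IH: "integrable M (\<lambda>\<omega>. norm (S n \<omega>) powr p)"
      "(\<integral>\<omega>. norm (S n \<omega>) powr p \<partial>M) \<le> (\<integral>\<omega>. norm (A \<omega>) powr p \<partial>M) + real n * (6 * a powr p * K)"
      by auto
    let ?i = "Suc n" let ?H = "batch_algebra M \<F> P {1..n} X"
    define b where "b \<omega> = a *\<^sub>R V \<omega> (X ?i \<omega>)" for \<omega>
    have i: "?i \<in> {1..N}" "?i \<notin> {1..n}" and J: "{1..n} \<subseteq> {1..N}" using Suc.prems by auto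
    have XJ: "\<And>i. i \<in> {1..n} \<Longrightarrow> X i \<in> measurable M P" using X J by blast
    have H: "subalgebra M ?H" by (rule subalgebra_batch_algebra[OF F _ XJ]) auto
    have sub: "sets \<F> \<subseteq> sets ?H" using XJ by (rule sets_base_subset_batch_algebra[OF F])
    have compose: "(\<lambda>\<omega>. V \<omega> (X i \<omega>)) \<in> borel_measurable L"
      if "X i \<in> measurable L P" "space L = space M" "sets \<F> \<subseteq> sets L" for i and L :: "'w measure"
    proof -
      have "(\<lambda>\<omega>. \<omega>) \<in> measurable L \<F>"
        using that F by (intro measurableI) (auto simp: subalgebra_def dest: sets.sets_into_space)
      then have "(\<lambda>\<omega>. (\<omega>, X i \<omega>)) \<in> measurable L (\<F> \<Otimes>\<^sub>M P)" using that(1) by (rule measurable_Pair)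
      from measurable_compose[OF this V] show ?thesis by simp
    qed
    have VM: "(\<lambda>\<omega>. V \<omega> (X ?i \<omega>)) \<in> borel_measurable M"
      using F by (intro compose X i) (auto simp: subalgebra_def)
    have "A \<in> borel_measurable ?H"
      using sub F by (intro measurable_from_subalg[OF _ A(1)]) (simp add: subalgebra_def space_batch_algebra[OF F])
    moreover have "(\<lambda>\<omega>. V \<omega> (X i \<omega>)) \<in> borel_measurable ?H" if "i \<in> {1..n}" for i
      using measurable_batch_algebra[OF F XJ that] sub by (intro compose) (simp_all add: space_batch_algebra[OF F])
    ultimately have SH: "S n \<in> borel_measurable ?H"
      unfolding S_def[abs_def] by (intro borel_measurable_add borel_measurable_scaleR borel_measurable_sum) auto
    have bM: "b \<in> borel_measurable M" unfolding b_def[abs_def] using VM by measurable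
    have bp: "norm (b \<omega>) powr p = a powr p * norm (V \<omega> (X ?i \<omega>)) powr p" for \<omega>
      using \<open>0 \<le> a\<close> by (simp add: b_def powr_mult)
    have bint: "integrable M (\<lambda>\<omega>. norm (b \<omega>) powr p)" unfolding bp by (intro integrable_mult_right mom i)
    have bK: "(\<integral>\<omega>. norm (b \<omega>) powr p \<partial>M) \<le> a powr p * K"
      unfolding bp using mom(2)[OF i(1)] by (auto intro!: mult_left_mono)
    have bzero: "AE \<omega> in M. real_cond_exp M ?H (\<lambda>\<omega>. b \<omega> $ j) \<omega> = 0" for j
    proof -
      interpret H: finite_measure_subalgebra M ?H by unfold_locales (rule H)
      from borel_measurable_vec_component[OF V] have v: "(\<lambda>(\<omega>, s). V \<omega> s $ j) \<in> borel_measurable (\<F> \<Otimes>\<^sub>M P)" by (simp add: case_prod_beta')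
      have int: "integrable M (\<lambda>\<omega>. V \<omega> (X ?i \<omega>) $ j)"
        using mom(1)[OF i(1)] p(1) by (intro integrable_vec_component_of_moment[OF M(1) VM])
      have "AE \<omega> in M. real_cond_exp M ?H (\<lambda>\<omega>. a * (V \<omega> (X ?i \<omega>) $ j)) \<omega>
          = a * real_cond_exp M ?H (\<lambda>\<omega>. V \<omega> (X ?i \<omega>) $ j) \<omega>"
        using int by (rule H.real_cond_exp_cmult)
      moreover have "AE \<omega> in M. real_cond_exp M ?H (\<lambda>\<omega>. V \<omega> (X ?i \<omega>) $ j) \<omega>
          = real_cond_exp M \<F> (\<lambda>\<omega>. V \<omega> (X ?i \<omega>) $ j) \<omega>"
        by (rule cond_exp_batch_algebra[OF M F iid _ J i v int]) simp
      ultimately show ?thesis using zero[OF i(1), of j] unfolding b_def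
        by eventually_elim simp
    qed
    have S: "S (Suc n) \<omega> = S n \<omega> + b \<omega>" for \<omega>
      by (simp add: S_def b_def scaleR_add_right)
    show ?case
      using norm_powr_martingale_step[OF M(1) H p SH bM IH(1) bint bzero] IH(2) bK
      by (auto simp: S algebra_simps)
  qed
  from this[of N] show ?thesis by (simp add: S_def)
qed

section \<open>Summability of the momentum error\<close>

text \<open>The momentum recursion started from zero, with inputs \<open>d k\<close> and weights \<open>\<nu> k\<close>.\<close>

primrec moving_average :: "(nat \<Rightarrow> real) \<Rightarrow> (nat \<Rightarrow> 'a::real_vector) \<Rightarrow> nat \<Rightarrow> 'a" where
  "moving_average \<nu> d 0 = \<nu> 0 *\<^sub>R d 0"
| "moving_average \<nu> d (Suc k) = (1 - \<nu> (Suc k)) *\<^sub>R moving_average \<nu> d k + \<nu> (Suc k) *\<^sub>R d (Suc k)"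

text \<open>After removal of the averaged noise \<open>g k - q k\<close>, the error of the momentum \<open>m k\<close> as an estimate of \<open>q k\<close> is driven by the
increments of \<open>q\<close> only.\<close>

lemma momentum_drift_recursion:
  assumes "\<And>k. m k = (1 - \<nu> k) *\<^sub>R (if k = 0 then m_init else m (k - 1)) + \<nu> k *\<^sub>R g k"
  shows "m (Suc k) - q (Suc k) - moving_average \<nu> (\<lambda>k. g k - q k) (Suc k)
    = (1 - \<nu> (Suc k)) *\<^sub>R ((m k - q k - moving_average \<nu> (\<lambda>k. g k - q k) k) + (q k - q (Suc k)))"
  using assms[of "Suc k"] by (simp add: algebra_simps)

lemma summable_powr_Suc_iff: "summable (\<lambda>k. real (k + 1) powr s) \<longleftrightarrow> s < - 1"
  using summable_Suc_iff[of "\<lambda>n. real n powr s"] by (simp add: summable_real_powr_iff)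

lemma momentum_drift_summable:
  fixes m g q :: "nat \<Rightarrow> 'a::real_normed_vector"
  assumes rec: "\<And>k. m k = (1 - \<nu> k) *\<^sub>R (if k = 0 then m_init else m (k - 1)) + \<nu> k *\<^sub>R g k"
    and q: "\<And>k. norm (q (Suc k) - q k) \<le> L * \<Delta> k" and "0 \<le> L"
    and \<Delta>: "\<And>k. \<Delta> k = \<Delta>0 / real (k + 1) powr a1" and \<nu>: "\<And>k. \<nu> k = \<nu>0 / real (k + 1) powr a2"
    and "0 < \<Delta>0" "0 < \<nu>0" "\<nu>0 \<le> 1" "a1 \<le> 1" "0 < a2" "a2 < 2 * a1 - 1"
  shows "summable (\<lambda>k. \<Delta> k * norm (m k - q k - moving_average \<nu> (\<lambda>k. g k - q k) k))"
proof -
  define y where "y k = norm (m k - q k - moving_average \<nu> (\<lambda>k. g k - q k) k)" for k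
  define C where "C = L * \<Delta>0 * 2 powr a1 / \<nu>0"
  have "0 < a1" "a2 < 1" "a2 < a1" using assms by linarith+
  have step: "y (Suc k) \<le> (1 - \<nu>0 / real (k + 2) powr a2) * y k
      + C * (\<nu>0 / real (k + 2) powr a2) * real (k + 2) powr (- (a1 - a2))" for k
  proof -
    have "1 \<le> real (k + 2) powr a2" using \<open>0 < a2\<close> by (intro ge_one_powr_ge_zero) auto
    then have \<nu>1: "0 \<le> \<nu> (Suc k)" "\<nu> (Suc k) \<le> 1"
      using assms by (auto simp: \<nu> divide_simps add.commute)
    have "y (Suc k) = (1 - \<nu> (Suc k)) * norm ((m k - q k - moving_average \<nu> (\<lambda>k. g k - q k) k) + (q k - q (Suc k)))"
      unfolding y_def momentum_drift_recursion[OF rec] using \<nu>1 by simp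
    also have "\<dots> \<le> (1 - \<nu> (Suc k)) * (y k + L * \<Delta> k)"
      using \<nu>1 q[of k] norm_triangle_ineq[of "m k - q k - moving_average \<nu> (\<lambda>k. g k - q k) k" "q k - q (Suc k)"]
      by (intro mult_left_mono) (auto simp: y_def norm_minus_commute)
    also have "\<dots> \<le> (1 - \<nu> (Suc k)) * y k + L * \<Delta> k"
      using \<nu>1 \<open>0 \<le> L\<close> \<open>0 < \<Delta>0\<close> mult_right_mono[of "1 - \<nu> (Suc k)" 1 "L * \<Delta> k"]
      by (simp add: distrib_left \<Delta>)
    also have "L * \<Delta> k \<le> C * \<nu>0 * real (k + 2) powr (- a1)"
    proof -
      have "real (k + 2) powr a1 \<le> (2 * real (k + 1)) powr a1"
        using \<open>0 < a1\<close> by (intro powr_mono2) auto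
      also have "\<dots> = 2 powr a1 * real (k + 1) powr a1" by (subst powr_mult) simp_all
      finally have "1 / real (k + 1) powr a1 \<le> 2 powr a1 / real (k + 2) powr a1"
        by (simp add: field_simps)
      then have "(L * \<Delta>0) * (1 / real (k + 1) powr a1) \<le> (L * \<Delta>0) * (2 powr a1 / real (k + 2) powr a1)"
        using \<open>0 \<le> L\<close> \<open>0 < \<Delta>0\<close> by (intro mult_left_mono) auto
      moreover have "C * \<nu>0 = (L * \<Delta>0) * 2 powr a1" using \<open>0 < \<nu>0\<close> by (simp add: C_def)
      ultimately show ?thesis by (simp add: \<Delta> powr_minus divide_inverse mult_ac)
    qed
    also have "real (k + 2) powr (- a1) = real (k + 2) powr (- a2) * real (k + 2) powr (- (a1 - a2))"
      by (simp flip: powr_add)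
    finally show ?thesis
      by (simp add: \<nu> powr_minus divide_inverse mult_ac add_ac)
  qed
  have C: "0 \<le> C" using \<open>0 \<le> L\<close> \<open>0 < \<Delta>0\<close> \<open>0 < \<nu>0\<close> by (simp add: C_def)
  have y: "0 \<le> y k" and a: "0 \<le> a1 - a2" for k using \<open>a2 < a1\<close> by (auto simp: y_def)
  obtain D where D: "\<And>k. y k \<le> D * real (k + 1) powr (- (a1 - a2))"
    using momentum_recursion_decay[OF \<open>0 < \<nu>0\<close> \<open>\<nu>0 \<le> 1\<close> \<open>0 < a2\<close> \<open>a2 < 1\<close> a C y step] by blast
  have "summable (\<lambda>k. \<Delta>0 * D * real (k + 1) powr (- (2 * a1 - a2)))"
    using assms by (intro summable_mult) (simp only: summable_powr_Suc_iff)
  then have "summable (\<lambda>k. \<Delta> k * y k)"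
  proof (rule summable_comparison_test'[where N = 0])
    fix k
    have "\<Delta> k * y k \<le> \<Delta> k * (D * real (k + 1) powr (- (a1 - a2)))"
      using D[of k] \<open>0 < \<Delta>0\<close> by (intro mult_left_mono) (auto simp: \<Delta>)
    also have "\<dots> = \<Delta>0 * D * (real (k + 1) powr (- a1) * real (k + 1) powr (- (a1 - a2)))"
      by (simp add: \<Delta> powr_minus divide_inverse)
    also have "real (k + 1) powr (- a1) * real (k + 1) powr (- (a1 - a2)) = real (k + 1) powr (- (2 * a1 - a2))"
      by (simp flip: powr_add)
    finally show "norm (\<Delta> k * y k) \<le> \<Delta>0 * D * real (k + 1) powr (- (2 * a1 - a2))"
      using \<open>0 < \<Delta>0\<close> by (simp add: y_def \<Delta>)
  qed
  then show ?thesis by (simp add: y_def)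
qed

lemma AE_summable_of_summable_expectations:
  fixes X :: "nat \<Rightarrow> 'w \<Rightarrow> real"
  assumes int: "\<And>k. integrable M (X k)" and nonneg: "\<And>k \<omega>. 0 \<le> X k \<omega>"
    and sum: "summable (\<lambda>k. \<integral>\<omega>. X k \<omega> \<partial>M)"
  shows "AE \<omega> in M. summable (\<lambda>k. X k \<omega>)"
proof -
  have [measurable]: "X k \<in> borel_measurable M" for k using int by auto
  have "(\<integral>\<^sup>+\<omega>. (\<Sum>k. ennreal (X k \<omega>)) \<partial>M) = (\<Sum>k. \<integral>\<^sup>+\<omega>. ennreal (X k \<omega>) \<partial>M)"
    by (rule nn_integral_suminf) measurable
  also have "\<dots> = (\<Sum>k. ennreal (\<integral>\<omega>. X k \<omega> \<partial>M))"
    using int nonneg by (simp add: nn_integral_eq_integral)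
  also have "\<dots> = ennreal (\<Sum>k. \<integral>\<omega>. X k \<omega> \<partial>M)"
    using nonneg sum by (intro suminf_ennreal2) auto
  finally have "(\<integral>\<^sup>+\<omega>. (\<Sum>k. ennreal (X k \<omega>)) \<partial>M) \<noteq> \<infinity>" by simp
  then have "AE \<omega> in M. (\<Sum>k. ennreal (X k \<omega>)) \<noteq> \<infinity>"
    by (intro nn_integral_PInf_AE) measurable
  then show ?thesis
    by eventually_elim (use nonneg in \<open>auto intro!: summable_suminf_not_top\<close>)
qed

lemma sample_filtration:
  assumes X: "\<And>k i. i \<in> {1..N k} \<Longrightarrow> \<xi> k i \<in> measurable M P"
  shows subalgebra_sample_filtration: "subalgebra M (sample_filtration M P N \<xi> k)"
    and sample_filtration_mono: "sets (sample_filtration M P N \<xi> k) \<subseteq> sets (sample_filtration M P N \<xi> (Suc k))"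
    and measurable_sample_filtration:
      "i \<in> {1..N k} \<Longrightarrow> \<xi> k i \<in> measurable (sample_filtration M P N \<xi> (Suc k)) P"
proof -
  define E where "E k = {\<xi> j i -` A \<inter> space M | j i A. j < k \<and> i \<in> {1..N j} \<and> A \<in> sets P}" for k
  have E: "E k \<subseteq> sets M" for k using X by (auto simp: E_def intro: measurable_sets)
  then have Pow: "E k \<subseteq> Pow (space M)" for k using sets.sets_into_space by blast
  have sp: "space (sample_filtration M P N \<xi> k) = space M"
    and st: "sets (sample_filtration M P N \<xi> k) = sigma_sets (space M) (E k)" for k
    using Pow[of k] unfolding sample_filtration_def E_def[symmetric] by auto
  show "subalgebra M (sample_filtration M P N \<xi> k)"
    unfolding subalgebra_def using sets.sigma_sets_subset[OF E[of k]] by (simp add: sp st)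
  show "sets (sample_filtration M P N \<xi> k) \<subseteq> sets (sample_filtration M P N \<xi> (Suc k))"
    unfolding st by (intro sigma_sets_mono') (auto simp: E_def intro: less_SucI)
  show "\<xi> k i \<in> measurable (sample_filtration M P N \<xi> (Suc k)) P" if i: "i \<in> {1..N k}"
  proof (rule measurableI)
    show "\<xi> k i \<omega> \<in> space P" if "\<omega> \<in> space (sample_filtration M P N \<xi> (Suc k))" for \<omega>
      using measurable_space[OF X[OF i]] that by (simp add: sp)
    show "\<xi> k i -` A \<inter> space (sample_filtration M P N \<xi> (Suc k)) \<in> sets (sample_filtration M P N \<xi> (Suc k))"
      if "A \<in> sets P" for A
      unfolding sp st using that i by (intro sigma_sets.Basic) (auto simp: E_def)
  qed
qed

lemma integrable_of_cond_moment:
  assumes "prob_space M" and F: "subalgebra M \<F>" and [measurable]: "Y \<in> borel_measurable M"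
    and nonneg: "\<And>\<omega>. 0 \<le> Y \<omega>" and "0 \<le> K"
    and ae: "AE \<omega> in M. nn_cond_exp M \<F> (\<lambda>\<omega>. ennreal (Y \<omega>)) \<omega> \<le> ennreal K"
  shows "integrable M Y" and "(\<integral>\<omega>. Y \<omega> \<partial>M) \<le> K"
proof -
  interpret M: prob_space M by fact
  interpret finite_measure_subalgebra M \<F> by unfold_locales (rule F)
  have "(\<integral>\<^sup>+\<omega>. ennreal (Y \<omega>) \<partial>M) = (\<integral>\<^sup>+\<omega>. 1 * nn_cond_exp M \<F> (\<lambda>\<omega>. ennreal (Y \<omega>)) \<omega> \<partial>M)"
    by (subst nn_cond_exp_intg) auto
  also have "\<dots> \<le> (\<integral>\<^sup>+\<omega>. ennreal K \<partial>M)"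
    using ae by (intro nn_integral_mono_AE) auto
  also have "\<dots> = ennreal K" by (simp add: M.emeasure_space_1)
  finally have le: "(\<integral>\<^sup>+\<omega>. ennreal (Y \<omega>) \<partial>M) \<le> ennreal K" .
  then show int: "integrable M Y"
    using nonneg by (intro integrableI_nonneg) (auto simp: less_top[symmetric] top_unique)
  show "(\<integral>\<omega>. Y \<omega> \<partial>M) \<le> K"
    using le nonneg \<open>0 \<le> K\<close> by (simp add: nn_integral_eq_integral[OF int])
qed

text \<open>The two terms come from \<open>(1 - \<nu>) powr p \<le> 1 - \<nu>\<close> and from the \<open>N\<close> samples of the batch, each of weight
\<open>\<nu> / N\<close>.\<close>

lemma noise_moment_recursion:
  fixes V :: "nat \<Rightarrow> 'w \<Rightarrow> 's \<Rightarrow> real^'d" and \<nu> :: "nat \<Rightarrow> real"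
  assumes M: "prob_space M" "prob_space P" and F: "\<And>k. subalgebra M (\<F> k)"
    and mono: "\<And>k. sets (\<F> k) \<subseteq> sets (\<F> (Suc k))"
    and iid: "\<And>k. cond_iid M (\<F> k) P {1..N k} (\<xi> k)"
    and \<xi>: "\<And>k i. i \<in> {1..N k} \<Longrightarrow> \<xi> k i \<in> measurable (\<F> (Suc k)) P"
    and p: "1 < p" "p \<le> 2" and \<nu>: "\<And>k. 0 \<le> \<nu> k" "\<And>k. \<nu> k \<le> 1"
    and V: "\<And>k. (\<lambda>(\<omega>, s). V k \<omega> s) \<in> borel_measurable (\<F> k \<Otimes>\<^sub>M P)"
    and mom: "\<And>k i. i \<in> {1..N k} \<Longrightarrow> integrable M (\<lambda>\<omega>. norm (V k \<omega> (\<xi> k i \<omega>)) powr p)"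
      "\<And>k i. i \<in> {1..N k} \<Longrightarrow> (\<integral>\<omega>. norm (V k \<omega> (\<xi> k i \<omega>)) powr p \<partial>M) \<le> K"
    and zero: "\<And>k i j. i \<in> {1..N k} \<Longrightarrow> AE \<omega> in M. real_cond_exp M (\<F> k) (\<lambda>\<omega>. V k \<omega> (\<xi> k i \<omega>) $ j) \<omega> = 0"
  defines "noise k \<omega> \<equiv> moving_average \<nu> (\<lambda>k. (1 / real (N k)) *\<^sub>R (\<Sum>i\<in>{1..N k}. V k \<omega> (\<xi> k i \<omega>))) k"
  shows "integrable M (\<lambda>\<omega>. norm (noise k \<omega>) powr p)"
    and "(\<integral>\<omega>. norm (noise (Suc k) \<omega>) powr p \<partial>M) \<le> (1 - \<nu> (Suc k)) * (\<integral>\<omega>. norm (noise k \<omega>) powr p \<partial>M)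
      + 6 * K * real (N (Suc k)) * (\<nu> (Suc k) / real (N (Suc k))) powr p"
proof -
  define batch where "batch k \<omega> = (\<Sum>i\<in>{1..N k}. V k \<omega> (\<xi> k i \<omega>))" for k \<omega>
  have bm: "batch k \<in> borel_measurable (\<F> (Suc k))" for k
    unfolding batch_def[abs_def]
  proof (rule borel_measurable_sum)
    fix i assume i: "i \<in> {1..N k}"
    have "(\<lambda>\<omega>. \<omega>) \<in> measurable (\<F> (Suc k)) (\<F> k)"
      using F[of k] F[of "Suc k"] mono[of k]
      by (intro measurableI) (auto simp: subalgebra_def dest: sets.sets_into_space)
    then have "(\<lambda>\<omega>. (\<omega>, \<xi> k i \<omega>)) \<in> measurable (\<F> (Suc k)) (\<F> k \<Otimes>\<^sub>M P)"
      using \<xi>[OF i] by (rule measurable_Pair)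
    from measurable_compose[OF this V] show "(\<lambda>\<omega>. V k \<omega> (\<xi> k i \<omega>)) \<in> borel_measurable (\<F> (Suc k))" by simp
  qed
  have noise0: "noise 0 \<omega> = 0 + (\<nu> 0 / real (N 0)) *\<^sub>R batch 0 \<omega>" for \<omega>
    by (simp add: noise_def batch_def)
  have noise_Suc: "noise (Suc k) \<omega> = (1 - \<nu> (Suc k)) *\<^sub>R noise k \<omega> + (\<nu> (Suc k) / real (N (Suc k))) *\<^sub>R batch (Suc k) \<omega>"
    for k \<omega> by (simp add: noise_def batch_def)
  have bound: "integrable M (\<lambda>\<omega>. norm (A \<omega> + (\<nu> k / real (N k)) *\<^sub>R batch k \<omega>) powr p) \<and>
    (\<integral>\<omega>. norm (A \<omega> + (\<nu> k / real (N k)) *\<^sub>R batch k \<omega>) powr p \<partial>M)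
      \<le> (\<integral>\<omega>. norm (A \<omega>) powr p \<partial>M) + real (N k) * (6 * (\<nu> k / real (N k)) powr p * K)"
    if "A \<in> borel_measurable (\<F> k)" "integrable M (\<lambda>\<omega>. norm (A \<omega>) powr p)" for A k
    unfolding batch_def using \<nu>(1)[of k]
    by (intro batch_moment_bound[OF M F iid p V mom zero that]) auto
  have noise: "noise k \<in> borel_measurable (\<F> (Suc k)) \<and> integrable M (\<lambda>\<omega>. norm (noise k \<omega>) powr p)" for k
  proof (induction k)
    case 0
    show ?case
      using bound[of "\<lambda>_. 0" 0] bm[of 0] by (auto simp: noise0[abs_def] p)
  next
    case (Suc k)
    let ?A = "\<lambda>\<omega>. (1 - \<nu> (Suc k)) *\<^sub>R noise k \<omega>"
    have "?A \<in> borel_measurable (\<F> (Suc k))" 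
      by (intro borel_measurable_scaleR borel_measurable_const Suc.IH[THEN conjunct1])
    moreover have "integrable M (\<lambda>\<omega>. norm (?A \<omega>) powr p)"
      using Suc \<nu>[of "Suc k"] by (simp add: powr_mult)
    moreover have "noise k \<in> borel_measurable (\<F> (Suc (Suc k)))"
      using Suc F[of "Suc k"] F[of "Suc (Suc k)"] mono[of "Suc k"]
      by (intro measurable_from_subalg[of "\<F> (Suc (Suc k))" "\<F> (Suc k)"]) (auto simp: subalgebra_def)
    ultimately show ?case
      using bound[of ?A "Suc k"] bm[of "Suc k"] by (auto simp: noise_Suc[abs_def])
  qed
  then show "integrable M (\<lambda>\<omega>. norm (noise k \<omega>) powr p)" by simp
  let ?A = "\<lambda>\<omega>. (1 - \<nu> (Suc k)) *\<^sub>R noise k \<omega>"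
  have \<nu>': "0 \<le> 1 - \<nu> (Suc k)" "1 - \<nu> (Suc k) \<le> 1" using \<nu>[of "Suc k"] by auto
  have A: "?A \<in> borel_measurable (\<F> (Suc k))"
    by (intro borel_measurable_scaleR borel_measurable_const noise[THEN conjunct1])
  have eq: "norm (?A \<omega>) powr p = (1 - \<nu> (Suc k)) powr p * norm (noise k \<omega>) powr p" for \<omega>
    using \<nu>' by (simp add: powr_mult)
  have int: "integrable M (\<lambda>\<omega>. norm (?A \<omega>) powr p)" unfolding eq using noise by simp
  have "(\<integral>\<omega>. norm (?A \<omega>) powr p \<partial>M) \<le> (1 - \<nu> (Suc k)) * (\<integral>\<omega>. norm (noise k \<omega>) powr p \<partial>M)"
  proof -
    have "(1 - \<nu> (Suc k)) powr p \<le> (1 - \<nu> (Suc k)) powr 1"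
      using \<nu>' p by (intro powr_mono') auto
    then show ?thesis unfolding eq using \<nu>' by (auto intro!: mult_right_mono)
  qed
  then show "(\<integral>\<omega>. norm (noise (Suc k) \<omega>) powr p \<partial>M) \<le> (1 - \<nu> (Suc k)) * (\<integral>\<omega>. norm (noise k \<omega>) powr p \<partial>M)
      + 6 * K * real (N (Suc k)) * (\<nu> (Suc k) / real (N (Suc k))) powr p"
    using bound[OF A int] by (simp add: noise_Suc[abs_def] mult_ac)
qed

text \<open>The moment recursion gives \<open>E \<parallel>n k\<parallel> powr p = O((k + 1) powr - ((a2 + a3) * (p - 1)))\<close>, since
\<open>N * (\<nu> / N) powr p = \<nu> * (\<nu> / N) powr (p - 1)\<close>.\<close>

lemma summable_radius_noise:
  fixes n :: "nat \<Rightarrow> 'w \<Rightarrow> 'a::real_normed_vector"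
  assumes int: "\<And>k. integrable M (\<lambda>\<omega>. norm (n k \<omega>) powr p)"
    and rec: "\<And>k. (\<integral>\<omega>. norm (n (Suc k) \<omega>) powr p \<partial>M) \<le> (1 - \<nu> (Suc k)) * (\<integral>\<omega>. norm (n k \<omega>) powr p \<partial>M)
      + 6 * K * real (N (Suc k)) * (\<nu> (Suc k) / real (N (Suc k))) powr p"
    and "0 \<le> K" and p: "1 < p" "p \<le> 2"
    and \<Delta>: "\<And>k. \<Delta> k = \<Delta>0 / real (k + 1) powr a1" and \<nu>: "\<And>k. \<nu> k = \<nu>0 / real (k + 1) powr a2"
    and N: "\<And>k. real (k + 1) powr a3 \<le> real (N k)"
    and "0 < \<Delta>0" "0 < \<nu>0" "\<nu>0 \<le> 1" "0 < a2" "a2 < 1" "0 \<le> a3"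
    and a: "a1 + (a2 + a3) * (p - 1) / p > 1"
  shows "AE \<omega> in M. summable (\<lambda>k. \<Delta> k * norm (n k \<omega>))"
proof -
  define \<beta> where "\<beta> = (a2 + a3) * (p - 1)"
  have \<beta>: "0 \<le> \<beta>" using assms by (simp add: \<beta>_def)
  define y where "y k = (\<integral>\<omega>. norm (n k \<omega>) powr p \<partial>M)" for k
  have step: "y (Suc k) \<le> (1 - \<nu>0 / real (k + 2) powr a2) * y k
      + 6 * K * (\<nu>0 / real (k + 2) powr a2) * real (k + 2) powr (- \<beta>)" for k
  proof -
    let ?N = "real (N (Suc k))" and ?\<nu> = "\<nu> (Suc k)"
    have N1: "real (k + 2) powr a3 \<le> ?N" using N[of "Suc k"] by (simp add: add.commute)
    have pos: "0 < real (k + 2) powr a3" by simp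
    then have N0: "0 < ?N" using N1 by linarith
    have \<nu>pos: "0 < ?\<nu>" using \<open>0 < \<nu>0\<close> by (simp add: \<nu>)
    have "?\<nu> / ?N \<le> (1 / real (k + 2) powr a2) / real (k + 2) powr a3"
      using N1 pos \<nu>pos \<open>0 < \<nu>0\<close> \<open>\<nu>0 \<le> 1\<close>
      by (intro frac_le) (auto simp: \<nu> add.commute intro!: divide_right_mono)
    also have "\<dots> = real (k + 2) powr (- (a2 + a3))"
      unfolding powr_minus powr_add by (simp add: divide_inverse)
    finally have "(?\<nu> / ?N) powr (p - 1) \<le> (real (k + 2) powr (- (a2 + a3))) powr (p - 1)"
      using p N0 \<nu>pos by (intro powr_mono2) auto
    also have "\<dots> = real (k + 2) powr (- \<beta>)" unfolding powr_powr \<beta>_def by (simp add: algebra_simps)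
    finally have fac: "(?\<nu> / ?N) powr (p - 1) \<le> real (k + 2) powr (- \<beta>)" .
    have base: "(?\<nu> / ?N) powr p = ?\<nu> / ?N * (?\<nu> / ?N) powr (p - 1)"
      using powr_mult_base[of "?\<nu> / ?N" "p - 1"] N0 \<nu>pos by simp
    have "?N * (?\<nu> / ?N) powr p = ?\<nu> * (?\<nu> / ?N) powr (p - 1)"
      unfolding base using N0 by simp
    also have "\<dots> \<le> ?\<nu> * real (k + 2) powr (- \<beta>)" using \<nu>pos fac by (intro mult_left_mono) auto
    finally have "6 * K * (?N * (?\<nu> / ?N) powr p) \<le> 6 * K * (?\<nu> * real (k + 2) powr (- \<beta>))"
      using \<open>0 \<le> K\<close> by (intro mult_left_mono) auto
    then show ?thesis using rec[of k] by (simp add: y_def \<nu> mult.assoc add.commute)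
  qed
  have y: "0 \<le> y k" and K6: "0 \<le> 6 * K" for k using \<open>0 \<le> K\<close> by (auto simp: y_def)
  obtain D where D: "\<And>k. y k \<le> D * real (k + 1) powr (- \<beta>)"
    using momentum_recursion_decay[OF \<open>0 < \<nu>0\<close> \<open>\<nu>0 \<le> 1\<close> \<open>0 < a2\<close> \<open>a2 < 1\<close> \<beta> K6 y step] by blast
  \<comment> \<open>The expected size of the noise; the norm is bounded by \<open>s k\<close> plus a multiple of its \<open>p\<close>-th power.\<close>
  define s where "s k = real (k + 1) powr (- (\<beta> / p))" for k
  have s: "0 < s k" for k by (simp add: s_def)
  have \<Delta>s: "summable (\<lambda>k. \<Delta> k * s k)"
  proof -
    have "summable (\<lambda>k. \<Delta>0 * real (k + 1) powr (- (a1 + \<beta> / p)))"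
      using a by (intro summable_mult) (simp only: summable_powr_Suc_iff \<beta>_def)
    also have "(\<lambda>k. \<Delta>0 * real (k + 1) powr (- (a1 + \<beta> / p))) = (\<lambda>k. \<Delta> k * s k)"
      by (simp add: fun_eq_iff \<Delta> s_def powr_add powr_minus field_simps powr_diff)
    finally show ?thesis .
  qed
  have \<Delta>0: "0 \<le> \<Delta> k" for k using \<open>0 < \<Delta>0\<close> by (simp add: \<Delta>)
  have young: "\<Delta> k * norm (n k \<omega>) \<le> \<Delta> k * s k + \<Delta> k * s k powr (1 - p) * norm (n k \<omega>) powr p" for k \<omega>
  proof -
    have "norm (n k \<omega>) \<le> s k + s k powr (1 - p) * norm (n k \<omega>) powr p"
    proof (cases "norm (n k \<omega>) \<le> s k")
      case False
      have "norm (n k \<omega>) powr (1 - p) \<le> s k powr (1 - p)"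
        using False s[of k] p by (intro powr_mono2') auto
      then have "norm (n k \<omega>) powr (1 - p) * norm (n k \<omega>) powr p \<le> s k powr (1 - p) * norm (n k \<omega>) powr p"
        by (intro mult_right_mono) auto
      then show ?thesis using False s[of k] by (simp flip: powr_add)
    qed (simp add: add_increasing2)
    then have "\<Delta> k * norm (n k \<omega>) \<le> \<Delta> k * (s k + s k powr (1 - p) * norm (n k \<omega>) powr p)"
      using \<Delta>0 by (intro mult_left_mono) auto
    then show ?thesis by (simp add: algebra_simps)
  qed
  have "AE \<omega> in M. summable (\<lambda>k. \<Delta> k * s k powr (1 - p) * norm (n k \<omega>) powr p)"
  proof (rule AE_summable_of_summable_expectations)
    show "integrable M (\<lambda>\<omega>. \<Delta> k * s k powr (1 - p) * norm (n k \<omega>) powr p)" for k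
      using int by simp
    show "0 \<le> \<Delta> k * s k powr (1 - p) * norm (n k \<omega>) powr p" for k \<omega> using \<Delta>0 by simp
    show "summable (\<lambda>k. \<integral>\<omega>. \<Delta> k * s k powr (1 - p) * norm (n k \<omega>) powr p \<partial>M)"
    proof (rule summable_comparison_test'[where N = 0])
      show "summable (\<lambda>k. D * (\<Delta> k * s k))" by (intro summable_mult \<Delta>s)
      fix k
      have sp: "s k powr (1 - p) * real (k + 1) powr (- \<beta>) = s k"
      proof -
        have "real (k + 1) powr (- \<beta>) = s k powr p" using p by (simp add: s_def powr_powr)
        then show ?thesis using s[of k] by (simp flip: powr_add)
      qed
      have "norm (\<integral>\<omega>. \<Delta> k * s k powr (1 - p) * norm (n k \<omega>) powr p \<partial>M) = \<Delta> k * s k powr (1 - p) * y k"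
        using \<Delta>0[of k] by (simp add: y_def abs_mult)
      also have "\<dots> \<le> \<Delta> k * s k powr (1 - p) * (D * real (k + 1) powr (- \<beta>))"
        using D[of k] \<Delta>0[of k] by (intro mult_left_mono) auto
      also have "\<dots> = D * (\<Delta> k * (s k powr (1 - p) * real (k + 1) powr (- \<beta>)))" by (simp add: mult_ac)
      finally show "norm (\<integral>\<omega>. \<Delta> k * s k powr (1 - p) * norm (n k \<omega>) powr p \<partial>M) \<le> D * (\<Delta> k * s k)"
        by (simp only: sp)
    qed
  qed
  then show ?thesis
  proof eventually_elim
    case (elim \<omega>)
    show ?case
    proof (rule summable_comparison_test'[where N = 0])
      show "summable (\<lambda>k. \<Delta> k * s k + \<Delta> k * s k powr (1 - p) * norm (n k \<omega>) powr p)"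
        by (intro summable_add \<Delta>s elim)
      show "norm (\<Delta> k * norm (n k \<omega>)) \<le> \<Delta> k * s k + \<Delta> k * s k powr (1 - p) * norm (n k \<omega>) powr p" for k
        using young[of k \<omega>] \<Delta>0[of k] by simp
    qed
  qed
qed

section \<open>Almost sure convergence\<close>

theorem theorem3p6:
  fixes M :: "'w measure" and P :: "'s measure"
    and F :: "real^'d \<Rightarrow> 's \<Rightarrow> real" and f :: "real^'d \<Rightarrow> real"
    and c :: "real^'d \<Rightarrow> real^'m"
    and \<Omega> :: "(real^'d) set"
    and \<xi> :: "nat \<Rightarrow> nat \<Rightarrow> 'w \<Rightarrow> 's"
    and B :: "nat \<Rightarrow> 'w \<Rightarrow> real^'d^'d"
    and Z :: "nat \<Rightarrow> 'w \<Rightarrow> nat \<Rightarrow> real^'d"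
    and u :: "nat \<Rightarrow> 'w \<Rightarrow> nat \<Rightarrow> real"
    and x m :: "nat \<Rightarrow> 'w \<Rightarrow> real^'d"
    and x0 m_init :: "real^'d"
    and \<Delta> \<nu> :: "nat \<Rightarrow> real" and N :: "nat \<Rightarrow> nat"
    and \<theta> \<eta> f_inf L_f L_G \<kappa>_B \<kappa>_c \<kappa>_f \<kappa>_1G \<kappa>_2G p \<sigma>0 \<Delta>0 \<nu>0 N0 a1 a2 a3 :: real
  defines "\<F> \<equiv> sample_filtration M P N \<xi>"
  assumes "prob_space M" and "prob_space P"
    \<comment> \<open>the objective\<close>
    and F_integrable: "\<And>y. y \<in> \<Omega> \<Longrightarrow> integrable P (F y)"
    and f_def: "\<And>y. f y = (\<integral>s. F y s \<partial>P)"
    and F_diff: "\<And>y s. y \<in> \<Omega> \<Longrightarrow> s \<in> space P \<Longrightarrow> (\<lambda>z. F z s) differentiable (at y)"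
    \<comment> \<open>the method\<close>
    and "0 < \<theta>" "\<theta> < 1" "0 < \<eta>" "\<eta> \<le> 1"
    and run: "\<And>\<omega>. \<omega> \<in> space M \<Longrightarrow>
      tr_ssqp_run F c \<theta> \<eta> \<Delta> \<nu> N x0 m_init (\<lambda>k i. \<xi> k i \<omega>)
        (\<lambda>k. B k \<omega>) (\<lambda>k. Z k \<omega>) (\<lambda>k. u k \<omega>) (\<lambda>k. x k \<omega>) (\<lambda>k. m k \<omega>)"
    and adapted: "\<And>k. x k \<in> borel_measurable (\<F> k)"
    \<comment> \<open>Assumption (R)\<close>
    and "open \<Omega>" "convex \<Omega>"
    and iterates: "\<And>k \<omega>. \<omega> \<in> space M \<Longrightarrow> x k \<omega> \<in> \<Omega>"
    and f_diff: "\<And>y. y \<in> \<Omega> \<Longrightarrow> f differentiable (at y)"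
    and f_C1: "continuous_on \<Omega> (gradient f)"
    and f_bound: "\<And>y. y \<in> \<Omega> \<Longrightarrow> f_inf \<le> f y"
    and "0 < L_f" and f_lip: "L_f-lipschitz_on \<Omega> (gradient f)"
    and c_diff: "\<And>y. y \<in> \<Omega> \<Longrightarrow> c differentiable (at y)"
    and c_C1: "continuous_on \<Omega> (jacobian_at c)"
    and G_lip: "\<And>y z. y \<in> \<Omega> \<Longrightarrow> z \<in> \<Omega> \<Longrightarrow>
      opnorm (jacobian_at c y - jacobian_at c z) \<le> L_G * norm (y - z)"
    and "0 < \<kappa>_B" "0 < \<kappa>_c" "0 < \<kappa>_f" "0 < \<kappa>_1G" "0 < \<kappa>_2G"
    and bounds: "\<And>k \<omega>. \<omega> \<in> space M \<Longrightarrow>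
      opnorm (B k \<omega>) \<le> \<kappa>_B \<and>
      norm (c (x k \<omega>)) \<le> \<kappa>_c \<and>
      norm (gradient f (x k \<omega>)) \<le> \<kappa>_f \<and>
      mat \<kappa>_1G \<preceq>\<^sub>L jacobian_at c (x k \<omega>) ** transpose (jacobian_at c (x k \<omega>)) \<and>
      jacobian_at c (x k \<omega>) ** transpose (jacobian_at c (x k \<omega>)) \<preceq>\<^sub>L mat \<kappa>_2G"
    \<comment> \<open>Assumption (S)\<close>
    and iid: "\<And>k. cond_iid M (\<F> k) P {1..N k} (\<xi> k)"
    and unbiased: "\<And>k i j. i \<in> {1..N k} \<Longrightarrow>
      (AE \<omega> in M. real_cond_exp M (\<F> k) (\<lambda>\<omega>. gradient (\<lambda>y. F y (\<xi> k i \<omega>)) (x k \<omega>) $ j) \<omega>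
                    = gradient f (x k \<omega>) $ j)"
    and "1 < p" "p \<le> 2" "0 \<le> \<sigma>0"
    and moment: "\<And>k i. i \<in> {1..N k} \<Longrightarrow>
      (AE \<omega> in M. nn_cond_exp M (\<F> k)
          (\<lambda>\<omega>. ennreal (norm (gradient (\<lambda>y. F y (\<xi> k i \<omega>)) (x k \<omega>) - gradient f (x k \<omega>)) powr p)) \<omega>
        \<le> ennreal (\<sigma>0 powr p))"
    \<comment> \<open>parameter choices\<close>
    and "0 < \<Delta>0" "0 < \<nu>0" "\<nu>0 \<le> 1" "1 \<le> N0"
    and \<Delta>_eq: "\<And>k. \<Delta> k = \<Delta>0 / real (k + 1) powr a1"
    and \<nu>_eq: "\<And>k. \<nu> k = \<nu>0 / real (k + 1) powr a2"
    and N_eq: "\<And>k. N k = nat \<lceil>N0 * real (k + 1) powr a3\<rceil>"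
    and "0.5 < a1" "a1 \<le> 1" "0 < a2" "a2 < 2 * a1 - 1" "0 \<le> a3"
    and "a1 + (a2 + a3) * (p - 1) / p > 1"
  shows "AE \<omega> in M.
    (\<lambda>k. norm (gradient f (x k \<omega>)
              + transpose (jacobian_at c (x k \<omega>)) *v
                  lagrange_multiplier (jacobian_at c (x k \<omega>)) (gradient f (x k \<omega>)))
         + norm (c (x k \<omega>))) \<longlonglongrightarrow> 0"
proof -
  interpret M: prob_space M by fact
  have rpow: "0 < real (k + 1) powr a" for k :: nat and a :: real by simp
  have r1: "1 \<le> real (k + 1) powr a" if "0 \<le> a" for k :: nat and a :: real
    using that by (intro ge_one_powr_ge_zero) auto
  have \<nu>01: "0 \<le> \<nu> k" "\<nu> k \<le> 1" for k
    using r1[of a2 k] \<open>0 < a2\<close> \<open>0 < \<nu>0\<close> \<open>\<nu>0 \<le> 1\<close> by (auto simp: \<nu>_eq divide_simps)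
  have N_ge: "real (k + 1) powr a3 \<le> real (N k)" for k
  proof -
    have "real (k + 1) powr a3 \<le> N0 * real (k + 1) powr a3"
      using \<open>1 \<le> N0\<close> rpow[of k a3] by simp
    also have "\<dots> \<le> real (N k)" unfolding N_eq by (rule real_nat_ceiling_ge)
    finally show ?thesis .
  qed
  have N_pos: "0 < N k" for k
    using order_trans[OF r1[OF \<open>0 \<le> a3\<close>] N_ge[of k]] by simp
  have \<Delta>_pos: "0 < \<Delta> k" and \<Delta>_le: "\<Delta> k \<le> \<Delta>0" for k
    using r1[of a1 k] \<open>0.5 < a1\<close> \<open>0 < \<Delta>0\<close> by (auto simp: \<Delta>_eq divide_simps)

  have \<xi>M: "\<xi> k i \<in> measurable M P" if "i \<in> {1..N k}" for k i
    using iid[of k] that by (simp add: cond_iid_def)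
  have sub: "subalgebra M (\<F> k)" for k
    unfolding \<F>_def by (rule subalgebra_sample_filtration) (rule \<xi>M)
  have mono: "sets (\<F> k) \<subseteq> sets (\<F> (Suc k))" for k
    unfolding \<F>_def by (rule sample_filtration_mono) (rule \<xi>M)
  have \<xi>F: "\<xi> k i \<in> measurable (\<F> (Suc k)) P" if "i \<in> {1..N k}" for k i
    unfolding \<F>_def using that by (intro measurable_sample_filtration \<xi>M)
  have spF: "space (\<F> k) = space M" for k using sub by (simp add: subalgebra_def)

  \<comment> \<open>The error of the gradient at the iterate \<open>x k\<close> for the sample \<open>s\<close>.\<close>
  define V where "V k \<omega> s = gradient (\<lambda>y. F y s) (x k \<omega>) - gradient f (x k \<omega>)" for k \<omega> s
  have grad_f: "(\<lambda>\<omega>. gradient f (x k \<omega>)) \<in> borel_measurable (\<F> k)" for k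
  proof -
    have "(\<lambda>y. indicator \<Omega> y *\<^sub>R gradient f y) \<in> borel_measurable borel"
      using \<open>open \<Omega>\<close> f_C1 by (intro borel_measurable_continuous_on_indicator) auto
    from measurable_compose[OF adapted this] show ?thesis
      by (rule measurable_cong[THEN iffD1, rotated]) (simp add: spF iterates)
  qed
  have grad_F: "(\<lambda>(\<omega>, s). gradient (\<lambda>y. F y s) (x k \<omega>)) \<in> borel_measurable (\<F> k \<Otimes>\<^sub>M P)" for k
    using F_integrable adapted
    by (intro gradient_compose_measurable[OF \<open>open \<Omega>\<close> _ F_diff]) (auto simp: spF iterates)
  have V: "(\<lambda>(\<omega>, s). V k \<omega> s) \<in> borel_measurable (\<F> k \<Otimes>\<^sub>M P)" for k
    using borel_measurable_diff[OF grad_F measurable_compose[OF measurable_fst grad_f]]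
    by (simp add: V_def case_prod_beta')
  have pair: "(\<lambda>\<omega>. (\<omega>, \<xi> k i \<omega>)) \<in> measurable M (\<F> k \<Otimes>\<^sub>M P)" if "i \<in> {1..N k}" for k i
  proof (rule measurable_Pair[OF _ \<xi>M[OF that]])
    show "(\<lambda>\<omega>. \<omega>) \<in> measurable M (\<F> k)"
      using sub[of k] by (intro measurableI) (auto simp: subalgebra_def)
  qed
  have VM: "(\<lambda>\<omega>. V k \<omega> (\<xi> k i \<omega>)) \<in> borel_measurable M" if "i \<in> {1..N k}" for k i
    using measurable_compose[OF pair[OF that] V] by simp
  have grad_FM: "(\<lambda>\<omega>. gradient (\<lambda>y. F y (\<xi> k i \<omega>)) (x k \<omega>)) \<in> borel_measurable M" if "i \<in> {1..N k}" for k i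
    using measurable_compose[OF pair[OF that] grad_F] by simp
  have mom: "integrable M (\<lambda>\<omega>. norm (V k \<omega> (\<xi> k i \<omega>)) powr p)"
    "(\<integral>\<omega>. norm (V k \<omega> (\<xi> k i \<omega>)) powr p \<partial>M) \<le> \<sigma>0 powr p" if i: "i \<in> {1..N k}" for k i
  proof -
    have [measurable]: "(\<lambda>\<omega>. norm (V k \<omega> (\<xi> k i \<omega>)) powr p) \<in> borel_measurable M" using VM[OF i] by measurable
    have ae: "AE \<omega> in M. nn_cond_exp M (\<F> k) (\<lambda>\<omega>. ennreal (norm (V k \<omega> (\<xi> k i \<omega>)) powr p)) \<omega> \<le> ennreal (\<sigma>0 powr p)"
      using moment[OF i] by (simp add: V_def)
    show "integrable M (\<lambda>\<omega>. norm (V k \<omega> (\<xi> k i \<omega>)) powr p)"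
      "(\<integral>\<omega>. norm (V k \<omega> (\<xi> k i \<omega>)) powr p \<partial>M) \<le> \<sigma>0 powr p"
      using integrable_of_cond_moment[OF \<open>prob_space M\<close> sub _ _ _ ae] by auto
  qed
  have zero: "AE \<omega> in M. real_cond_exp M (\<F> k) (\<lambda>\<omega>. V k \<omega> (\<xi> k i \<omega>) $ j) \<omega> = 0"
    if i: "i \<in> {1..N k}" for k i j
  proof -
    interpret finite_measure_subalgebra M "\<F> k" by unfold_locales (rule sub)
    let ?g = "\<lambda>\<omega>. gradient f (x k \<omega>) $ j" and ?G = "\<lambda>\<omega>. gradient (\<lambda>y. F y (\<xi> k i \<omega>)) (x k \<omega>) $ j"
    have gF: "?g \<in> borel_measurable (\<F> k)" by (rule borel_measurable_vec_component[OF grad_f])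
    then have gM: "?g \<in> borel_measurable M" by (rule measurable_from_subalg[OF sub])
    have "norm (?g \<omega>) \<le> \<kappa>_f" if "\<omega> \<in> space M" for \<omega>
      using bounds[OF that, of k] component_le_norm_cart[of "gradient f (x k \<omega>)" j] by simp
    then have gI: "integrable M ?g" using gM by (intro M.integrable_const_bound[of _ \<kappa>_f] AE_I2) auto
    have VI: "integrable M (\<lambda>\<omega>. V k \<omega> (\<xi> k i \<omega>) $ j)"
      by (rule integrable_vec_component_of_moment[OF \<open>prob_space M\<close> VM[OF i] mom(1)[OF i] \<open>1 < p\<close>])
    have GI: "integrable M ?G"
      using Bochner_Integration.integrable_add[OF VI gI] by (simp add: V_def)
    have "AE \<omega> in M. real_cond_exp M (\<F> k) (\<lambda>\<omega>. ?G \<omega> - ?g \<omega>) \<omega>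
        = real_cond_exp M (\<F> k) ?G \<omega> - real_cond_exp M (\<F> k) ?g \<omega>"
      by (rule real_cond_exp_diff[OF GI gI])
    moreover have "AE \<omega> in M. real_cond_exp M (\<F> k) ?g \<omega> = ?g \<omega>"
      by (rule real_cond_exp_F_meas[OF gI gF])
    ultimately show ?thesis
      using unbiased[OF i, of j] by eventually_elim (simp add: V_def)
  qed

  \<comment> \<open>The error of the batch average \<open>g k\<close>; its moving average is the noise part of the momentum error.\<close>
  define d where "d \<omega> k = (1 / real (N k)) *\<^sub>R (\<Sum>i\<in>{1..N k}. V k \<omega> (\<xi> k i \<omega>))" for \<omega> k
  have noise: "AE \<omega> in M. summable (\<lambda>k. \<Delta> k * norm (moving_average \<nu> (d \<omega>) k))"
  proof (rule summable_radius_noise[where p = p and K = "\<sigma>0 powr p", OF _ _ _ _ _ \<Delta>_eq \<nu>_eq N_ge])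
    note rec = noise_moment_recursion[where M = M and P = P and \<F> = \<F> and N = N and \<xi> = \<xi>
        and \<nu> = \<nu> and V = V and p = p and K = "\<sigma>0 powr p"]
    note facts = \<open>prob_space M\<close> \<open>prob_space P\<close> sub mono iid \<xi>F \<open>1 < p\<close> \<open>p \<le> 2\<close> \<nu>01 V mom zero
    show "integrable M (\<lambda>\<omega>. norm (moving_average \<nu> (d \<omega>) k) powr p)" for k
      unfolding d_def[abs_def] by (rule rec(1)) (assumption | rule facts)+
    show "(\<integral>\<omega>. norm (moving_average \<nu> (d \<omega>) (Suc k)) powr p \<partial>M)
        \<le> (1 - \<nu> (Suc k)) * (\<integral>\<omega>. norm (moving_average \<nu> (d \<omega>) k) powr p \<partial>M)
          + 6 * \<sigma>0 powr p * real (N (Suc k)) * (\<nu> (Suc k) / real (N (Suc k))) powr p" for k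
      unfolding d_def[abs_def] by (rule rec(2)) (assumption | rule facts)+
    show "a2 < 1" using \<open>a2 < 2 * a1 - 1\<close> \<open>a1 \<le> 1\<close> by linarith
  qed (rule powr_ge_zero \<open>1 < p\<close> \<open>p \<le> 2\<close> \<open>0 < \<Delta>0\<close> \<open>0 < \<nu>0\<close> \<open>\<nu>0 \<le> 1\<close> \<open>0 < a2\<close> \<open>0 \<le> a3\<close>
      \<open>a1 + (a2 + a3) * (p - 1) / p > 1\<close>)+

  show ?thesis
    using noise AE_space[of M]
  proof eventually_elim
    case (elim \<omega>)
    note noise = elim(1) and \<omega> = elim(2)
    define g where "g k = (1 / real (N k)) *\<^sub>R (\<Sum>i\<in>{1..N k}. gradient (\<lambda>y. F y (\<xi> k i \<omega>)) (x k \<omega>))" for k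
    define q where "q k = gradient f (x k \<omega>)" for k
    let ?r = "CARD('d) - CARD('m)"
    have x_step: "let w = normal_step \<theta> (\<Delta> k) (jacobian_at c (x k \<omega>)) (c (x k \<omega>)) in
        tangential_solution ?r \<eta> (Z k \<omega>) (B k \<omega>) (m k \<omega> + B k \<omega> *v w) (sqrt ((\<Delta> k)\<^sup>2 - (norm w)\<^sup>2)) (u k \<omega>) \<and>
        x (Suc k) \<omega> = x k \<omega> + (w + zmult ?r (Z k \<omega>) (u k \<omega>))"
      and basis: "kernel_basis ?r (jacobian_at c (x k \<omega>)) (Z k \<omega>)"
      and m_step: "m k \<omega> = (1 - \<nu> k) *\<^sub>R (if k = 0 then m_init else m (k - 1) \<omega>) + \<nu> k *\<^sub>R g k" for k
      unfolding g_def Let_def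
      using run[OF \<omega>, unfolded tr_ssqp_run_def Let_def, THEN conjunct2, THEN spec, of k] by blast+
    have d_eq: "d \<omega> k = g k - q k" for k
      using N_pos[of k] by (simp add: d_def g_def q_def V_def sum_subtractf scaleR_diff_right
          sum_constant_scaleR del: sum_constant)
    have \<kappa>bounds: "opnorm (B k \<omega>) \<le> \<kappa>_B" "norm (c (x k \<omega>)) \<le> \<kappa>_c" "norm (gradient f (x k \<omega>)) \<le> \<kappa>_f"
      "mat \<kappa>_1G \<preceq>\<^sub>L jacobian_at c (x k \<omega>) ** transpose (jacobian_at c (x k \<omega>))"
      "jacobian_at c (x k \<omega>) ** transpose (jacobian_at c (x k \<omega>)) \<preceq>\<^sub>L mat \<kappa>_2G" for k
      using bounds[OF \<omega>, of k] by blast+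
    \<comment> \<open>The constant \<open>L_G\<close> is replaced by its positive part, as its sign is not known.\<close>
    interpret tr_ssqp_path f c \<Omega> "\<lambda>k. B k \<omega>" "\<lambda>k. Z k \<omega>" "\<lambda>k. u k \<omega>" "\<lambda>k. x k \<omega>" "\<lambda>k. m k \<omega>" \<Delta> ?r
      \<theta> \<eta> f_inf L_f "max L_G 0" \<kappa>_B \<kappa>_c \<kappa>_f \<kappa>_1G \<kappa>_2G \<Delta>0
    proof unfold_locales
      fix y z assume "y \<in> \<Omega>" "z \<in> \<Omega>"
      then have "opnorm (jacobian_at c y - jacobian_at c z) \<le> L_G * norm (y - z)" by (rule G_lip)
      also have "\<dots> \<le> max L_G 0 * norm (y - z)" by (intro mult_right_mono) auto
      finally show "opnorm (jacobian_at c y - jacobian_at c z) \<le> max L_G 0 * norm (y - z)" .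
    next
      show "0 \<le> max L_G 0" by simp
    qed (assumption | rule \<open>0 < \<theta>\<close> \<open>\<theta> < 1\<close> \<open>0 < \<eta>\<close> \<open>\<eta> \<le> 1\<close> \<open>convex \<Omega>\<close> iterates[OF \<omega>] f_diff f_bound f_lip c_diff
        \<open>0 < \<kappa>_B\<close> \<open>0 < \<kappa>_c\<close> \<open>0 < \<kappa>_f\<close> \<open>0 < \<kappa>_1G\<close> \<open>0 < \<kappa>_2G\<close> \<kappa>bounds \<Delta>_pos \<Delta>_le basis x_step)+
    have "residual \<longlonglongrightarrow> 0"
    proof (rule residual_tendsto_zero)
      have "(\<lambda>k. (\<Delta> k)\<^sup>2) = (\<lambda>k. \<Delta>0\<^sup>2 * real (k + 1) powr (- (2 * a1)))"
      proof
        fix k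
        have "(real (k + 1) powr a1)\<^sup>2 = real (k + 1) powr (2 * a1)"
          by (simp add: power2_eq_square flip: powr_add)
        then show "(\<Delta> k)\<^sup>2 = \<Delta>0\<^sup>2 * real (k + 1) powr (- (2 * a1))"
          by (simp only: \<Delta>_eq powr_minus divide_inverse power_mult_distrib power_inverse)
      qed
      moreover have "summable (\<lambda>k. real (k + 1) powr (- (2 * a1)))"
        using \<open>0.5 < a1\<close> by (simp only: summable_powr_Suc_iff)
      ultimately show "summable (\<lambda>k. (\<Delta> k)\<^sup>2)" by (simp only: summable_mult)
      have "\<Delta> = (\<lambda>k. \<Delta>0 * real (k + 1) powr (- a1))"
        by (simp only: fun_eq_iff \<Delta>_eq powr_minus divide_inverse) simp
      moreover have "\<not> summable (\<lambda>k. real (k + 1) powr (- a1))"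
        using \<open>a1 \<le> 1\<close> by (simp only: summable_powr_Suc_iff)
      ultimately show "\<not> summable \<Delta>" using \<open>0 < \<Delta>0\<close> by (simp only: summable_cmult_iff) simp
      have drift: "summable (\<lambda>k. \<Delta> k * norm (m k \<omega> - q k - moving_average \<nu> (\<lambda>k. g k - q k) k))"
      proof (rule momentum_drift_summable[OF m_step _ _ \<Delta>_eq \<nu>_eq])
        fix k
        have "norm (q (Suc k) - q k) \<le> L_f * norm (x (Suc k) \<omega> - x k \<omega>)"
          using lipschitz_onD[OF f_lip iterates iterates] by (simp add: q_def dist_norm)
        also have "\<dots> \<le> L_f * \<Delta> k" using norm_step_le \<open>0 < L_f\<close> by (intro mult_left_mono) auto
        finally show "norm (q (Suc k) - q k) \<le> L_f * \<Delta> k" .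
      qed (use \<open>0 < L_f\<close> \<open>0 < \<Delta>0\<close> \<open>0 < \<nu>0\<close> \<open>\<nu>0 \<le> 1\<close> \<open>a1 \<le> 1\<close> \<open>0 < a2\<close> \<open>a2 < 2 * a1 - 1\<close> in linarith)+
      show "summable (\<lambda>k. \<Delta> k * norm (m k \<omega> - gradient f (x k \<omega>)))"
      proof (rule summable_comparison_test'[where N = 0])
        show "summable (\<lambda>k. \<Delta> k * norm (m k \<omega> - q k - moving_average \<nu> (\<lambda>k. g k - q k) k)
            + \<Delta> k * norm (moving_average \<nu> (d \<omega>) k))"
          by (rule summable_add[OF drift noise])
        fix k
        let ?n = "moving_average \<nu> (\<lambda>k. g k - q k) k"
        have "norm (m k \<omega> - q k) \<le> norm (m k \<omega> - q k - ?n) + norm ?n"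
          using norm_triangle_ineq[of "m k \<omega> - q k - ?n" ?n] by simp
        then have "\<Delta> k * norm (m k \<omega> - q k) \<le> \<Delta> k * (norm (m k \<omega> - q k - ?n) + norm ?n)"
          using \<Delta>_pos[of k] by (intro mult_left_mono) auto
        moreover have "moving_average \<nu> (d \<omega>) k = ?n" by (simp add: d_eq[abs_def])
        ultimately show "norm (\<Delta> k * norm (m k \<omega> - gradient f (x k \<omega>)))
            \<le> \<Delta> k * norm (m k \<omega> - q k - ?n) + \<Delta> k * norm (moving_average \<nu> (d \<omega>) k)"
          using \<Delta>_pos[of k] by (simp add: q_def distrib_left)
      qed
    qed
    then show ?case by (simp add: projected_gradient_def)
  qed
qed

end
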